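(* Let $\mathcal{X}$ be a simplicial complex with underlying polytope $X$, let $\mathcal{V}$ be a combinatorial vector field on $\mathcal{X}$, and let $0<\epsilon<\frac{1}{1+\dim\mathcal{X}}$. Let $\mathcal{S}\subset\mathcal{X}$ be an isolated invariant set for the multivalued map $\Pi_{\mathcal{V}}$, and let $\varphi:\mathbb{R}_0^+\times X\to X$ be an arbitrary admissible semiflow for $\mathcal{V}$. Then the set $$B:=\bigcup_{\sigma\in\mathcal{S}}\operatorname{cl}\langle\sigma\rangle_\epsilon$$ is an isolating block for $\varphi$, and $$H_*(\operatorname{Cl}\mathcal{S},\operatorname{Mo}\mathcal{S})\;\cong\;H_*(B,B^-),$$ where the left-hand side is simplicial homology and the right-hand side is singular homology. In other words, every isolated invariant set $\mathcal{S}$ of $\mathcal{V}$ gives rise to an isolated invariant set (namely $\operatorname{Inv}(B,\varphi)$) for $\varphi$ with the same Conley index.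
   Context: **Simplicial complexes.** A simplicial complex $\mathcal{X}$ is a finite collection of nonempty finite sets (simplices) such that every nonempty subset of a simplex is a simplex. $\dim\sigma=\#\sigma-1$, $\dim\mathcal{X}$ is the maximal dimension of its simplices, $\mathcal{X}_0=\bigcup\mathcal{X}$ is the vertex set, $d:=\#\mathcal{X}_0$. A face of $\sigma$ is a nonempty subset of $\sigma$; a facet of $\sigma$ is a face $\tau$ with $\dim\tau=\dim\sigma-1$. For $\mathcal{A}\subset\mathcal{X}$, $\operatorname{Cl}\mathcal{A}$ is the set of all faces of simplices in $\mathcal{A}$; $\mathcal{A}$ is combinatorially closed if $\operatorname{Cl}\mathcal{A}=\mathcal{A}$. For a simplex $\sigma$, $\operatorname{Cl}\sigma$ is the set of all faces of $\sigma$ and $\operatorname{Bd}\sigma$ the set of all proper faces. Index coordinates of $\mathbb{R}^d$ by $\mathcal{X}_0$; the underlying polytope (of the standard geometric realization) is $X=\{x\in\mathbb{R}^d: x_v\ge 0,\ \sum_{v}x_v=1,\ \{v: x_v>0\}\in\mathcal{X}\}$ with the subspace topology; $\operatorname{cl},\operatorname{int},\operatorname{bd}$ are taken in $X$. **Combinatorial vector field.** A combinatorial vector field $\mathcal{V}$ on $\mathcal{X}$ is a partition of $\mathcal{X}$ into singletons and doubletons such that each doubleton consists of a simplex and one of its facets. If $\{\sigma\}\in\mathcal{V}$, $\sigma$ is critical ($\sigma\in\operatorname{Crit}\mathcal{V}$). A doubleton $\{\tau,\sigma\}\in\mathcal{V}$ with $\tau$ a facet of $\sigma$ is an arrow with tail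 $\tau\in\operatorname{Tail}\mathcal{V}$ and head $\sigma\in\operatorname{Head}\mathcal{V}$; write $\mathcal{V}(\tau)=\sigma$, $\mathcal{V}^{-1}(\sigma)=\tau$. For a simplex $\omega$: if $\omega$ is critical, $\omega^-=\omega^+=\omega$; if $\omega$ belongs to an arrow with tail $\tau$ and head $\sigma$, $\omega^-=\tau$, $\omega^+=\sigma$. The multivalued map $\Pi_{\mathcal{V}}:\mathcal{X}\multimap\mathcal{X}$ is $\Pi_{\mathcal{V}}(\sigma)=\operatorname{Cl}\sigma$ if $\sigma\in\operatorname{Crit}\mathcal{V}$, $\{\mathcal{V}(\sigma)\}$ if $\sigma\in\operatorname{Tail}\mathcal{V}$, and $\operatorname{Bd}\sigma\setminus\{\mathcal{V}^{-1}(\sigma)\}$ if $\sigma\in\operatorname{Head}\mathcal{V}$. A solution is a map $\rho$ from an interval of $\mathbb{Z}$ to $\mathcal{X}$ with $\rho_{k+1}\in\Pi_{\mathcal{V}}(\rho_k)$ whenever $k,k+1\in\operatorname{dom}\rho$; it is full if its domain is $\mathbb{Z}$, and through $\sigma$ if $\rho_0=\sigma$. $\mathcal{S}\subset\mathcal{X}$ is invariant if through every $\sigma\in\mathcal{S}$ there is a full solution with values in $\mathcal{S}$. Put $\operatorname{Mo}\mathcal{S}:=\operatorname{Cl}\mathcal{S}\setminus\mathcal{S}$. An invariant set $\mathcal{S}$ is an isolated invariant set if (a) $\operatorname{Mo}\mathcal{S}$ is combinatorially closed and (b) there is no solution $\rho:\{-1,0,1\}\to\mathcal{X}$ with $\rho_{-1},\rho_1\in\mathcal{S}$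 and $\rho_0\in\operatorname{Mo}\mathcal{S}$. Its Conley index is the simplicial homology $H_*(\operatorname{Cl}\mathcal{S},\operatorname{Mo}\mathcal{S})$. **Cells and flow tiles.** For $\sigma\in\mathcal{X}$, $\langle\sigma\rangle_\epsilon:=\{x\in X: x_v>\epsilon\ \forall v\in\sigma,\ x_v<\epsilon\ \forall v\notin\sigma\}$. The flow tiles are the sets $C_\omega:=\operatorname{cl}\langle\omega^-\rangle_\epsilon\cup\operatorname{cl}\langle\omega^+\rangle_\epsilon$, one for each element of $\mathcal{V}$ (critical cell or arrow). For $x\in X$: $\sigma^\epsilon_{\min}(x)=\{v: x_v>\epsilon\}$, $\sigma^\epsilon_{\max}(x)=\{v: x_v\ge\epsilon\}$. **Semiflows.** A semiflow on $X$ is a continuous $\varphi:\mathbb{R}_0^+\times X\to X$ with $\varphi(0,x)=x$, $\varphi(s,\varphi(t,x))=\varphi(s+t,x)$. A solution is a map $\gamma:I\to X$ ($I\subset\mathbb{R}$ an interval) with $\varphi(s,\gamma(t))=\gamma(s+t)$ whenever $s\ge0$, $t,s+t\in I$; it is through $x$ if $0\in I$, $\gamma(0)=x$. $\operatorname{Inv}(N,\varphi)$ is the set of $x\in N$ through which there is a solution $\gamma:\mathbb{R}\to N$. A closed set $S$ with $\operatorname{Inv}S=S$ is an isolated invariant set if it has a closed neighborhood $N$ with $\operatorname{Inv}N=S\subset\operatorname{int}N$. *Admissible:* $\varphi$ is admissible for $\mathcal{V}$ if for every $x\in X$ contained in at least two flow tiles and every solution $\gamma:[t_-,t_+]\to X$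 through $x$ with $t_-\le0<t_+$ there is an open neighborhood $U$ of $0$ in $[t_-,t_+]$ with $\gamma(t)\in\langle\sigma^\epsilon_{\max}(x)\rangle_\epsilon$ for all $t\in U$, $t<0$, and $\gamma(t)\in\langle\sigma^\epsilon_{\min}(x)\rangle_\epsilon$ for all $t\in U$, $t>0$. *Isolating blocks:* Let $B\subset X$ be closed and $x\in\operatorname{bd}B$. $x$ is a strict egress (resp. strict ingress, resp. bounce-off) point if for every solution $\gamma:[\delta_1,\delta_2]\to X$ through $x$ with $\delta_1\le0<\delta_2$ there is a neighborhood $J$ of $0$ in $[\delta_1,\delta_2]$ such that $\gamma(t)\notin B$ for $t\in J$, $t>0$ and $\gamma(t)\in\operatorname{int}B$ for $t\in J$, $t<0$ (resp. $\gamma(t)\in\operatorname{int}B$ for $t\in J$, $t>0$ and $\gamma(t)\notin B$ for $t\in J$, $t<0$; resp. $\gamma(t)\notin B$ for $t\in J\setminus\{0\}$). These sets of points are $B^e,B^i,B^b$; $B^-:=B^e\cup B^b$. $B$ is an isolating block if $\operatorname{bd}B=B^e\cup B^i\cup B^b$ and $B^-$ is closed in $X$. For an isolating block $B$, the Conley index of $\operatorname{Inv}(B,\varphi)$ is $H_*(B,B^-)$. *)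

theory Defs
  imports "HOL-Homology.Homology"
begin

section \<open>Abstract simplicial complexes\<close>

definition abstract_simplicial_complex :: "'v set set \<Rightarrow> bool" where
  "abstract_simplicial_complex K \<longleftrightarrow>
     finite K \<and> (\<forall>\<sigma>\<in>K. \<sigma> \<noteq> {} \<and> finite \<sigma>) \<and> (\<forall>\<sigma>\<in>K. \<forall>\<tau>. \<tau> \<noteq> {} \<and> \<tau> \<subseteq> \<sigma> \<longrightarrow> \<tau> \<in> K)"

definition vertices :: "'v set set \<Rightarrow> 'v set" where
  "vertices K = \<Union>K"

definition simplex_dim :: "'v set \<Rightarrow> int" where
  "simplex_dim \<sigma> = int (card \<sigma>) - 1"

definition complex_dim :: "'v set set \<Rightarrow> int" where
  "complex_dim K = Max (simplex_dim ` K)"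

definition is_face :: "'v set \<Rightarrow> 'v set \<Rightarrow> bool" where
  "is_face \<tau> \<sigma> \<longleftrightarrow> \<tau> \<noteq> {} \<and> \<tau> \<subseteq> \<sigma>"

definition is_facet :: "'v set \<Rightarrow> 'v set \<Rightarrow> bool" where
  "is_facet \<tau> \<sigma> \<longleftrightarrow> is_face \<tau> \<sigma> \<and> simplex_dim \<tau> = simplex_dim \<sigma> - 1"

definition simplicial_closure :: "'v set set \<Rightarrow> 'v set set" where
  "simplicial_closure A = {\<tau>. \<exists>\<sigma>\<in>A. is_face \<tau> \<sigma>}"

definition combinatorially_closed :: "'v set set \<Rightarrow> bool" where
  "combinatorially_closed A \<longleftrightarrow> simplicial_closure A = A"

definition simplex_boundary :: "'v set \<Rightarrow> 'v set set" where
  "simplex_boundary \<sigma> = {\<tau>. is_face \<tau> \<sigma> \<and> \<tau> \<noteq> \<sigma>}"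

definition mouth :: "'v set set \<Rightarrow> 'v set set" where
  "mouth S = simplicial_closure S - S"

text \<open>
  Points of the Euclidean space with coordinates indexed by the vertices are represented as
  functions that vanish off the vertex set. The topology on functions is the product topology,
  which on this set is the usual one because there are finitely many vertices.
\<close>

definition polytope_space :: "'v set set \<Rightarrow> ('v \<Rightarrow> real) topology" where
  "polytope_space K = top_of_set
     {x. (\<forall>v. v \<notin> vertices K \<longrightarrow> x v = 0) \<and> (\<forall>v\<in>vertices K. 0 \<le> x v) \<and>
         (\<Sum>v\<in>vertices K. x v) = 1 \<and> {v\<in>vertices K. x v > 0} \<in> K}"


section \<open>Relative simplicial homology with integer coefficients\<close>

text \<open>
  Simplices are oriented by a linear order \<open>r\<close> of the vertices: with the vertices listed in
  increasing order, the coefficient of the face omitting the vertex at position \<open>i\<close> is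
  \<open>(-1) ^ i\<close>, where \<open>i\<close> is the number of smaller vertices of the simplex.
  The definitions mirror those of \<^const>\<open>relcycle_group\<close> and \<^const>\<open>relative_homology_group\<close>.
\<close>

definition simplicial_chain_group :: "nat \<Rightarrow> 'v set set \<Rightarrow> ('v set \<Rightarrow>\<^sub>0 int) monoid" where
  "simplicial_chain_group p L = free_Abelian_group {\<sigma>\<in>L. card \<sigma> = Suc p}"

definition simplicial_boundary ::
    "'v rel \<Rightarrow> nat \<Rightarrow> ('v set \<Rightarrow>\<^sub>0 int) \<Rightarrow> ('v set \<Rightarrow>\<^sub>0 int)" where
  "simplicial_boundary r p c =
     (if p = 0 then 0 else
      frag_extend (\<lambda>\<sigma>. \<Sum>v\<in>\<sigma>. frag_cmul ((-1) ^ card {w\<in>\<sigma>. w \<noteq> v \<and> (w, v) \<in> r})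
                                       (frag_of (\<sigma> - {v}))) c)"

definition simplicial_relcycles ::
    "'v rel \<Rightarrow> nat \<Rightarrow> 'v set set \<Rightarrow> 'v set set \<Rightarrow> ('v set \<Rightarrow>\<^sub>0 int) set" where
  "simplicial_relcycles r p L M =
     {c \<in> carrier (simplicial_chain_group p L).
        simplicial_boundary r p c \<in> carrier (simplicial_chain_group (p - 1) M)}"

definition simplicial_relboundaries ::
    "'v rel \<Rightarrow> nat \<Rightarrow> 'v set set \<Rightarrow> 'v set set \<Rightarrow> ('v set \<Rightarrow>\<^sub>0 int) set" where
  "simplicial_relboundaries r p L M =
     {c \<in> carrier (simplicial_chain_group p L).
        \<exists>d \<in> carrier (simplicial_chain_group (Suc p) L).
          simplicial_boundary r (Suc p) d - c \<in> carrier (simplicial_chain_group p M)}"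

definition simplicial_homology_group ::
    "'v rel \<Rightarrow> nat \<Rightarrow> 'v set set \<Rightarrow> 'v set set \<Rightarrow> ('v set \<Rightarrow>\<^sub>0 int) set monoid" where
  "simplicial_homology_group r p L M =
     subgroup_generated (simplicial_chain_group p L) (simplicial_relcycles r p L M)
       Mod simplicial_relboundaries r p L M"


section \<open>Combinatorial vector fields\<close>

definition combinatorial_vector_field :: "'v set set \<Rightarrow> 'v set set set \<Rightarrow> bool" where
  "combinatorial_vector_field K V \<longleftrightarrow>
     partition_on K V \<and>
     (\<forall>A\<in>V. (\<exists>\<sigma>. A = {\<sigma>}) \<or> (\<exists>\<tau> \<sigma>. A = {\<tau>, \<sigma>} \<and> is_facet \<tau> \<sigma>))"

definition critical :: "'v set set set \<Rightarrow> 'v set set" where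
  "critical V = {\<sigma>. {\<sigma>} \<in> V}"

definition is_arrow :: "'v set set set \<Rightarrow> 'v set \<Rightarrow> 'v set \<Rightarrow> bool" where
  "is_arrow V \<tau> \<sigma> \<longleftrightarrow> {\<tau>, \<sigma>} \<in> V \<and> is_facet \<tau> \<sigma>"

definition arrow_tails :: "'v set set set \<Rightarrow> 'v set set" where
  "arrow_tails V = {\<tau>. \<exists>\<sigma>. is_arrow V \<tau> \<sigma>}"

definition arrow_heads :: "'v set set set \<Rightarrow> 'v set set" where
  "arrow_heads V = {\<sigma>. \<exists>\<tau>. is_arrow V \<tau> \<sigma>}"

definition head_of :: "'v set set set \<Rightarrow> 'v set \<Rightarrow> 'v set" where
  "head_of V \<tau> = (THE \<sigma>. is_arrow V \<tau> \<sigma>)"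

definition tail_of :: "'v set set set \<Rightarrow> 'v set \<Rightarrow> 'v set" where
  "tail_of V \<sigma> = (THE \<tau>. is_arrow V \<tau> \<sigma>)"

text \<open>The simplices \<open>\<omega>\<^sup>-\<close> and \<open>\<omega>\<^sup>+\<close>.\<close>

definition lower_simplex :: "'v set set set \<Rightarrow> 'v set \<Rightarrow> 'v set" where
  "lower_simplex V \<omega> = (if \<omega> \<in> arrow_heads V then tail_of V \<omega> else \<omega>)"

definition upper_simplex :: "'v set set set \<Rightarrow> 'v set \<Rightarrow> 'v set" where
  "upper_simplex V \<omega> = (if \<omega> \<in> arrow_tails V then head_of V \<omega> else \<omega>)"

text \<open>The multivalued map \<open>\<Pi>\<^sub>V\<close>; the last branch does not occur for simplices of the complex.\<close>

definition Pi_map :: "'v set set set \<Rightarrow> 'v set \<Rightarrow> 'v set set" where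
  "Pi_map V \<sigma> =
     (if \<sigma> \<in> critical V then simplicial_closure {\<sigma>}
      else if \<sigma> \<in> arrow_tails V then {head_of V \<sigma>}
      else if \<sigma> \<in> arrow_heads V then simplex_boundary \<sigma> - {tail_of V \<sigma>}
      else {})"

definition int_interval :: "int set \<Rightarrow> bool" where
  "int_interval I \<longleftrightarrow> (\<forall>a\<in>I. \<forall>b\<in>I. {a..b} \<subseteq> I)"

text \<open>\<open>\<rho>\<close> restricted to \<open>I\<close> is a solution; the values of \<open>\<rho>\<close> outside \<open>I\<close> are irrelevant.\<close>

definition comb_solution ::
    "'v set set \<Rightarrow> 'v set set set \<Rightarrow> int set \<Rightarrow> (int \<Rightarrow> 'v set) \<Rightarrow> bool" where
  "comb_solution K V I \<rho> \<longleftrightarrow>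
     int_interval I \<and> \<rho> ` I \<subseteq> K \<and> (\<forall>k. k \<in> I \<and> k + 1 \<in> I \<longrightarrow> \<rho> (k + 1) \<in> Pi_map V (\<rho> k))"

definition comb_invariant :: "'v set set \<Rightarrow> 'v set set set \<Rightarrow> 'v set set \<Rightarrow> bool" where
  "comb_invariant K V S \<longleftrightarrow>
     S \<subseteq> K \<and> (\<forall>\<sigma>\<in>S. \<exists>\<rho>. comb_solution K V UNIV \<rho> \<and> \<rho> 0 = \<sigma> \<and> range \<rho> \<subseteq> S)"

definition comb_isolated_invariant :: "'v set set \<Rightarrow> 'v set set set \<Rightarrow> 'v set set \<Rightarrow> bool" where
  "comb_isolated_invariant K V S \<longleftrightarrow>
     comb_invariant K V S \<and>
     combinatorially_closed (mouth S) \<and>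
     \<not> (\<exists>\<rho>. comb_solution K V {-1, 0, 1} \<rho> \<and> \<rho> (-1) \<in> S \<and> \<rho> 1 \<in> S \<and> \<rho> 0 \<in> mouth S)"


section \<open>Cells and flow tiles\<close>

definition eps_cell :: "'v set set \<Rightarrow> real \<Rightarrow> 'v set \<Rightarrow> ('v \<Rightarrow> real) set" where
  "eps_cell K \<epsilon> \<sigma> =
     {x \<in> topspace (polytope_space K). (\<forall>v\<in>\<sigma>. x v > \<epsilon>) \<and> (\<forall>v\<in>vertices K - \<sigma>. x v < \<epsilon>)}"

definition flow_tile :: "'v set set \<Rightarrow> 'v set set set \<Rightarrow> real \<Rightarrow> 'v set \<Rightarrow> ('v \<Rightarrow> real) set" where
  "flow_tile K V \<epsilon> \<omega> =
     polytope_space K closure_of eps_cell K \<epsilon> (lower_simplex V \<omega>) \<union>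
     polytope_space K closure_of eps_cell K \<epsilon> (upper_simplex V \<omega>)"

definition flow_tiles :: "'v set set \<Rightarrow> 'v set set set \<Rightarrow> real \<Rightarrow> ('v \<Rightarrow> real) set set" where
  "flow_tiles K V \<epsilon> = flow_tile K V \<epsilon> ` K"

definition sigma_min :: "'v set set \<Rightarrow> real \<Rightarrow> ('v \<Rightarrow> real) \<Rightarrow> 'v set" where
  "sigma_min K \<epsilon> x = {v\<in>vertices K. x v > \<epsilon>}"

definition sigma_max :: "'v set set \<Rightarrow> real \<Rightarrow> ('v \<Rightarrow> real) \<Rightarrow> 'v set" where
  "sigma_max K \<epsilon> x = {v\<in>vertices K. x v \<ge> \<epsilon>}"


section \<open>Semiflows\<close>

definition semiflow :: "'a topology \<Rightarrow> (real \<Rightarrow> 'a \<Rightarrow> 'a) \<Rightarrow> bool" where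
  "semiflow X \<phi> \<longleftrightarrow>
     continuous_map (prod_topology (top_of_set {0..}) X) X (\<lambda>(t, x). \<phi> t x) \<and>
     (\<forall>x\<in>topspace X. \<phi> 0 x = x) \<and>
     (\<forall>x\<in>topspace X. \<forall>s\<ge>0. \<forall>t\<ge>0. \<phi> s (\<phi> t x) = \<phi> (s + t) x)"

definition flow_solution ::
    "'a topology \<Rightarrow> (real \<Rightarrow> 'a \<Rightarrow> 'a) \<Rightarrow> real set \<Rightarrow> (real \<Rightarrow> 'a) \<Rightarrow> bool" where
  "flow_solution X \<phi> I \<gamma> \<longleftrightarrow>
     is_interval I \<and> \<gamma> ` I \<subseteq> topspace X \<and>
     (\<forall>s t. s \<ge> 0 \<and> t \<in> I \<and> s + t \<in> I \<longrightarrow> \<phi> s (\<gamma> t) = \<gamma> (s + t))"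

definition Inv :: "'a topology \<Rightarrow> (real \<Rightarrow> 'a \<Rightarrow> 'a) \<Rightarrow> 'a set \<Rightarrow> 'a set" where
  "Inv X \<phi> N = {x\<in>N. \<exists>\<gamma>. flow_solution X \<phi> UNIV \<gamma> \<and> \<gamma> 0 = x \<and> range \<gamma> \<subseteq> N}"

definition flow_isolated_invariant ::
    "'a topology \<Rightarrow> (real \<Rightarrow> 'a \<Rightarrow> 'a) \<Rightarrow> 'a set \<Rightarrow> bool" where
  "flow_isolated_invariant X \<phi> S \<longleftrightarrow>
     closedin X S \<and> Inv X \<phi> S = S \<and>
     (\<exists>N. closedin X N \<and> Inv X \<phi> N = S \<and> S \<subseteq> X interior_of N)"

definition admissible ::
    "'v set set \<Rightarrow> 'v set set set \<Rightarrow> real \<Rightarrow> (real \<Rightarrow> ('v \<Rightarrow> real) \<Rightarrow> ('v \<Rightarrow> real)) \<Rightarrow> bool" where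
  "admissible K V \<epsilon> \<phi> \<longleftrightarrow>
     (\<forall>x\<in>topspace (polytope_space K).
        (\<exists>C\<in>flow_tiles K V \<epsilon>. \<exists>D\<in>flow_tiles K V \<epsilon>. C \<noteq> D \<and> x \<in> C \<and> x \<in> D) \<longrightarrow>
        (\<forall>t1 t2 \<gamma>. t1 \<le> 0 \<and> 0 < t2 \<and>
            flow_solution (polytope_space K) \<phi> {t1..t2} \<gamma> \<and> \<gamma> 0 = x \<longrightarrow>
          (\<exists>U. openin (top_of_set {t1..t2}) U \<and> 0 \<in> U \<and>
             (\<forall>t\<in>U. t < 0 \<longrightarrow> \<gamma> t \<in> eps_cell K \<epsilon> (sigma_max K \<epsilon> x)) \<and>
             (\<forall>t\<in>U. t > 0 \<longrightarrow> \<gamma> t \<in> eps_cell K \<epsilon> (sigma_min K \<epsilon> x)))))"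


section \<open>Isolating blocks\<close>

definition nbhd_in :: "'a topology \<Rightarrow> 'a \<Rightarrow> 'a set \<Rightarrow> bool" where
  "nbhd_in X x J \<longleftrightarrow> J \<subseteq> topspace X \<and> x \<in> X interior_of J"

definition strict_egress :: "'a topology \<Rightarrow> (real \<Rightarrow> 'a \<Rightarrow> 'a) \<Rightarrow> 'a set \<Rightarrow> 'a set" where
  "strict_egress X \<phi> B = {x \<in> X frontier_of B.
     \<forall>\<delta>1 \<delta>2 \<gamma>. \<delta>1 \<le> 0 \<and> 0 < \<delta>2 \<and> flow_solution X \<phi> {\<delta>1..\<delta>2} \<gamma> \<and> \<gamma> 0 = x \<longrightarrow>
       (\<exists>J. nbhd_in (top_of_set {\<delta>1..\<delta>2}) 0 J \<and>
          (\<forall>t\<in>J. t > 0 \<longrightarrow> \<gamma> t \<notin> B) \<and> (\<forall>t\<in>J. t < 0 \<longrightarrow> \<gamma> t \<in> X interior_of B))}"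

definition strict_ingress :: "'a topology \<Rightarrow> (real \<Rightarrow> 'a \<Rightarrow> 'a) \<Rightarrow> 'a set \<Rightarrow> 'a set" where
  "strict_ingress X \<phi> B = {x \<in> X frontier_of B.
     \<forall>\<delta>1 \<delta>2 \<gamma>. \<delta>1 \<le> 0 \<and> 0 < \<delta>2 \<and> flow_solution X \<phi> {\<delta>1..\<delta>2} \<gamma> \<and> \<gamma> 0 = x \<longrightarrow>
       (\<exists>J. nbhd_in (top_of_set {\<delta>1..\<delta>2}) 0 J \<and>
          (\<forall>t\<in>J. t > 0 \<longrightarrow> \<gamma> t \<in> X interior_of B) \<and> (\<forall>t\<in>J. t < 0 \<longrightarrow> \<gamma> t \<notin> B))}"

definition bounce_off :: "'a topology \<Rightarrow> (real \<Rightarrow> 'a \<Rightarrow> 'a) \<Rightarrow> 'a set \<Rightarrow> 'a set" where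
  "bounce_off X \<phi> B = {x \<in> X frontier_of B.
     \<forall>\<delta>1 \<delta>2 \<gamma>. \<delta>1 \<le> 0 \<and> 0 < \<delta>2 \<and> flow_solution X \<phi> {\<delta>1..\<delta>2} \<gamma> \<and> \<gamma> 0 = x \<longrightarrow>
       (\<exists>J. nbhd_in (top_of_set {\<delta>1..\<delta>2}) 0 J \<and> (\<forall>t\<in>J - {0}. \<gamma> t \<notin> B))}"

definition exit_set :: "'a topology \<Rightarrow> (real \<Rightarrow> 'a \<Rightarrow> 'a) \<Rightarrow> 'a set \<Rightarrow> 'a set" where
  "exit_set X \<phi> B = strict_egress X \<phi> B \<union> bounce_off X \<phi> B"

definition isolating_block :: "'a topology \<Rightarrow> (real \<Rightarrow> 'a \<Rightarrow> 'a) \<Rightarrow> 'a set \<Rightarrow> bool" where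
  "isolating_block X \<phi> B \<longleftrightarrow>
     closedin X B \<and>
     X frontier_of B = strict_egress X \<phi> B \<union> strict_ingress X \<phi> B \<union> bounce_off X \<phi> B \<and>
     closedin X (exit_set X \<phi> B)"

end

theory Submission
  imports Defs "HOL-Analysis.Abstract_Topological_Spaces"
begin

text \<open>
  For a subcomplex \<open>L\<close> and a small level \<open>a \<ge> 0\<close> let \<open>N\<^sub>a(L)\<close> be the set of points whose coordinates above
  \<open>a\<close> are indexed by a simplex of \<open>L\<close>; thus \<open>N\<^sub>0(L)\<close> is the polytope of \<open>L\<close>. A point \<open>x\<close> lies in the closed
  cell of \<open>\<sigma>\<close> iff \<open>\<sigma>\<close> lies between \<open>\<sigma>\<^sub>m\<^sub>i\<^sub>n(x)\<close> and \<open>\<sigma>\<^sub>m\<^sub>a\<^sub>x(x)\<close>. An isolated invariant set \<open>S\<close> is convex for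
  the face relation and contains both or neither of the simplices of an arrow. Hence admissibility
  applies at every frontier point \<open>x\<close> of \<open>B\<close>: solutions come from the cell of \<open>\<sigma>\<^sub>m\<^sub>a\<^sub>x(x)\<close> and go to the cell of
  \<open>\<sigma>\<^sub>m\<^sub>i\<^sub>n(x)\<close>, and by convexity these are not both in \<open>S\<close>. This gives the isolating block and
  \<open>B\<^sup>- = {x \<in> B. \<sigma>\<^sub>m\<^sub>i\<^sub>n(x) \<notin> S} = B \<inter> N\<^sub>\<epsilon>(Mo S)\<close>.

  Since \<open>N\<^sub>\<epsilon>(Cl S) = B \<union> N\<^sub>\<epsilon>(Mo S)\<close>, the homology of \<open>(B, B\<^sup>-)\<close> is that of \<open>(N\<^sub>\<epsilon>(Cl S), N\<^sub>\<epsilon>(Mo S))\<close> by excision,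
  and hence that of \<open>(N\<^sub>0(Cl S), N\<^sub>0(Mo S))\<close>: squeezing coordinates in an interval of levels to its lower end
  is a deformation that changes the level. It is also used to thicken closed sets before excising.
  Simplicial and singular homology agree because the mapping cone of the comparison map is acyclic for
  every subcomplex, by induction on the number of simplices with excision of the last one.
\<close>

section \<open>Acyclic pairs and simplicial chains\<close>

text \<open>The bound on \<open>\<epsilon>\<close> makes \<open>\<epsilon>\<close> times the number
  of vertices of any simplex less than \<open>1\<close>, so every point of the polytope has a
  coordinate above \<open>\<epsilon>\<close>. This keeps the simplex of large coordinates nonempty
  and the denominator of the squeezing map positive. Only finitely many strict inequalities are
  involved, so a slightly larger level \<open>b\<close> has the same property; the gap between
  \<open>\<epsilon>\<close> and \<open>b\<close> is the room in which closed sets are thickened.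

  The mapping cone stands in for long exact sequences, connecting homomorphisms and the five lemma.
  Acyclicity modulo a subcomplex is an existence statement about chains; for nested subcomplexes the
  witnesses simply add up, and one such statement contains both surjectivity and injectivity on
  homology. The same excision result serves twice: at level \<open>0\<close> in the comparison of
  simplicial with singular homology, and at level \<open>\<epsilon>\<close> for the block.\<close>

text \<open>
  All differentials used below vanish in degree \<open>0\<close>, so the truncated \<open>q - 1\<close> imposes no condition
  there.
\<close>

definition acyclic_pair :: "(nat \<Rightarrow> 'a::ab_group_add \<Rightarrow> 'a) \<Rightarrow> (nat \<Rightarrow> 'a set) \<Rightarrow> (nat \<Rightarrow> 'a set) \<Rightarrow> bool" where
  "acyclic_pair D A B \<longleftrightarrow>
     (\<forall>q. \<forall>x\<in>A q. D q x \<in> B (q - 1) \<longrightarrow> (\<exists>y\<in>A (Suc q). x - D (Suc q) y \<in> B q))"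

text \<open>A chain complex encoded as graded subsets of one ambient type. All laws are demanded on
  members only: the cone differential below relies on \<open>realize\<close> commuting with
  boundaries, which is available for chains of simplices of the complex.\<close>

definition dg_subgroup :: "(nat \<Rightarrow> 'a::ab_group_add \<Rightarrow> 'a) \<Rightarrow> (nat \<Rightarrow> 'a set) \<Rightarrow> bool" where
  "dg_subgroup D A \<longleftrightarrow>
     (\<forall>q. 0 \<in> A q \<and> (\<forall>x\<in>A q. \<forall>y\<in>A q. x - y \<in> A q) \<and> (\<forall>x\<in>A q. D q x \<in> A (q - 1)) \<and>
          (\<forall>x\<in>A q. \<forall>y\<in>A q. D q (x - y) = D q x - D q y) \<and>
          (\<forall>x\<in>A q. D (q - 1) (D q x) = 0) \<and> (\<forall>x\<in>A 0. D 0 x = 0))"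

lemma dg_subgroupD:
  assumes "dg_subgroup D A"
  shows "0 \<in> A q" and "x \<in> A q \<Longrightarrow> y \<in> A q \<Longrightarrow> x - y \<in> A q" and "x \<in> A q \<Longrightarrow> D q x \<in> A (q - 1)"
    and "x \<in> A q \<Longrightarrow> y \<in> A q \<Longrightarrow> D q (x - y) = D q x - D q y"
    and "x \<in> A q \<Longrightarrow> D (q - 1) (D q x) = 0" and "x \<in> A 0 \<Longrightarrow> D 0 x = 0"
  using assms unfolding dg_subgroup_def by blast+

lemma dg_subgroup_add:
  assumes "dg_subgroup D A" "x \<in> A q" "y \<in> A q"
  shows "x + y \<in> A q" "D q (x + y) = D q x + D q y"
proof -
  have m: "- y \<in> A q" "D q (- y) = - D q y"
    using dg_subgroupD(2,4)[OF assms(1), where x=0 and y=y and q=q]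
      dg_subgroupD(4)[OF assms(1), where x=0 and y=0 and q=q] dg_subgroupD(1)[OF assms(1)] assms(3)
    by auto
  show "x + y \<in> A q" "D q (x + y) = D q x + D q y"
    using dg_subgroupD(2,4)[OF assms(1,2) m(1)] m(2) by auto
qed

lemma acyclic_pairD:
  assumes "acyclic_pair D A B" "x \<in> A q" "D q x \<in> B (q - 1)"
  obtains y where "y \<in> A (Suc q)" "x - D (Suc q) y \<in> B q"
  using assms unfolding acyclic_pair_def by blast

text \<open>Elementwise form of the exact sequence of a triple. The witness for \<open>AB\<close>
  moves a cycle modulo \<open>C\<close> into \<open>B\<close>; subtracting a boundary leaves its
  differential unchanged, so the witness for \<open>BC\<close> can move it on into
  \<open>C\<close>.\<close>

lemma acyclic_pair_trans:
  assumes A: "dg_subgroup D A" and B: "dg_subgroup D B" and C: "dg_subgroup D C"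
    and "\<And>q. B q \<subseteq> A q" "\<And>q. C q \<subseteq> B q"
    and AB: "acyclic_pair D A B" and BC: "acyclic_pair D B C"
  shows "acyclic_pair D A C"
  unfolding acyclic_pair_def
proof (intro allI ballI impI)
  fix q x assume x: "x \<in> A q" "D q x \<in> C (q - 1)"
  then obtain y where y: "y \<in> A (Suc q)" "x - D (Suc q) y \<in> B q"
    using acyclic_pairD[OF AB] assms(5) by blast
  have Dy: "D (Suc q) y \<in> A q" "D q (D (Suc q) y) = 0"
    using dg_subgroupD(3,5)[OF A y(1)] by auto
  have "D q (x - D (Suc q) y) = D q x"
    using dg_subgroupD(4)[OF A x(1) Dy(1)] Dy(2) by simp
  then obtain z where z: "z \<in> B (Suc q)" "x - D (Suc q) y - D (Suc q) z \<in> C q"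
    using acyclic_pairD[OF BC y(2)] x(2) by metis
  have "z \<in> A (Suc q)"
    using z(1) assms(4) by blast
  then show "\<exists>y\<in>A (Suc q). x - D (Suc q) y \<in> C q"
    using z(2) dg_subgroup_add[OF A y(1)] by (metis diff_diff_add)
qed

text \<open>The differential of a cycle \<open>x\<close> modulo \<open>B\<close> is itself a cycle
  in \<open>B\<close>, so modulo \<open>C\<close> it is the differential of some \<open>y\<close> in
  \<open>B\<close>. Then \<open>x - y\<close> is a cycle modulo \<open>C\<close>, to which
  \<open>AC\<close> applies.\<close>

lemma acyclic_pair_quotient:
  assumes A: "dg_subgroup D A" and B: "dg_subgroup D B" and C: "dg_subgroup D C"
    and "\<And>q. B q \<subseteq> A q" "\<And>q. C q \<subseteq> B q"
    and AC: "acyclic_pair D A C" and BC: "acyclic_pair D B C"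
  shows "acyclic_pair D A B"
  unfolding acyclic_pair_def
proof (intro allI ballI impI)
  fix q x assume x: "x \<in> A q" "D q x \<in> B (q - 1)"
  show "\<exists>y\<in>A (Suc q). x - D (Suc q) y \<in> B q"
  proof (cases q)
    \<comment> \<open>Filling \<open>D q x\<close> in degree \<open>q - 1\<close> gives an element
      of degree \<open>Suc (q - 1)\<close>, which is \<open>q\<close> only for positive
      \<open>q\<close>. In degree \<open>0\<close> the differential vanishes and \<open>AC\<close>
      applies to \<open>x\<close> itself.\<close>
    case 0
    then show ?thesis
      using acyclic_pairD[OF AC x(1)] dg_subgroupD(6)[OF A] dg_subgroupD(1)[OF C] x assms(5)
      by (metis subsetD)
  next
    case (Suc n)
    have "D (q - 1) (D q x) = 0"
      using dg_subgroupD(5)[OF A x(1)] .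
    then obtain y where y: "y \<in> B q" "D q x - D q y \<in> C (q - 1)"
      using acyclic_pairD[OF BC x(2)] dg_subgroupD(1)[OF C] Suc by (metis diff_Suc_1)
    have yA: "y \<in> A q"
      using y assms(4) by blast
    obtain z where z: "z \<in> A (Suc q)" "x - y - D (Suc q) z \<in> C q"
      using acyclic_pairD[OF AC dg_subgroupD(2)[OF A x(1) yA]] y(2) dg_subgroupD(4)[OF A x(1) yA]
      by metis
    have "y + (x - y - D (Suc q) z) \<in> B q"
      using dg_subgroup_add(1)[OF B y(1)] z(2) assms(5) by blast
    then show ?thesis
      using z(1) by (auto simp: algebra_simps)
  qed
qed

section \<open>Vertex positions, simplicial chains and their realization as singular chains\<close>

definition position :: "'v rel \<Rightarrow> 'v set \<Rightarrow> 'v \<Rightarrow> nat" where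
  "position r \<sigma> v = card {w\<in>\<sigma>. w \<noteq> v \<and> (w, v) \<in> r}"

lemma position_less:
  assumes r: "linear_order_on A r" and "\<sigma> \<subseteq> A" "finite \<sigma>" "v \<in> \<sigma>" "w \<in> \<sigma>" "v \<noteq> w" "(v, w) \<in> r"
  shows "position r \<sigma> v < position r \<sigma> w"
  unfolding position_def
proof (rule psubset_card_mono)
  have tr: "trans r" "antisym r"
    using r by (auto simp: linear_order_on_def partial_order_on_def preorder_on_def)
  then have sub: "{u \<in> \<sigma>. u \<noteq> v \<and> (u, v) \<in> r} \<subseteq> {u \<in> \<sigma>. u \<noteq> w \<and> (u, w) \<in> r}"
    using assms(6,7) by (auto dest: transD antisymD)
  moreover have "v \<in> {u \<in> \<sigma>. u \<noteq> w \<and> (u, w) \<in> r}" "v \<notin> {u \<in> \<sigma>. u \<noteq> v \<and> (u, v) \<in> r}"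
    using assms by auto
  ultimately show "{u \<in> \<sigma>. u \<noteq> v \<and> (u, v) \<in> r} \<subset> {u \<in> \<sigma>. u \<noteq> w \<and> (u, w) \<in> r}"
    by blast
qed (use assms in auto)

lemma position_less_iff:
  assumes r: "linear_order_on A r" and "\<sigma> \<subseteq> A" "finite \<sigma>" "v \<in> \<sigma>" "w \<in> \<sigma>"
  shows "position r \<sigma> v < position r \<sigma> w \<longleftrightarrow> v \<noteq> w \<and> (v, w) \<in> r"
proof
  assume l: "position r \<sigma> v < position r \<sigma> w"
  then have "v \<noteq> w" by auto
  moreover have "(v, w) \<in> r \<or> (w, v) \<in> r"
    using r assms \<open>v \<noteq> w\<close> by (auto simp: linear_order_on_def total_on_def)
  ultimately show "v \<noteq> w \<and> (v, w) \<in> r"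
    using position_less[OF assms(1-3,5,4)] l by force
qed (use position_less[OF assms] in auto)

lemma bij_betw_position:
  assumes r: "linear_order_on A r" and "\<sigma> \<subseteq> A" "finite \<sigma>"
  shows "bij_betw (position r \<sigma>) \<sigma> {..<card \<sigma>}"
proof -
  have "inj_on (position r \<sigma>) \<sigma>"
  proof (rule inj_onI, rule ccontr)
    fix v w assume *: "v \<in> \<sigma>" "w \<in> \<sigma>" "position r \<sigma> v = position r \<sigma> w" "v \<noteq> w"
    then have "(v, w) \<in> r \<or> (w, v) \<in> r"
      using assms by (auto simp: linear_order_on_def total_on_def)
    then show False
      using position_less[OF assms] * by (metis less_irrefl)
  qed
  moreover have "position r \<sigma> ` \<sigma> \<subseteq> {..<card \<sigma>}"
  proof clarsimp
    fix v assume "v \<in> \<sigma>"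
    then have "{w \<in> \<sigma>. w \<noteq> v \<and> (w, v) \<in> r} \<subset> \<sigma>" by blast
    then show "position r \<sigma> v < card \<sigma>"
      unfolding position_def using assms(3) by (simp add: psubset_card_mono)
  qed
  ultimately show ?thesis
    by (metis assms(3) bij_betw_def card_image card_lessThan card_subset_eq finite_lessThan)
qed

lemma position_remove:
  assumes r: "linear_order_on A r" and "\<sigma> \<subseteq> A" "finite \<sigma>" "v \<in> \<sigma>" "w \<in> \<sigma>" "w \<noteq> v"
  shows "position r (\<sigma> - {v}) w = (if position r \<sigma> w < position r \<sigma> v then position r \<sigma> w else position r \<sigma> w - 1)"
proof (cases "(w, v) \<in> r")
  case True
  then have "(v, w) \<notin> r"
    using r assms by (auto simp: linear_order_on_def partial_order_on_def dest: antisymD)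
  then have "{u \<in> \<sigma> - {v}. u \<noteq> w \<and> (u, w) \<in> r} = {u \<in> \<sigma>. u \<noteq> w \<and> (u, w) \<in> r}"
    by auto
  then show ?thesis
    using position_less_iff[OF assms(1-3,5,4)] True assms by (simp add: position_def)
next
  case False
  then have "(v, w) \<in> r"
    using r assms by (auto simp: linear_order_on_def total_on_def)
  then have "{u \<in> \<sigma> - {v}. u \<noteq> w \<and> (u, w) \<in> r} = {u \<in> \<sigma>. u \<noteq> w \<and> (u, w) \<in> r} - {v}"
    "v \<in> {u \<in> \<sigma>. u \<noteq> w \<and> (u, w) \<in> r}"
    using assms by auto
  then show ?thesis
    using position_less_iff[OF assms(1-3,5,4)] False assms by (simp add: position_def)
qed

definition down_closed :: "'v set set \<Rightarrow> bool" where
  "down_closed L \<longleftrightarrow> (\<forall>\<sigma>\<in>L. \<forall>\<tau>. \<tau> \<noteq> {} \<and> \<tau> \<subseteq> \<sigma> \<longrightarrow> \<tau> \<in> L)"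

definition simp_chains :: "'v set set \<Rightarrow> nat \<Rightarrow> ('v set \<Rightarrow>\<^sub>0 int) set" where
  "simp_chains L p = {c. Poly_Mapping.keys c \<subseteq> {\<sigma>\<in>L. card \<sigma> = Suc p}}"

lemma carrier_simplicial_chain_group: "carrier (simplicial_chain_group p L) = simp_chains L p"
  by (auto simp: simplicial_chain_group_def simp_chains_def)

lemma simp_chains_closed:
  "0 \<in> simp_chains L p"
  "a \<in> simp_chains L p \<Longrightarrow> b \<in> simp_chains L p \<Longrightarrow> a - b \<in> simp_chains L p"
  "a \<in> simp_chains L p \<Longrightarrow> b \<in> simp_chains L p \<Longrightarrow> a + b \<in> simp_chains L p"
  "a \<in> simp_chains L p \<Longrightarrow> - a \<in> simp_chains L p"
  "a \<in> simp_chains L p \<Longrightarrow> frag_cmul k a \<in> simp_chains L p"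
  using keys_diff[of a b] keys_add[of a b] by (auto simp: simp_chains_def)

lemma simp_chains_mono: "L \<subseteq> L' \<Longrightarrow> simp_chains L p \<subseteq> simp_chains L' p"
  by (auto simp: simp_chains_def)

lemma simplicial_boundary_linear:
  "simplicial_boundary r p (a - b) = simplicial_boundary r p a - simplicial_boundary r p b"
  "simplicial_boundary r p (a + b) = simplicial_boundary r p a + simplicial_boundary r p b"
  "simplicial_boundary r p (- a) = - simplicial_boundary r p a"
  "simplicial_boundary r p 0 = 0"
  by (simp_all add: simplicial_boundary_def frag_extend_diff frag_extend_add frag_extend_minus)

lemma simplicial_boundary_of:
  "simplicial_boundary r (Suc p) (frag_of \<sigma>) =
     (\<Sum>v\<in>\<sigma>. frag_cmul ((-1) ^ position r \<sigma> v) (frag_of (\<sigma> - {v})))"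
  by (simp add: simplicial_boundary_def position_def)

lemma simplicial_boundary_in:
  assumes "down_closed L" "c \<in> simp_chains L p"
  shows "simplicial_boundary r p c \<in> simp_chains L (p - 1)"
proof (cases p)
  case 0
  then show ?thesis by (simp add: simplicial_boundary_def simp_chains_closed)
next
  case (Suc n)
  have "Poly_Mapping.keys c \<subseteq> {\<sigma>\<in>L. card \<sigma> = Suc p}"
    using assms by (simp add: simp_chains_def)
  then show ?thesis
  proof (induction c rule: frag_induction)
    case zero
    then show ?case by (simp add: simplicial_boundary_linear simp_chains_closed)
  next
    case (one \<sigma>)
    have fin: "finite \<sigma>"
      using one by (metis (mono_tags, lifting) card.infinite mem_Collect_eq nat.distinct(1))
    have "\<sigma> - {v} \<in> L \<and> card (\<sigma> - {v}) = Suc n" if "v \<in> \<sigma>" for v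
    proof -
      have "card (\<sigma> - {v}) = Suc n"
        using one that fin Suc by simp
      moreover from this have "\<sigma> - {v} \<noteq> {}" by force
      ultimately show ?thesis
        using assms(1) one unfolding down_closed_def by (metis (no_types, lifting) Diff_subset mem_Collect_eq)
    qed
    then show ?case
      unfolding Suc simplicial_boundary_of simp_chains_def using Suc
      by (auto dest!: subsetD[OF keys_sum])
  next
    case (diff a b)
    then show ?case by (simp add: simplicial_boundary_linear simp_chains_closed)
  qed
qed

text \<open>The affine parametrization of a simplex that preserves the order of the vertices. The
  restriction is there because singular simplices have to be extensional.\<close>

definition simplex_param :: "'v rel \<Rightarrow> 'v set \<Rightarrow> (nat \<Rightarrow> real) \<Rightarrow> 'v \<Rightarrow> real" where
  "simplex_param r \<sigma> =
     restrict (\<lambda>t v. if v \<in> \<sigma> then t (position r \<sigma> v) else 0) (standard_simplex (card \<sigma> - 1))"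

definition realize :: "'v rel \<Rightarrow> ('v set \<Rightarrow>\<^sub>0 int) \<Rightarrow> ('v \<Rightarrow> real) chain" where
  "realize r = frag_extend (frag_of \<circ> simplex_param r)"

lemma realize_linear:
  "realize r (a - b) = realize r a - realize r b"
  "realize r (a + b) = realize r a + realize r b"
  "realize r (- a) = - realize r a"
  "realize r 0 = 0"
  "realize r (frag_cmul k a) = frag_cmul k (realize r a)"
  "realize r (frag_of \<sigma>) = frag_of (simplex_param r \<sigma>)"
  by (simp_all add: realize_def frag_extend_diff frag_extend_add frag_extend_minus frag_extend_cmul)

text \<open>The face map inserts a zero at the position of \<open>v\<close>. Removing
  \<open>v\<close> from the simplex lowers exactly the later positions by one, which is the same
  renumbering.\<close>

lemma singular_face_simplex_param:
  assumes r: "linear_order_on A r" and "\<sigma> \<subseteq> A" and c: "card \<sigma> = Suc (Suc p)" and v: "v \<in> \<sigma>"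
  shows "singular_face (Suc p) (position r \<sigma> v) (simplex_param r \<sigma>) = simplex_param r (\<sigma> - {v})"
proof
  fix t
  have fin: "finite \<sigma>"
    using c card.infinite by fastforce
  have cv: "card (\<sigma> - {v}) = Suc p"
    using fin c v by simp
  have pv: "position r \<sigma> v \<le> Suc p"
    using bij_betw_apply[OF bij_betw_position[OF r assms(2) fin] v] c by simp
  show "singular_face (Suc p) (position r \<sigma> v) (simplex_param r \<sigma>) t = simplex_param r (\<sigma> - {v}) t"
  proof (cases "t \<in> standard_simplex p")
    case True
    have "simplical_face (position r \<sigma> v) t \<in> standard_simplex (Suc p)"
      using simplical_face_in_standard_simplex[of "Suc p" "position r \<sigma> v" t] True pv by simp
    moreover have "(if w \<in> \<sigma> then simplical_face (position r \<sigma> v) t (position r \<sigma> w) else 0) =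
      (if w \<in> \<sigma> - {v} then t (position r (\<sigma> - {v}) w) else 0)" for w
    proof (cases "w \<in> \<sigma> \<and> w \<noteq> v")
      case True
      then have "position r \<sigma> w \<noteq> position r \<sigma> v"
        using bij_betw_position[OF r assms(2) fin] v by (auto simp: bij_betw_def inj_on_def)
      then show ?thesis
        using position_remove[OF r assms(2) fin v] True by (auto simp: simplical_face_def)
    qed (use v in \<open>auto simp: simplical_face_def\<close>)
    ultimately show ?thesis
      using True c cv by (simp add: singular_face_def simplex_param_def fun_eq_iff)
  next
    case False
    then show ?thesis
      using cv by (simp add: singular_face_def simplex_param_def)
  qed
qed

lemma chain_boundary_realize:
  assumes r: "linear_order_on (vertices K) r" and "c \<in> simp_chains K p"
  shows "chain_boundary p (realize r c) = realize r (simplicial_boundary r p c)"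
proof (cases p)
  case 0
  then show ?thesis by (simp add: simplicial_boundary_def chain_boundary_def realize_linear)
next
  case (Suc n)
  have "Poly_Mapping.keys c \<subseteq> {\<sigma>\<in>K. card \<sigma> = Suc p}"
    using assms by (simp add: simp_chains_def)
  then show ?thesis
  proof (induction c rule: frag_induction)
    case zero
    then show ?case by (simp add: realize_linear simplicial_boundary_linear)
  next
    case (one \<sigma>)
    have sub: "\<sigma> \<subseteq> vertices K"
      using one by (auto simp: vertices_def)
    have fin: "finite \<sigma>"
      using one by (metis (mono_tags, lifting) card.infinite mem_Collect_eq nat.distinct(1))
    have bij: "bij_betw (position r \<sigma>) \<sigma> {..Suc n}"
      using bij_betw_position[OF r sub fin] one Suc by (simp add: lessThan_Suc_atMost)
    have "chain_boundary p (realize r (frag_of \<sigma>)) =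
      (\<Sum>k\<le>Suc n. frag_cmul ((-1) ^ k) (frag_of (singular_face (Suc n) k (simplex_param r \<sigma>))))"
      by (simp add: realize_linear chain_boundary_of Suc)
    also have "\<dots> = (\<Sum>v\<in>\<sigma>. frag_cmul ((-1) ^ position r \<sigma> v)
        (frag_of (singular_face (Suc n) (position r \<sigma> v) (simplex_param r \<sigma>))))"
      by (rule sum.reindex_bij_betw[OF bij, symmetric])
    also have "\<dots> = (\<Sum>v\<in>\<sigma>. frag_cmul ((-1) ^ position r \<sigma> v) (frag_of (simplex_param r (\<sigma> - {v}))))"
      using singular_face_simplex_param[OF r sub] one Suc by (intro sum.cong) auto
    also have "\<dots> = realize r (simplicial_boundary r p (frag_of \<sigma>))"
      unfolding Suc simplicial_boundary_of realize_def
      by (simp add: frag_extend_sum[OF fin] frag_extend_cmul)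
    finally show ?case .
  next
    case (diff a b)
    then show ?case by (simp add: realize_linear simplicial_boundary_linear chain_boundary_diff)
  qed
qed

section \<open>Superlevel sets of barycentric coordinates\<close>

lemma topspace_polytope_space:
  "topspace (polytope_space K) =
     {x. (\<forall>v. v \<notin> vertices K \<longrightarrow> x v = 0) \<and> (\<forall>v\<in>vertices K. 0 \<le> x v) \<and>
         (\<Sum>v\<in>vertices K. x v) = 1 \<and> {v\<in>vertices K. x v > 0} \<in> K}"
  by (simp add: polytope_space_def)

lemma subtopology_polytope_space:
  "A \<subseteq> topspace (polytope_space K) \<Longrightarrow> subtopology (polytope_space K) A = top_of_set A"
  by (simp add: polytope_space_def subtopology_subtopology Int_absorb1)

lemma closedin_polytope_space:
    "closed C \<Longrightarrow> closedin (polytope_space K) (topspace (polytope_space K) \<inter> C)"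
  and openin_polytope_space:
    "open C \<Longrightarrow> openin (polytope_space K) (topspace (polytope_space K) \<inter> C)"
  by (simp_all add: polytope_space_def closedin_closed_Int openin_open_Int)

lemma down_closedD: "down_closed L \<Longrightarrow> \<sigma> \<in> L \<Longrightarrow> \<tau> \<noteq> {} \<Longrightarrow> \<tau> \<subseteq> \<sigma> \<Longrightarrow> \<tau> \<in> L"
  unfolding down_closed_def by blast

lemma sum_one_imp_pos:
  fixes f :: "'a \<Rightarrow> real"
  assumes "sum f A = 1"
  shows "\<exists>v\<in>A. f v > 0"
  using assms sum_nonpos[of A f] by (force simp: not_less[symmetric])

definition superlevel :: "'v set set \<Rightarrow> real \<Rightarrow> 'v set set \<Rightarrow> ('v \<Rightarrow> real) set" where
  "superlevel K a L = {x\<in>topspace (polytope_space K). {v\<in>vertices K. x v > a} \<in> L}"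

text \<open>Rules out points whose coordinates are all at most \<open>b\<close>: the coordinates of
  such a point, summed over its support \<open>\<sigma>\<close>, would give at most
  \<open>b * card \<sigma>\<close> and miss the required sum \<open>1\<close>.\<close>

definition admissible_level :: "'v set set \<Rightarrow> real \<Rightarrow> bool" where
  "admissible_level K b \<longleftrightarrow> 0 \<le> b \<and> (\<forall>\<sigma>\<in>K. b * real (card \<sigma>) < 1)"

text \<open>
  The coordinates in \<open>[a, b]\<close> collapse to \<open>a\<close>; the factor in front of the part above \<open>b\<close> restores the
  coordinate sum \<open>1\<close>. Its denominator is positive at an admissible level, because then some
  coordinate exceeds \<open>b\<close>.
\<close>

definition squeeze :: "'v set set \<Rightarrow> real \<Rightarrow> real \<Rightarrow> ('v \<Rightarrow> real) \<Rightarrow> 'v \<Rightarrow> real" where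
  "squeeze K a b x v = min (x v) a +
     (1 - (\<Sum>w\<in>vertices K. min (x w) a)) / (\<Sum>w\<in>vertices K. max (x w - b) 0) * max (x v - b) 0"

definition squeeze_homotopy :: "'v set set \<Rightarrow> real \<Rightarrow> real \<Rightarrow> real \<Rightarrow> ('v \<Rightarrow> real) \<Rightarrow> 'v \<Rightarrow> real" where
  "squeeze_homotopy K a b t x v = (1 - t) * x v + t * squeeze K a b x v"

lemma squeeze_homotopy_0 [simp]: "squeeze_homotopy K a b 0 x = x"
  and squeeze_homotopy_1 [simp]: "squeeze_homotopy K a b 1 x = squeeze K a b x"
  by (auto simp: squeeze_homotopy_def)

locale polyhedron =
  fixes K :: "'v set set"
  assumes complex: "abstract_simplicial_complex K"
begin

abbreviation "X \<equiv> polytope_space K"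
abbreviation "P \<equiv> topspace (polytope_space K)"

lemma finite_complex: "finite K"
  and simplexD: "\<sigma> \<in> K \<Longrightarrow> \<sigma> \<noteq> {}" "\<sigma> \<in> K \<Longrightarrow> finite \<sigma>"
  and down_closed_complex: "down_closed K"
  using complex unfolding abstract_simplicial_complex_def down_closed_def by blast+

lemma finite_vertices: "finite (vertices K)"
  using finite_complex simplexD by (simp add: vertices_def)

lemma simplex_vertices: "\<sigma> \<in> K \<Longrightarrow> \<sigma> \<subseteq> vertices K"
  by (auto simp: vertices_def)

lemma pointD:
  assumes "x \<in> P"
  shows "v \<notin> vertices K \<Longrightarrow> x v = 0" "0 \<le> x v" "(\<Sum>v\<in>vertices K. x v) = 1"
    "{v\<in>vertices K. x v > 0} \<in> K"
  using assms unfolding topspace_polytope_space by (cases "v \<in> vertices K"; force)+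

lemma exceeds_level:
  assumes x: "x \<in> P" and b: "admissible_level K b"
  obtains v where "v \<in> vertices K" "x v > b"
proof -
  have "\<exists>v\<in>vertices K. x v > b"
  proof (rule ccontr)
    assume "\<not> ?thesis"
    then have le: "x v \<le> b" if "v \<in> vertices K" for v
      using that by force
    let ?s = "{v\<in>vertices K. x v > 0}"
    have "(\<Sum>v\<in>vertices K. x v) = (\<Sum>v\<in>?s. x v)"
      using pointD(2)[OF x] finite_vertices
      by (intro sum.mono_neutral_cong_right) (auto simp: order_less_le)
    also have "\<dots> \<le> (\<Sum>v\<in>?s. b)"
      using le by (intro sum_mono) auto
    also have "\<dots> = b * real (card ?s)"
      by simp
    also have "\<dots> < 1"
      using b pointD(4)[OF x] unfolding admissible_level_def by blast
    finally show False
      using pointD(3)[OF x] by simp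
  qed
  then show thesis
    using that by blast
qed

text \<open>Replaces the condition on the set of large coordinates by finitely many closed
  conditions, one for each missing face. The empty set of large coordinates would escape these
  conditions; \<open>exceeds_level\<close> excludes it.\<close>

lemma superlevel_eq_no_face_above:
  assumes b: "admissible_level K b" and L: "down_closed L"
  shows "superlevel K b L =
    {x\<in>P. \<forall>\<tau>\<in>{\<tau>. \<tau> \<subseteq> vertices K \<and> \<tau> \<noteq> {} \<and> \<tau> \<notin> L}. \<exists>v\<in>\<tau>. x v \<le> b}" (is "_ = ?R")
proof
  show "superlevel K b L \<subseteq> ?R"
  proof (clarsimp simp: superlevel_def, rule ccontr)
    fix x \<tau> assume *: "{v \<in> vertices K. b < x v} \<in> L" "\<tau> \<subseteq> vertices K" "\<tau> \<noteq> {}" "\<tau> \<notin> L"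
      and "\<not> (\<exists>v\<in>\<tau>. x v \<le> b)"
    then have "\<tau> \<subseteq> {v \<in> vertices K. b < x v}" by force
    then show False
      using * down_closedD[OF L] by blast
  qed
  show "?R \<subseteq> superlevel K b L"
  proof
    fix x assume x: "x \<in> ?R"
    then have xP: "x \<in> P" by blast
    have "{v \<in> vertices K. b < x v} \<noteq> {}"
      using exceeds_level[OF xP b] by blast
    moreover have "\<not> (\<exists>v\<in>{v \<in> vertices K. b < x v}. x v \<le> b)" "{v \<in> vertices K. b < x v} \<subseteq> vertices K"
      by auto
    ultimately have "{v \<in> vertices K. b < x v} \<in> L"
      using x by blast
    then show "x \<in> superlevel K b L"
      using xP unfolding superlevel_def by blast
  qed
qed

lemma continuous_on_coordinate: "continuous_on A (\<lambda>x::'v\<Rightarrow>real. x v)"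
  by (rule continuous_on_subset[OF continuous_on_product_coordinates]) simp

lemma closedin_superlevel:
  assumes b: "admissible_level K b" and L: "down_closed L"
  shows "closedin X (superlevel K b L)"
proof -
  let ?N = "{\<tau>. \<tau> \<subseteq> vertices K \<and> \<tau> \<noteq> {} \<and> \<tau> \<notin> L}"
  have fin: "finite \<tau>" if "\<tau> \<in> ?N" for \<tau>
    using that finite_vertices finite_subset by blast
  have "closed (\<Inter>\<tau>\<in>?N. \<Union>v\<in>\<tau>. {x::'v\<Rightarrow>real. x v \<le> b})"
  proof (intro closed_INT ballI closed_UN)
    fix v show "closed {x::'v\<Rightarrow>real. x v \<le> b}"
      by (rule closed_Collect_le[OF continuous_on_coordinate continuous_on_const])
  qed (use fin in auto)
  moreover have "superlevel K b L = P \<inter> (\<Inter>\<tau>\<in>?N. \<Union>v\<in>\<tau>. {x::'v\<Rightarrow>real. x v \<le> b})"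
    unfolding superlevel_eq_no_face_above[OF assms] by auto
  ultimately show ?thesis
    by (simp add: closedin_polytope_space)
qed

lemma superlevel_mono: "L \<subseteq> L' \<Longrightarrow> superlevel K b L \<subseteq> superlevel K b L'"
  by (auto simp: superlevel_def)

lemma superlevel_subset: "superlevel K b L \<subseteq> P"
  by (auto simp: superlevel_def)

lemma superlevel_level_mono:
  assumes "admissible_level K b" "down_closed L" "a \<le> b"
  shows "superlevel K a L \<subseteq> superlevel K b L"
proof
  fix x assume x: "x \<in> superlevel K a L"
  then have xP: "x \<in> P" by (simp add: superlevel_def)
  have "{v\<in>vertices K. x v > b} \<noteq> {}"
    using exceeds_level[OF xP assms(1)] by blast
  moreover have "{v\<in>vertices K. x v > b} \<subseteq> {v\<in>vertices K. x v > a}"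
    using assms(3) by auto
  ultimately have "{v\<in>vertices K. x v > b} \<in> L"
    by (rule down_closedD[OF assms(2), of "{v\<in>vertices K. x v > a}", rotated]) (use x in \<open>simp add: superlevel_def\<close>)
  then show "x \<in> superlevel K b L"
    using xP by (simp add: superlevel_def)
qed

text \<open>The set in between forbids that all coordinates of a missing face are at least
  \<open>b\<close>, instead of greater than \<open>b\<close>. The forbidden sets are closed and
  finite in number, so an open set remains.\<close>

lemma superlevel_interior:
  assumes a: "0 \<le> a" "a < b" and b: "admissible_level K b" and L: "down_closed L"
  obtains W where "openin X W" "superlevel K a L \<subseteq> W" "W \<subseteq> superlevel K b L"
proof
  let ?W = "P \<inter> - (\<Union>\<tau>\<in>{\<tau>. \<tau> \<subseteq> vertices K \<and> \<tau> \<noteq> {} \<and> \<tau> \<notin> L}. \<Inter>v\<in>\<tau>. {x::'v\<Rightarrow>real. b \<le> x v})"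
  have "open (- (\<Union>\<tau>\<in>{\<tau>. \<tau> \<subseteq> vertices K \<and> \<tau> \<noteq> {} \<and> \<tau> \<notin> L}. \<Inter>v\<in>\<tau>. {x::'v\<Rightarrow>real. b \<le> x v}))"
  proof (intro open_Compl closed_UN ballI closed_INT)
    show "finite {\<tau>. \<tau> \<subseteq> vertices K \<and> \<tau> \<noteq> {} \<and> \<tau> \<notin> L}" using finite_vertices by simp
    fix v show "closed {x::'v\<Rightarrow>real. b \<le> x v}"
      by (rule closed_Collect_le[OF continuous_on_const continuous_on_coordinate])
  qed
  then show "openin X ?W"
    by (rule openin_polytope_space)
  show "superlevel K a L \<subseteq> ?W"
  proof (clarsimp simp: superlevel_def)
    fix x \<tau> assume *: "{v \<in> vertices K. a < x v} \<in> L" "\<tau> \<subseteq> vertices K" "\<tau> \<noteq> {}" "\<tau> \<notin> L"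
    show "\<exists>v\<in>\<tau>. \<not> b \<le> x v"
    proof (rule ccontr)
      assume "\<not> (\<exists>v\<in>\<tau>. \<not> b \<le> x v)"
      then have "\<tau> \<subseteq> {v \<in> vertices K. a < x v}"
        using *(2) a(2) by fastforce
      then show False
        using * down_closedD[OF L] by blast
    qed
  qed
  show "?W \<subseteq> superlevel K b L"
  proof
    fix x assume x: "x \<in> ?W"
    then have xP: "x \<in> P" by blast
    have "{v \<in> vertices K. b < x v} \<noteq> {}"
      using exceeds_level[OF xP b] by blast
    moreover have "x \<in> (\<Inter>v\<in>{v \<in> vertices K. b < x v}. {x. b \<le> x v})" "{v \<in> vertices K. b < x v} \<subseteq> vertices K"
      by auto
    ultimately have "{v \<in> vertices K. b < x v} \<in> L"
      using x by blast
    then show "x \<in> superlevel K b L"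
      using xP unfolding superlevel_def by blast
  qed
qed

section \<open>The deformation that squeezes coordinates\<close>

context
  fixes a b :: real
  assumes ab: "0 \<le> a" "a \<le> b" and lev: "admissible_level K b"
begin

lemma squeeze_denominator_pos:
  assumes "x \<in> P"
  shows "0 < (\<Sum>w\<in>vertices K. max (x w - b) 0)"
proof -
  obtain v where v: "v \<in> vertices K" "x v > b"
    using exceeds_level[OF assms lev] .
  then have "0 < max (x v - b) 0" by simp
  also have "\<dots> \<le> (\<Sum>w\<in>vertices K. max (x w - b) 0)"
    using member_le_sum[OF v(1), of "\<lambda>w. max (x w - b) 0"] finite_vertices by simp
  finally show ?thesis .
qed

lemma squeeze_factor_nonneg:
  assumes "x \<in> P"
  shows "0 \<le> (1 - (\<Sum>w\<in>vertices K. min (x w) a)) / (\<Sum>w\<in>vertices K. max (x w - b) 0)"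
proof -
  have "(\<Sum>w\<in>vertices K. min (x w) a) \<le> (\<Sum>w\<in>vertices K. x w)"
    by (intro sum_mono) auto
  then show ?thesis
    using pointD(3)[OF assms] squeeze_denominator_pos[OF assms] by simp
qed

lemma squeeze_low: "x v \<le> b \<Longrightarrow> squeeze K a b x v = min (x v) a"
  by (simp add: squeeze_def)

lemma squeeze_ge: "x \<in> P \<Longrightarrow> min (x v) a \<le> squeeze K a b x v"
  using mult_nonneg_nonneg[OF squeeze_factor_nonneg, of x "max (x v - b) 0"] unfolding squeeze_def by simp

lemma sum_squeeze: "x \<in> P \<Longrightarrow> (\<Sum>v\<in>vertices K. squeeze K a b x v) = 1"
  using squeeze_denominator_pos[of x]
  unfolding squeeze_def sum.distrib sum_distrib_left[symmetric] by simp

lemma squeeze_homotopy_low: "x v \<le> s \<Longrightarrow> s \<le> b \<Longrightarrow> 0 \<le> t \<Longrightarrow> t \<le> 1 \<Longrightarrow> squeeze_homotopy K a b t x v \<le> s"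
  unfolding squeeze_homotopy_def by (rule convex_bound_le) (auto simp: squeeze_low)

lemma squeeze_homotopy_fixed: "x v \<le> a \<Longrightarrow> squeeze_homotopy K a b t x v = x v"
  using ab squeeze_low[of x v] by (simp add: squeeze_homotopy_def algebra_simps)

lemma squeeze_homotopy_ge:
  assumes "x \<in> P" "a \<le> x v" "0 \<le> t" "t \<le> 1"
  shows "a \<le> squeeze_homotopy K a b t x v"
proof -
  have "- squeeze_homotopy K a b t x v \<le> - a"
    using squeeze_ge[OF assms(1), of v] assms
      convex_bound_le[of "- x v" "-a" "- squeeze K a b x v" "1 - t" t]
    by (simp add: squeeze_homotopy_def)
  then show ?thesis by simp
qed

text \<open>A zero coordinate is at most \<open>a\<close> and hence stays zero, so the support can
  only shrink and remains a simplex.\<close>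

lemma squeeze_homotopy_in:
  assumes x: "x \<in> P" and t: "0 \<le> t" "t \<le> 1"
  shows "squeeze_homotopy K a b t x \<in> P"
proof -
  let ?y = "squeeze_homotopy K a b t x"
  have s: "0 \<le> squeeze K a b x v" for v
    using squeeze_ge[OF x, of v] pointD(2)[OF x, of v] ab by simp
  have nn: "0 \<le> ?y v" for v
    using s pointD(2)[OF x] t by (simp add: squeeze_homotopy_def)
  have off: "?y v = 0" if "v \<notin> vertices K" for v
    using pointD(1)[OF x that] ab squeeze_homotopy_fixed[of x v t] by simp
  have sum: "(\<Sum>v\<in>vertices K. ?y v) = 1"
    using sum_squeeze[OF x] pointD(3)[OF x]
    by (simp add: squeeze_homotopy_def sum.distrib flip: sum_distrib_left)
  have sub: "{v\<in>vertices K. ?y v > 0} \<subseteq> {v\<in>vertices K. x v > 0}"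
  proof clarify
    fix v assume "v \<in> vertices K" "?y v > 0"
    then show "x v > 0"
      using squeeze_homotopy_fixed[of x v t] ab by force
  qed
  have "\<exists>v\<in>vertices K. ?y v > 0"
    by (rule sum_one_imp_pos[OF sum])
  then have "{v\<in>vertices K. ?y v > 0} \<noteq> {}"
    by blast
  then have "{v\<in>vertices K. ?y v > 0} \<in> K"
    using sub by (rule down_closedD[OF down_closed_complex pointD(4)[OF x]])
  then show ?thesis
    using nn off sum by (simp add: topspace_polytope_space)
qed

text \<open>Below \<open>b\<close> coordinates never rise above a level \<open>s\<close> they have
  not exceeded. So the set of coordinates above \<open>s\<close> can only shrink, and it cannot
  become empty because \<open>s\<close> is admissible as well.\<close>

lemma squeeze_homotopy_superlevel:
  assumes L: "down_closed L" and x: "x \<in> superlevel K s L" and s: "0 \<le> s" "s \<le> b" and t: "0 \<le> t" "t \<le> 1"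
  shows "squeeze_homotopy K a b t x \<in> superlevel K s L"
proof -
  let ?y = "squeeze_homotopy K a b t x"
  have xP: "x \<in> P" and y: "?y \<in> P"
    using x squeeze_homotopy_in t by (auto simp: superlevel_def)
  have "admissible_level K s"
    using lev s unfolding admissible_level_def
    by (meson mult_right_mono of_nat_0_le_iff order.strict_trans1)
  then have "{v\<in>vertices K. ?y v > s} \<noteq> {}"
    using exceeds_level[OF y] by blast
  moreover have "{v\<in>vertices K. ?y v > s} \<subseteq> {v\<in>vertices K. x v > s}"
    using squeeze_homotopy_low[of x _ s t] s t by (auto simp flip: not_le)
  ultimately have "{v\<in>vertices K. ?y v > s} \<in> L"
    by (rule down_closedD[OF L, of "{v\<in>vertices K. x v > s}", rotated]) (use x in \<open>simp add: superlevel_def\<close>)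
  then show ?thesis
    using y by (simp add: superlevel_def)
qed

text \<open>At the end of the deformation only coordinates that exceeded \<open>b\<close> can exceed
  \<open>a\<close>. This is the point where the level changes.\<close>

lemma squeeze_superlevel:
  assumes L: "down_closed L" and x: "x \<in> superlevel K b L"
  shows "squeeze K a b x \<in> superlevel K a L"
proof -
  let ?y = "squeeze K a b x"
  have xP: "x \<in> P" and y: "?y \<in> P"
    using x squeeze_homotopy_in[of x 1] by (auto simp: superlevel_def)
  have "admissible_level K a"
    using lev ab unfolding admissible_level_def
    by (meson mult_right_mono of_nat_0_le_iff order.strict_trans1)
  then have "{v\<in>vertices K. ?y v > a} \<noteq> {}"
    using exceeds_level[OF y] by blast
  moreover have "{v\<in>vertices K. ?y v > a} \<subseteq> {v\<in>vertices K. x v > b}"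
    using squeeze_low[of x] by (auto simp flip: not_le)
  ultimately have "{v\<in>vertices K. ?y v > a} \<in> L"
    by (rule down_closedD[OF L, of "{v\<in>vertices K. x v > b}", rotated]) (use x in \<open>simp add: superlevel_def\<close>)
  then show ?thesis
    using y by (simp add: superlevel_def)
qed

lemma continuous_on_squeeze_homotopy:
  assumes "A \<subseteq> P"
  shows "continuous_on ({0..1} \<times> A) (\<lambda>z. squeeze_homotopy K a b (fst z) (snd z))"
proof (rule continuous_on_coordinatewise_then_product)
  fix v
  have c: "continuous_on ({0..1::real} \<times> A) (\<lambda>z. snd z w)" for w
    by (rule continuous_on_compose2[OF continuous_on_coordinate continuous_on_snd]) (auto intro: continuous_on_id)
  have "(\<Sum>w\<in>vertices K. max (snd z w - b) 0) \<noteq> 0" if "z \<in> {0..1::real} \<times> A" for z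
    using squeeze_denominator_pos[of "snd z"] that assms by (auto simp: mem_Times_iff)
  then show "continuous_on ({0..1} \<times> A) (\<lambda>z. squeeze_homotopy K a b (fst z) (snd z) v)"
    unfolding squeeze_homotopy_def squeeze_def
    by (intro continuous_intros c) (auto simp: mem_Times_iff)
qed

lemma homotopic_squeeze:
  assumes A: "A \<subseteq> P"
    and HA: "\<And>x t. x \<in> A \<Longrightarrow> 0 \<le> t \<Longrightarrow> t \<le> 1 \<Longrightarrow> squeeze_homotopy K a b t x \<in> A"
    and HB: "\<And>x t. x \<in> A \<Longrightarrow> x \<in> B \<Longrightarrow> 0 \<le> t \<Longrightarrow> t \<le> 1 \<Longrightarrow> squeeze_homotopy K a b t x \<in> B"
    and B: "B \<subseteq> A"
  shows "homotopic_with (\<lambda>h. h \<in> B \<rightarrow> B) (subtopology X A) (subtopology X A) (squeeze K a b) id"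
proof -
  have XA: "subtopology X A = top_of_set A"
    using A by (rule subtopology_polytope_space)
  have "homotopic_with (\<lambda>h. h \<in> B \<rightarrow> B) (subtopology X A) (subtopology X A) id (squeeze K a b)"
    unfolding homotopic_with_def
  proof (intro exI[where x="\<lambda>z. squeeze_homotopy K a b (fst z) (snd z)"] conjI allI ballI)
    show "continuous_map (prod_topology (top_of_set {0..1}) (subtopology X A)) (subtopology X A)
            (\<lambda>z. squeeze_homotopy K a b (fst z) (snd z))"
      using continuous_on_squeeze_homotopy[OF A] HA
      by (auto simp: XA prod_topology_subtopology_eu continuous_map_in_subtopology image_subset_iff_funcset[symmetric])
  qed (use HB B in auto)
  then show ?thesis
    by (simp add: homotopic_with_sym)
qed

end

end

definition faces :: "'v set \<Rightarrow> 'v set set" where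
  "faces \<sigma> = {\<tau>. \<tau> \<noteq> {} \<and> \<tau> \<subseteq> \<sigma>}"

lemma down_closed_faces: "down_closed (faces \<sigma>)"
  by (auto simp: down_closed_def faces_def)

section \<open>Isomorphisms induced by squeezing, and excision of closed sets\<close>

context polyhedron
begin

lemma continuous_map_id_subtopology: "A \<subseteq> A' \<Longrightarrow> continuous_map (subtopology Y A) (subtopology Y A') id"
  by (simp add: continuous_map_in_subtopology continuous_map_from_subtopology Pi_def) auto

text \<open>\<open>squeeze\<close> is a homotopy inverse of the inclusion. Both composites are
  \<open>squeeze\<close> again, on the small and on the large pair, and the straight-line homotopy
  joins each to the identity.\<close>

lemma inclusion_iso_squeeze:
  assumes ab: "0 \<le> a" "a \<le> b" and lev: "admissible_level K b"
    and sub: "A \<subseteq> A'" "A' \<subseteq> P" "B \<subseteq> A" "B' \<subseteq> A'" "B \<subseteq> B'"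
    and inv: "\<And>D x t. D \<in> {A, A', B, B'} \<Longrightarrow> x \<in> D \<Longrightarrow> 0 \<le> t \<Longrightarrow> t \<le> 1 \<Longrightarrow> squeeze_homotopy K a b t x \<in> D"
    and im: "\<And>x. x \<in> A' \<Longrightarrow> squeeze K a b x \<in> A" "\<And>x. x \<in> B' \<Longrightarrow> squeeze K a b x \<in> B"
  shows "hom_induced p (subtopology X A) B (subtopology X A') B' id
    \<in> iso (relative_homology_group p (subtopology X A) B) (relative_homology_group p (subtopology X A') B')"
proof (rule homotopy_equivalence_relative_homology_group_isomorphism)
  have 1: "homotopic_with (\<lambda>h. h \<in> B \<rightarrow> B) (subtopology X A) (subtopology X A) (squeeze K a b) id"
    using sub inv by (intro homotopic_squeeze[OF ab lev]) auto
  have 2: "homotopic_with (\<lambda>h. h \<in> B' \<rightarrow> B') (subtopology X A') (subtopology X A') (squeeze K a b) id"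
    using sub inv by (intro homotopic_squeeze[OF ab lev]) auto
  show "homotopic_with (\<lambda>h. h \<in> B \<rightarrow> B) (subtopology X A) (subtopology X A) (squeeze K a b \<circ> id) id"
    "homotopic_with (\<lambda>h. h \<in> B' \<rightarrow> B') (subtopology X A') (subtopology X A') (id \<circ> squeeze K a b) id"
    using 1 2 by simp_all
  show "continuous_map (subtopology X A') (subtopology X A) (squeeze K a b)"
    using homotopic_with_imp_continuous_maps[OF 2] im(1) sub
    by (auto simp: continuous_map_in_subtopology)
  show "continuous_map (subtopology X A) (subtopology X A') id"
    using sub(1) by (rule continuous_map_id_subtopology)
qed (use sub im in auto)

lemma iso_cancel_square:
  assumes i: "i \<in> hom G H" and j2: "j2 \<in> iso H H'" and j1: "j1 \<in> iso G G'" and e: "e \<in> iso G' H'"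
    and comm: "\<And>x. x \<in> carrier G \<Longrightarrow> j2 (i x) = e (j1 x)"
  shows "i \<in> iso G H"
proof -
  have bij: "bij_betw j2 (carrier H) (carrier H')" "bij_betw j1 (carrier G) (carrier G')"
    "bij_betw e (carrier G') (carrier H')"
    using j1 j2 e by (auto simp: iso_def)
  have "bij_betw (j2 \<circ> i) (carrier G) (carrier H')"
    using bij_betw_trans[OF bij(2,3)] by (rule bij_betw_cong[THEN iffD1, rotated]) (simp add: comm)
  moreover have "i ` carrier G \<subseteq> carrier H"
    using i by (auto simp: hom_def)
  ultimately have "bij_betw i (carrier G) (carrier H)"
    using bij_betw_comp_iff2[OF bij(1)] by blast
  then show ?thesis
    using i by (simp add: iso_def)
qed

text \<open>
  The closed sets do not satisfy the hypothesis of the excision axiom. Raising the level on \<open>M\<close> from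
  \<open>a\<close> to \<open>b\<close> thickens them, and squeezing shows that this does not change the homology of the pairs.
\<close>

lemma excision_closed:
  assumes a: "0 \<le> a" "a < b" and lev: "admissible_level K b"
    and L: "down_closed L" and M: "down_closed M" "M \<subseteq> L"
    and cover: "superlevel K a L = C \<union> superlevel K a M"
    and inv: "\<And>x t. x \<in> C \<Longrightarrow> 0 \<le> t \<Longrightarrow> t \<le> 1 \<Longrightarrow> squeeze_homotopy K a b t x \<in> C"
  shows "hom_induced p (subtopology X C) (C \<inter> superlevel K a M) (subtopology X (superlevel K a L)) (superlevel K a M) id
    \<in> iso (relative_homology_group p (subtopology X C) (C \<inter> superlevel K a M))
          (relative_homology_group p (subtopology X (superlevel K a L)) (superlevel K a M))"
proof -
  let ?La = "superlevel K a L" and ?Ma = "superlevel K a M" and ?Mb = "superlevel K b M"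
  have leva: "admissible_level K a"
    using lev a unfolding admissible_level_def
    by (meson less_imp_le mult_right_mono of_nat_0_le_iff order.strict_trans1)
  have MLa: "?Ma \<subseteq> ?La" and MM: "?Ma \<subseteq> ?Mb" and CL: "C \<subseteq> ?La" and LP: "?La \<subseteq> P"
    using superlevel_mono[OF M(2)] superlevel_level_mono[OF lev M(1)] a cover superlevel_subset[of a L] by auto
  have invL: "squeeze_homotopy K a b t x \<in> superlevel K s N"
    if "x \<in> superlevel K s N" "down_closed N" "0 \<le> s" "s \<le> b" "0 \<le> t" "t \<le> 1" for s N x t
    using squeeze_homotopy_superlevel[of a b N x s t] that a lev by auto
  have sq: "squeeze K a b x \<in> ?Ma" if "x \<in> ?Mb" for x
    using squeeze_superlevel[of a b M x] that a lev M by auto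
  have b0: "0 \<le> b" using a by simp
  let ?X' = "subtopology X ?La"
  have excise: "hom_induced p (subtopology X C) (C \<inter> ?Mb) ?X' (?La \<inter> ?Mb) id
    \<in> iso (relative_homology_group p (subtopology X C) (C \<inter> ?Mb)) (relative_homology_group p ?X' (?La \<inter> ?Mb))"
  proof -
    \<comment> \<open>By the covering, the part \<open>?U\<close> to be cut out lies in
      \<open>?Ma\<close>. That set is closed and, by the choice of \<open>W\<close>, inside the
      interior of the thickened \<open>?T\<close>.\<close>
    let ?U = "?La - C" and ?T = "?La \<inter> ?Mb"
    obtain W where W: "openin X W" "?Ma \<subseteq> W" "W \<subseteq> ?Mb"
      using superlevel_interior[OF a lev M(1)] .
    have "closedin ?X' ?Ma"
      using closedin_superlevel[OF leva M(1)] MLa by (simp add: closedin_subset_topspace)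
    then have "?X' closure_of ?U \<subseteq> ?Ma"
      using cover by (intro closure_of_minimal) auto
    also have "?Ma \<subseteq> ?X' interior_of ?T"
    proof -
      have "openin ?X' (?La \<inter> W)"
        using W(1) by (auto simp: openin_subtopology)
      then have "?La \<inter> W \<subseteq> ?X' interior_of ?T"
        using W(3) by (intro interior_of_maximal) auto
      then show ?thesis
        using W(2) MLa by blast
    qed
    finally have "hom_induced p (subtopology ?X' (?La - ?U)) (?T - ?U) (subtopology ?X' ?La) ?T id
      \<in> iso (relative_homology_group p (subtopology ?X' (?La - ?U)) (?T - ?U))
            (relative_homology_group p (subtopology ?X' ?La) ?T)"
      by (intro homology_excision_axiom) auto
    moreover have "?La - ?U = C" "?T - ?U = C \<inter> ?Mb" "?La \<inter> C = C"
      using CL by auto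
    ultimately show ?thesis
      by (simp add: subtopology_subtopology)
  qed
  have j1: "hom_induced p (subtopology X C) (C \<inter> ?Ma) (subtopology X C) (C \<inter> ?Mb) id
    \<in> iso (relative_homology_group p (subtopology X C) (C \<inter> ?Ma)) (relative_homology_group p (subtopology X C) (C \<inter> ?Mb))"
  proof (rule inclusion_iso_squeeze[OF a(1) less_imp_le[OF a(2)] lev])
    fix D x t assume *: "D \<in> {C, C, C \<inter> ?Ma, C \<inter> ?Mb}" "x \<in> D" and t: "0 \<le> t" "t \<le> (1::real)"
    then show "squeeze_homotopy K a b t x \<in> D"
      using inv[OF _ t, of x] invL[OF _ M(1) a(1) less_imp_le[OF a(2)] t, of x] invL[OF _ M(1) b0 order_refl t, of x]
      by auto
  next
    fix x assume "x \<in> C"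
    then show "squeeze K a b x \<in> C"
      using inv[of x 1] by simp
  next
    fix x assume "x \<in> C \<inter> ?Mb"
    then show "squeeze K a b x \<in> C \<inter> ?Ma"
      using sq inv[of x 1] by simp
  qed (use CL LP MM in auto)
  have j2: "hom_induced p ?X' ?Ma ?X' (?La \<inter> ?Mb) id
    \<in> iso (relative_homology_group p ?X' ?Ma) (relative_homology_group p ?X' (?La \<inter> ?Mb))"
  proof (rule inclusion_iso_squeeze[OF a(1) less_imp_le[OF a(2)] lev])
    fix D x t assume *: "D \<in> {?La, ?La, ?Ma, ?La \<inter> ?Mb}" "x \<in> D" and t: "0 \<le> t" "t \<le> (1::real)"
    then show "squeeze_homotopy K a b t x \<in> D"
      using invL[OF _ L a(1) less_imp_le[OF a(2)] t, of x]
        invL[OF _ M(1) a(1) less_imp_le[OF a(2)] t, of x] invL[OF _ M(1) b0 order_refl t, of x]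
      by auto
  next
    fix x assume "x \<in> ?La"
    then show "squeeze K a b x \<in> ?La"
      using invL[OF _ L a(1) less_imp_le[OF a(2)], of x 1] by simp
  qed (use MLa MM LP sq in auto)
  show ?thesis
  \<comment> \<open>The maps \<open>j1\<close> and \<open>j2\<close> raise the level on
    \<open>M\<close> from \<open>a\<close> to \<open>b\<close>. Excision holds at level
    \<open>b\<close>, and the square carries it back to level \<open>a\<close>.\<close>
  proof (rule iso_cancel_square[OF hom_induced_hom j2 j1 excise])
    fix x
    show "hom_induced p ?X' ?Ma ?X' (?La \<inter> ?Mb) id (hom_induced p (subtopology X C) (C \<inter> ?Ma) ?X' ?Ma id x) =
      hom_induced p (subtopology X C) (C \<inter> ?Mb) ?X' (?La \<inter> ?Mb) id
        (hom_induced p (subtopology X C) (C \<inter> ?Ma) (subtopology X C) (C \<inter> ?Mb) id x)"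
      using MM MLa CL by (subst (1 2) hom_induced_compose') (auto intro: continuous_map_id_subtopology)
  qed
qed

lemma admissible_level_0: "admissible_level K 0"
  by (simp add: admissible_level_def)

lemma faces_subset: "\<sigma> \<in> K \<Longrightarrow> faces \<sigma> \<subseteq> K"
  using down_closedD[OF down_closed_complex] by (auto simp: faces_def)

lemma superlevel_faces: "\<sigma> \<in> K \<Longrightarrow> superlevel K 0 (faces \<sigma>) = {x\<in>P. \<forall>v. v \<notin> \<sigma> \<longrightarrow> x v = 0}"
proof
  assume \<sigma>: "\<sigma> \<in> K"
  show "superlevel K 0 (faces \<sigma>) \<subseteq> {x\<in>P. \<forall>v. v \<notin> \<sigma> \<longrightarrow> x v = 0}"
  proof (clarsimp simp: superlevel_def faces_def, rule ccontr)
    fix x v assume "x \<in> P" "{v \<in> vertices K. 0 < x v} \<subseteq> \<sigma>" "v \<notin> \<sigma>" "x v \<noteq> 0"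
    moreover from this have "x v > 0" "v \<in> vertices K"
      using pointD(1,2)[of x v] by (auto simp: order_less_le)
    ultimately show False by blast
  qed
  show "{x\<in>P. \<forall>v. v \<notin> \<sigma> \<longrightarrow> x v = 0} \<subseteq> superlevel K 0 (faces \<sigma>)"
  proof clarify
    fix x assume x: "x \<in> P" "\<forall>v. v \<notin> \<sigma> \<longrightarrow> x v = 0"
    have "{v \<in> vertices K. 0 < x v} \<noteq> {}"
      using exceeds_level[OF x(1) admissible_level_0] by blast
    moreover have "{v \<in> vertices K. 0 < x v} \<subseteq> \<sigma>"
      using x(2) by force
    ultimately show "x \<in> superlevel K 0 (faces \<sigma>)"
      using x(1) by (simp add: superlevel_def faces_def)
  qed
qed

lemma convex_faces:
  assumes \<sigma>: "\<sigma> \<in> K" and x: "x \<in> superlevel K 0 (faces \<sigma>)" and y: "y \<in> superlevel K 0 (faces \<sigma>)"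
    and t: "0 \<le> t" "t \<le> 1"
  shows "(\<lambda>v. (1 - t) * x v + t * y v) \<in> superlevel K 0 (faces \<sigma>)"
proof -
  let ?z = "\<lambda>v. (1 - t) * x v + t * y v"
  have xP: "x \<in> P" "\<forall>v. v \<notin> \<sigma> \<longrightarrow> x v = 0" and yP: "y \<in> P" "\<forall>v. v \<notin> \<sigma> \<longrightarrow> y v = 0"
    using x y superlevel_faces[OF \<sigma>] by auto
  have nn: "0 \<le> ?z v" for v
    using pointD(2)[OF xP(1)] pointD(2)[OF yP(1)] t by simp
  have sum: "(\<Sum>v\<in>vertices K. ?z v) = 1"
    using pointD(3)[OF xP(1)] pointD(3)[OF yP(1)] by (simp add: sum.distrib flip: sum_distrib_left)
  have off: "?z v = 0" if "v \<notin> \<sigma>" for v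
    using xP yP that by simp
  have "\<exists>v\<in>vertices K. ?z v > 0"
    by (rule sum_one_imp_pos[OF sum])
  then have "{v \<in> vertices K. 0 < ?z v} \<noteq> {}" by blast
  moreover have "{v \<in> vertices K. 0 < ?z v} \<subseteq> \<sigma>"
    using off by force
  ultimately have "{v \<in> vertices K. 0 < ?z v} \<in> K"
    by (rule down_closedD[OF down_closed_complex \<sigma>])
  moreover have "?z v = 0" if "v \<notin> vertices K" for v
    using off simplex_vertices[OF \<sigma>] that by blast
  ultimately have "?z \<in> P"
    using nn sum by (simp add: topspace_polytope_space)
  then show ?thesis
    using off superlevel_faces[OF \<sigma>] by simp
qed

lemma admissible_level_exists:
  obtains b where "b > 0" "admissible_level K b"
proof
  \<comment> \<open>The sum bounds all cardinalities at once, and the extra \<open>1\<close> makes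
    the estimate strict and the denominator positive.\<close>
  let ?N = "\<Sum>\<sigma>\<in>K. card \<sigma>"
  have pos: "0 < 1 + real ?N"
    by (rule add_pos_nonneg[OF zero_less_one of_nat_0_le_iff])
  then show "1 / (1 + real ?N) > 0"
    by (rule divide_pos_pos[OF zero_less_one])
  have "card \<sigma> \<le> ?N" if "\<sigma> \<in> K" for \<sigma>
    using member_le_sum[OF that, of card] finite_complex by simp
  then have "real (card \<sigma>) < 1 + real ?N" if "\<sigma> \<in> K" for \<sigma>
    using that by (smt (verit) of_nat_mono)
  then show "admissible_level K (1 / (1 + real ?N))"
    unfolding admissible_level_def using pos by (simp only: divide_less_eq times_divide_eq_left) (simp add: less_imp_le)
qed

end

section \<open>Simplicial and singular homology agree\<close>

lemma continuous_on_simplex_param: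
  assumes "card \<sigma> = Suc p"
  shows "continuous_on (standard_simplex p) (simplex_param r \<sigma>)"
proof (rule continuous_on_coordinatewise_then_product)
  fix v
  have "continuous_on (standard_simplex p) (\<lambda>t::nat\<Rightarrow>real. t (position r \<sigma> v))"
    by (rule continuous_on_subset[OF continuous_on_product_coordinates]) simp
  then have "continuous_on (standard_simplex p) (\<lambda>t. if v \<in> \<sigma> then t (position r \<sigma> v) else 0)"
    by (cases "v \<in> \<sigma>") auto
  then show "continuous_on (standard_simplex p) (\<lambda>t. simplex_param r \<sigma> t v)"
    by (rule continuous_on_eq) (simp add: simplex_param_def assms)
qed

locale ordered_polyhedron = polyhedron K for K :: "'v set set" +
  fixes r :: "'v rel"
  assumes order: "linear_order_on (vertices K) r"
begin

abbreviation "space_of L \<equiv> subtopology X (superlevel K 0 L)"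

lemma simplex_param_sum:
  assumes \<sigma>: "\<sigma> \<in> K" "card \<sigma> = Suc p" and t: "t \<in> standard_simplex p"
  shows "(\<Sum>v\<in>vertices K. simplex_param r \<sigma> t v) = 1"
proof -
  have "(\<Sum>v\<in>vertices K. simplex_param r \<sigma> t v) = (\<Sum>v\<in>\<sigma>. t (position r \<sigma> v))"
    using \<sigma> t simplex_vertices[OF \<sigma>(1)] finite_vertices
    by (intro sum.mono_neutral_cong_right) (auto simp: simplex_param_def)
  also have "\<dots> = (\<Sum>i<card \<sigma>. t i)"
    by (rule sum.reindex_bij_betw[OF bij_betw_position[OF order simplex_vertices simplexD(2)]]) (use \<sigma> in auto)
  also have "\<dots> = 1"
    using t \<sigma> by (simp add: standard_simplex_def lessThan_Suc_atMost)
  finally show ?thesis .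
qed

lemma simplex_param_in:
  assumes L: "down_closed L" "L \<subseteq> K" and \<sigma>: "\<sigma> \<in> L" "card \<sigma> = Suc p" and t: "t \<in> standard_simplex p"
  shows "simplex_param r \<sigma> t \<in> superlevel K 0 L"
proof -
  let ?x = "simplex_param r \<sigma> t"
  have \<sigma>K: "\<sigma> \<in> K" using \<sigma> L by auto
  have x: "?x v = (if v \<in> \<sigma> then t (position r \<sigma> v) else 0)" for v
    using t \<sigma> by (simp add: simplex_param_def)
  have nn: "0 \<le> ?x v" for v
    using t by (simp add: x standard_simplex_def)
  have sum: "(\<Sum>v\<in>vertices K. ?x v) = 1"
    using simplex_param_sum[OF \<sigma>K \<sigma>(2) t] .
  have "\<exists>v\<in>vertices K. ?x v > 0"
    by (rule sum_one_imp_pos[OF sum])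
  then have "{v\<in>vertices K. ?x v > 0} \<noteq> {}" "{v\<in>vertices K. ?x v > 0} \<subseteq> \<sigma>"
    by (auto simp: x split: if_splits)
  then have "{v\<in>vertices K. ?x v > 0} \<in> L"
    by (rule down_closedD[OF L(1) \<sigma>(1)])
  moreover have "?x v = 0" if "v \<notin> vertices K" for v
    using that simplex_vertices[OF \<sigma>K] by (auto simp: x)
  ultimately show ?thesis
    using nn sum L(2) by (auto simp: superlevel_def topspace_polytope_space)
qed

lemma singular_simplex_param:
  assumes L: "down_closed L" "L \<subseteq> K" and \<sigma>: "\<sigma> \<in> L" "card \<sigma> = Suc p"
  shows "singular_simplex p (space_of L) (simplex_param r \<sigma>)"
proof -
  have "simplex_param r \<sigma> \<in> extensional (standard_simplex p)"
    using \<sigma>(2) by (simp add: simplex_param_def)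
  moreover have "continuous_map (subtopology (powertop_real UNIV) (standard_simplex p)) (space_of L) (simplex_param r \<sigma>)"
    using simplex_param_in[OF assms] continuous_on_simplex_param[OF \<sigma>(2)]
    by (auto simp: subtopology_polytope_space[OF superlevel_subset] euclidean_product_topology
        continuous_map_in_subtopology)
  ultimately show ?thesis
    by (simp add: singular_simplex_def)
qed

lemma singular_chain_realize:
  assumes L: "down_closed L" "L \<subseteq> K" and c: "c \<in> simp_chains L p"
  shows "singular_chain p (space_of L) (realize r c)"
  unfolding realize_def
proof (rule singular_chain_extend)
  fix \<sigma> assume "\<sigma> \<in> Poly_Mapping.keys c"
  then have "\<sigma> \<in> L" "card \<sigma> = Suc p"
    using c by (auto simp: simp_chains_def)
  then show "singular_chain p (space_of L) ((frag_of \<circ> simplex_param r) \<sigma>)"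
    using singular_simplex_param[OF L] by (simp add: singular_chain_of)
qed

text \<open>
  Injectivity of \<^const>\<open>realize\<close> yields \<open>\<partial>\<partial> = 0\<close> for simplicial chains from the singular case, without
  a computation with signs.
\<close>

lemma realize_eq_0:
  assumes c: "c \<in> simp_chains K p" and "realize r c = 0"
  shows "c = 0"
proof -
  \<comment> \<open>\<open>?g\<close> recovers a simplex from its parametrization as the set of
    coordinates that do not vanish identically. Its linear extension is a left inverse of
    \<open>realize\<close> on these chains.\<close>
  let ?g = "\<lambda>f::(nat \<Rightarrow> real) \<Rightarrow> 'v \<Rightarrow> real. {v. \<exists>t\<in>standard_simplex p. f t v \<noteq> 0}"
  have g: "?g (simplex_param r \<sigma>) = \<sigma>" if \<sigma>: "\<sigma> \<in> K" "card \<sigma> = Suc p" for \<sigma>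
  proof
    show "?g (simplex_param r \<sigma>) \<subseteq> \<sigma>"
      using \<sigma> by (auto simp: simplex_param_def)
    show "\<sigma> \<subseteq> ?g (simplex_param r \<sigma>)"
    proof
      fix v assume v: "v \<in> \<sigma>"
      let ?t = "\<lambda>j. if j = position r \<sigma> v then 1 else 0 :: real"
      have "position r \<sigma> v \<le> p"
        using bij_betw_apply[OF bij_betw_position[OF order simplex_vertices[OF \<sigma>(1)] simplexD(2)[OF \<sigma>(1)]] v] \<sigma>
        by simp
      then have "?t \<in> standard_simplex p"
        by simp
      moreover from this have "simplex_param r \<sigma> ?t v = 1"
        using v \<sigma> by (simp add: simplex_param_def)
      ultimately show "v \<in> ?g (simplex_param r \<sigma>)"
        by (intro CollectI bexI[of _ ?t]) simp_all
    qed
  qed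
  have "frag_extend (frag_of \<circ> ?g) (realize r c) = frag_extend ((frag_of \<circ> ?g) \<circ> simplex_param r) c"
    unfolding realize_def by (rule frag_extend_compose)
  also have "\<dots> = frag_extend frag_of c"
    using c g by (intro frag_extend_eq) (auto simp: simp_chains_def)
  also have "\<dots> = c"
    by (rule frag_expansion[symmetric])
  finally show ?thesis
    using assms(2) by simp
qed

lemma simplicial_boundary_boundary:
  assumes c: "c \<in> simp_chains K p"
  shows "simplicial_boundary r (p - 1) (simplicial_boundary r p c) = 0"
proof (rule realize_eq_0)
  have 1: "simplicial_boundary r p c \<in> simp_chains K (p - 1)"
    by (rule simplicial_boundary_in[OF down_closed_complex c])
  show "simplicial_boundary r (p - 1) (simplicial_boundary r p c) \<in> simp_chains K (p - 1 - 1)"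
    by (rule simplicial_boundary_in[OF down_closed_complex 1])
  have "singular_chain p (space_of K) (realize r c)"
    by (rule singular_chain_realize[OF down_closed_complex order_refl c])
  then show "realize r (simplicial_boundary r (p - 1) (simplicial_boundary r p c)) = 0"
    using chain_boundary_boundary chain_boundary_realize[OF order c] chain_boundary_realize[OF order 1]
    by (metis One_nat_def)
qed

text \<open>
  The mapping cone of \<^const>\<open>realize\<close>: simplicial chains of dimension \<open>q - 1\<close> paired with singular chains
  of dimension \<open>q\<close>. Acyclicity of the cone for a pair of subcomplexes says that \<^const>\<open>realize\<close> induces
  an isomorphism from simplicial to singular relative homology.
\<close>

definition cone_chains :: "'v set set \<Rightarrow> nat \<Rightarrow> (('v set \<Rightarrow>\<^sub>0 int) \<times> ('v \<Rightarrow> real) chain) set" where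
  "cone_chains L q = {(c, w). (case q of 0 \<Rightarrow> c = 0 | Suc p \<Rightarrow> c \<in> simp_chains L p) \<and> singular_chain q (space_of L) w}"

text \<open>The minus sign makes the two copies of the realized simplicial boundary cancel when the
  differential is squared. In degree \<open>1\<close> the simplicial component vanishes by itself,
  as \<open>cone_chains\<close> demands in degree \<open>0\<close>.\<close>

definition cone_boundary ::
    "nat \<Rightarrow> ('v set \<Rightarrow>\<^sub>0 int) \<times> ('v \<Rightarrow> real) chain \<Rightarrow> ('v set \<Rightarrow>\<^sub>0 int) \<times> ('v \<Rightarrow> real) chain" where
  "cone_boundary q x =
     (case q of 0 \<Rightarrow> 0
      | Suc p \<Rightarrow> (- simplicial_boundary r p (fst x), realize r (fst x) + chain_boundary (Suc p) (snd x)))"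

lemma cone_chains_0: "(c, w) \<in> cone_chains L 0 \<longleftrightarrow> c = 0 \<and> singular_chain 0 (space_of L) w"
  and cone_chains_Suc: "(c, w) \<in> cone_chains L (Suc p) \<longleftrightarrow> c \<in> simp_chains L p \<and> singular_chain (Suc p) (space_of L) w"
  by (auto simp: cone_chains_def)

lemma cone_boundary_0 [simp]: "cone_boundary 0 x = 0"
  and cone_boundary_Suc: "cone_boundary (Suc p) (c, w) =
     (- simplicial_boundary r p c, realize r c + chain_boundary (Suc p) w)"
  by (simp_all add: cone_boundary_def)

lemma cone_chains_mono: "L \<subseteq> L' \<Longrightarrow> cone_chains L q \<subseteq> cone_chains L' q"
  using simp_chains_mono[of L L'] singular_chain_mono[OF _ superlevel_mono, of _ X 0 L _ L']
  by (cases q) (auto simp: cone_chains_def subset_iff)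

lemma simplicial_boundary_0: "simplicial_boundary r 0 c = 0"
  by (simp add: simplicial_boundary_def)

lemma dg_subgroup_cone:
  assumes L: "down_closed L" "L \<subseteq> K"
  shows "dg_subgroup cone_boundary (cone_chains L)"
  unfolding dg_subgroup_def
proof (intro allI conjI ballI)
  fix q
  show "0 \<in> cone_chains L q"
    by (cases q) (simp_all add: zero_prod_def cone_chains_0 cone_chains_Suc simp_chains_closed)
  show "x - y \<in> cone_chains L q" if "x \<in> cone_chains L q" "y \<in> cone_chains L q" for x y
    using that by (cases q; cases x; cases y)
      (auto simp: cone_chains_0 cone_chains_Suc simp_chains_closed intro: singular_chain_diff)
  show "cone_boundary q (x - y) = cone_boundary q x - cone_boundary q y" for x y
    by (cases q; cases x; cases y)
      (auto simp: cone_boundary_Suc simplicial_boundary_linear realize_linear chain_boundary_diff)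
  show "cone_boundary 0 x = 0" for x
    by simp
  show D: "cone_boundary q x \<in> cone_chains L (q - 1)" if x: "x \<in> cone_chains L q" for x
  proof (cases q)
    case 0
    then show ?thesis
      by (simp add: zero_prod_def cone_chains_0)
  next
    case (Suc p)
    obtain c w where cw: "x = (c, w)" "c \<in> simp_chains L p" "singular_chain (Suc p) (space_of L) w"
      using x Suc by (cases x) (auto simp: cone_chains_Suc)
    have "singular_chain p (space_of L) (realize r c + chain_boundary (Suc p) w)"
      using singular_chain_realize[OF L cw(2)] singular_chain_boundary_alt[OF cw(3)] by (rule singular_chain_add)
    then show ?thesis
      using simplicial_boundary_in[OF L(1) cw(2), of r]
      by (cases p) (auto simp: Suc cw(1) cone_boundary_Suc cone_chains_0 cone_chains_Suc simplicial_boundary_0 simp_chains_closed)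
  qed
  show "cone_boundary (q - 1) (cone_boundary q x) = 0" if x: "x \<in> cone_chains L q" for x
  proof (cases q)
    case (Suc p)
    obtain c w where cw: "x = (c, w)" "c \<in> simp_chains L p" "singular_chain (Suc p) (space_of L) w"
      using x Suc by (cases x) (auto simp: cone_chains_Suc)
    have cK: "c \<in> simp_chains K p"
      using simp_chains_mono[OF L(2)] cw(2) by auto
    show ?thesis
    proof (cases p)
      case (Suc n)
      have "simplicial_boundary r n (simplicial_boundary r p c) = 0"
        using simplicial_boundary_boundary[OF cK] Suc by simp
      moreover have "chain_boundary p (chain_boundary (Suc p) w) = 0"
        using chain_boundary_boundary_alt[OF cw(3)] .
      ultimately show ?thesis
        using chain_boundary_realize[OF order cK] \<open>q = Suc p\<close> Suc
        by (simp add: cw(1) cone_boundary_Suc chain_boundary_add simplicial_boundary_linear realize_linear zero_prod_def)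
    qed (simp add: Suc)
  qed simp
qed

lemma trivial_homology_relboundary:
  assumes "trivial_group (relative_homology_group (int p) Y S)" "singular_relcycle p Y S c"
  shows "singular_relboundary p Y S c"
proof -
  have "homologous_rel_set p Y S c \<in> carrier (relative_homology_group (int p) Y S)"
    using assms(2) by (auto simp: carrier_relative_homology_group)
  then have "homologous_rel_set p Y S c = singular_relboundary_set p Y S"
    using assms(1) by (auto simp: trivial_group_def)
  then show ?thesis
    by (simp add: homologous_rel_set_eq_relboundary)
qed

lemma simp_chains_empty: "c \<in> simp_chains {} p \<longleftrightarrow> c = 0"
  by (simp add: simp_chains_def)

lemma superlevel_empty: "superlevel K a {} = {}"
  by (simp add: superlevel_def)

lemma cone_chains_empty: "x \<in> cone_chains {} q \<longleftrightarrow> x = 0"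
  by (cases q; cases x)
    (auto simp: cone_chains_0 cone_chains_Suc simp_chains_empty zero_prod_def superlevel_empty singular_chain_empty)

text \<open>If both relative homologies vanish, a cone cycle \<open>(c, w)\<close> can be filled one
  component at a time. Once \<open>c\<close> is filled by \<open>d\<close> modulo \<open>M\<close>,
  the chain \<open>w + realize r d\<close> is a relative singular cycle and bounds some
  \<open>u\<close> modulo \<open>M\<close>; the sign in the cone differential makes
  \<open>(- d, u)\<close> the witness.\<close>

lemma acyclic_cone_from_both:
  assumes L: "down_closed L" "L \<subseteq> K" and M: "down_closed M" "M \<subseteq> L"
    and sim: "\<And>p c. c \<in> simp_chains L p \<Longrightarrow> simplicial_boundary r p c \<in> simp_chains M (p - 1) \<Longrightarrow>
      \<exists>d\<in>simp_chains L (Suc p). c - simplicial_boundary r (Suc p) d \<in> simp_chains M p"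
    and sing: "\<And>p. trivial_group (relative_homology_group (int p) (space_of L) (superlevel K 0 M))"
  shows "acyclic_pair cone_boundary (cone_chains L) (cone_chains M)"
proof -
  have msub: "superlevel K 0 M \<subseteq> superlevel K 0 L"
    by (rule superlevel_mono[OF M(2)])
  then have sub: "subtopology (space_of L) (superlevel K 0 M) = space_of M"
    by (simp add: subtopology_subtopology Int_absorb1)
  have sing': "\<exists>u e. singular_chain (Suc p) (space_of L) u \<and> singular_chain p (space_of M) e \<and> w = chain_boundary (Suc p) u + e"
    if "singular_chain p (space_of L) w" "singular_chain (p - 1) (space_of M) (chain_boundary p w)" for p w
    using trivial_homology_relboundary[OF sing, of p w] that
    by (fastforce simp: singular_relcycle singular_relboundary sub)
  show ?thesis
    unfolding acyclic_pair_def
  proof (intro allI ballI impI)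
    fix q x assume x: "x \<in> cone_chains L q" "cone_boundary q x \<in> cone_chains M (q - 1)"
    obtain c w where cw: "x = (c, w)" by (cases x)
    show "\<exists>y\<in>cone_chains L (Suc q). x - cone_boundary (Suc q) y \<in> cone_chains M q"
    proof (cases q)
      case 0
      then obtain u e where u: "singular_chain (Suc 0) (space_of L) u" "singular_chain 0 (space_of M) e"
        "w = chain_boundary (Suc 0) u + e"
        using sing'[of 0 w] x cw by (auto simp: cone_chains_0 chain_boundary_def)
      then show ?thesis
        using x cw 0
        by (intro bexI[of _ "(0, u)"]) (auto simp: cone_chains_0 cone_chains_Suc cone_boundary_Suc realize_linear
            simplicial_boundary_linear simp_chains_closed)
    next
      case (Suc p)
      have c: "c \<in> simp_chains L p" and w: "singular_chain (Suc p) (space_of L) w"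
        using x cw Suc by (auto simp: cone_chains_Suc)
      have bc: "simplicial_boundary r p c \<in> simp_chains M (p - 1)"
        and bw: "singular_chain p (space_of M) (realize r c + chain_boundary (Suc p) w)"
        using x(2) cw Suc simp_chains_closed(4)[of "- simplicial_boundary r p c"] simp_chains_closed(1)
        by (cases p; auto simp: cone_chains_0 cone_chains_Suc cone_boundary_Suc simplicial_boundary_0)+
      obtain d where d: "d \<in> simp_chains L (Suc p)" "c - simplicial_boundary r (Suc p) d \<in> simp_chains M p"
        using sim[OF c bc] by blast
      have dK: "d \<in> simp_chains K (Suc p)"
        using simp_chains_mono[OF L(2)] d(1) by auto
      have "singular_chain (Suc p) (space_of L) (w + realize r d)"
        by (rule singular_chain_add[OF w singular_chain_realize[OF L d(1)]])
      moreover have "chain_boundary (Suc p) (w + realize r d) =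
        (realize r c + chain_boundary (Suc p) w) - realize r (c - simplicial_boundary r (Suc p) d)"
        using chain_boundary_realize[OF order dK] by (simp add: chain_boundary_add realize_linear)
      moreover have "singular_chain p (space_of M) (\<dots>)"
        using M L by (intro singular_chain_diff[OF bw] singular_chain_realize d) auto
      ultimately obtain u e where u: "singular_chain (Suc (Suc p)) (space_of L) u"
        "singular_chain (Suc p) (space_of M) e" "w + realize r d = chain_boundary (Suc (Suc p)) u + e"
        using sing'[of "Suc p" "w + realize r d"] by auto
      have "w + realize r d - chain_boundary (Suc (Suc p)) u = e"
        using u(3) by simp
      then show ?thesis
        using d u(1,2) cw Suc
        by (intro bexI[of _ "(- d, u)"]) (auto simp: cone_chains_Suc cone_boundary_Suc realize_linear
            simplicial_boundary_linear simp_chains_closed algebra_simps)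
    qed
  qed
qed

section \<open>The cone of a single simplex\<close>

definition vertex_point :: "'v \<Rightarrow> 'v \<Rightarrow> real" where
  "vertex_point v = (\<lambda>w. if w = v then 1 else 0)"

lemma superlevel_vertex: "{v} \<in> K \<Longrightarrow> superlevel K 0 {{v}} = {vertex_point v}"
proof -
  assume v: "{v} \<in> K"
  have vK: "v \<in> vertices K" using v by (auto simp: vertices_def)
  have "faces {v} = {{v}}" by (auto simp: faces_def)
  then have eq: "superlevel K 0 {{v}} = {x\<in>P. \<forall>w. w \<notin> {v} \<longrightarrow> x w = 0}"
    using superlevel_faces[OF v] by simp
  have "x = vertex_point v" if x: "x \<in> P" "\<forall>w. w \<notin> {v} \<longrightarrow> x w = 0" for x
  proof -
    have "(\<Sum>w\<in>vertices K. x w) = (\<Sum>w\<in>{v}. x w)"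
      using x(2) vK finite_vertices by (intro sum.mono_neutral_right) auto
    then have "x v = 1" using pointD(3)[OF x(1)] by simp
    then show ?thesis using x(2) by (auto simp: vertex_point_def)
  qed
  moreover have "vertex_point v \<in> P"
  proof -
    have "{w \<in> vertices K. 0 < vertex_point v w} = {v}"
      using vK by (auto simp: vertex_point_def)
    then show ?thesis
      using v vK finite_vertices by (auto simp: topspace_polytope_space vertex_point_def)
  qed
  moreover have "\<forall>w. w \<notin> {v} \<longrightarrow> vertex_point v w = 0"
    by (simp add: vertex_point_def)
  ultimately show ?thesis
    unfolding eq by blast
qed

text \<open>A closed simplex is convex and contracts to its vertex \<open>v\<close> along straight
  lines.\<close>

lemma trivial_homology_faces_vertex:
  assumes \<sigma>: "\<sigma> \<in> K" and v: "v \<in> \<sigma>"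
  shows "trivial_group (relative_homology_group p (space_of (faces \<sigma>)) (superlevel K 0 {{v}}))"
proof -
  let ?A = "superlevel K 0 (faces \<sigma>)" and ?e = "vertex_point v"
  have vK: "{v} \<in> K"
    by (rule down_closedD[OF down_closed_complex \<sigma>]) (use v in auto)
  have e: "superlevel K 0 {{v}} = {?e}"
    by (rule superlevel_vertex[OF vK])
  have eA: "?e \<in> ?A"
    using superlevel_mono[of "{{v}}" "faces \<sigma>" 0] v e by (auto simp: faces_def)
  have top: "topspace (space_of (faces \<sigma>)) = ?A"
    using superlevel_subset by auto
  have h: "homotopic_with (\<lambda>k. True) (space_of (faces \<sigma>)) (space_of (faces \<sigma>)) (\<lambda>x. ?e) id"
    unfolding homotopic_with_def
  proof (intro exI[where x="\<lambda>z v. (1 - fst z) * ?e v + fst z * snd z v"] conjI allI ballI)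
    have "continuous_on ({0..1::real} \<times> ?A) (\<lambda>z v. (1 - fst z) * ?e v + fst z * snd z v)"
    proof (rule continuous_on_coordinatewise_then_product)
      fix w
      have "continuous_on ({0..1::real} \<times> ?A) (\<lambda>z. snd z w)"
        by (rule continuous_on_compose2[OF continuous_on_coordinate continuous_on_snd]) (auto intro: continuous_on_id)
      then show "continuous_on ({0..1::real} \<times> ?A) (\<lambda>z. (1 - fst z) * ?e w + fst z * snd z w)"
        by (intro continuous_intros)
    qed
    then show "continuous_map (prod_topology (top_of_set {0..1}) (space_of (faces \<sigma>))) (space_of (faces \<sigma>))
        (\<lambda>z v. (1 - fst z) * ?e v + fst z * snd z v)"
      using convex_faces[OF \<sigma> eA]
      by (auto simp: subtopology_polytope_space[OF superlevel_subset] prod_topology_subtopology_eu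
          continuous_map_in_subtopology image_subset_iff_funcset[symmetric])
  qed auto
  show ?thesis
  proof (rule trivial_relative_homology_group_gen)
    show "continuous_map (space_of (faces \<sigma>)) (subtopology (space_of (faces \<sigma>)) (superlevel K 0 {{v}})) (\<lambda>x. ?e)"
      using e eA superlevel_subset by (auto simp: continuous_map_in_subtopology)
    show "homotopic_with (\<lambda>h. True) (subtopology (space_of (faces \<sigma>)) (superlevel K 0 {{v}}))
        (subtopology (space_of (faces \<sigma>)) (superlevel K 0 {{v}})) (\<lambda>x. ?e) id"
      using e eA superlevel_subset
      by (intro homotopic_with_equal) (auto simp: continuous_map_in_subtopology)
  qed (rule h)
qed

text \<open>
  Coning off with the least vertex \<open>v\<close> introduces no signs: \<open>v\<close> has position \<open>0\<close>, and it shifts all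
  other positions by one.
\<close>

lemma simplicial_acyclic_faces_vertex:
  assumes \<sigma>: "\<sigma> \<in> K" and v: "v \<in> \<sigma>" and min: "\<And>w. w \<in> \<sigma> \<Longrightarrow> (v, w) \<in> r"
    and c: "c \<in> simp_chains (faces \<sigma>) p" and bc: "simplicial_boundary r p c \<in> simp_chains {{v}} (p - 1)"
  shows "\<exists>d\<in>simp_chains (faces \<sigma>) (Suc p). c - simplicial_boundary r (Suc p) d \<in> simp_chains {{v}} p"
proof -
  \<comment> \<open>The cone operator with apex \<open>v\<close>; simplices that already contain
    \<open>v\<close> are sent to zero.\<close>
  let ?h = "frag_extend (\<lambda>\<tau>. if v \<in> \<tau> then 0 else frag_of (insert v \<tau>))"
  have antisym: "antisym r"
    using order by (auto simp: linear_order_on_def partial_order_on_def)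
  have fin: "finite \<sigma>" and sub: "\<sigma> \<subseteq> vertices K"
    using \<sigma> simplexD simplex_vertices by auto
  have key: "Poly_Mapping.keys c \<subseteq> {\<tau>\<in>faces \<sigma>. card \<tau> = Suc p}"
    using c by (simp add: simp_chains_def)
  have hin: "?h c \<in> simp_chains (faces \<sigma>) (Suc p)"
    using key
  proof (induction c rule: frag_induction)
    case (one \<tau>)
    then have "finite \<tau>"
      using fin finite_subset by (auto simp: faces_def)
    then show ?case
      using one v by (auto simp: simp_chains_def faces_def)
  qed (simp_all add: simp_chains_closed frag_extend_diff)
  \<comment> \<open>The homotopy formula for coning. It is exact in positive degrees, while in
    degree \<open>0\<close> a multiple of the vertex \<open>v\<close> is left over; hence the
    statement modulo \<open>{{v}}\<close>.\<close>
  have hom: "?h (simplicial_boundary r p c) + simplicial_boundary r (Suc p) (?h c) - c \<in> simp_chains {{v}} p"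
    using key
  proof (induction c rule: frag_induction)
    case zero
    then show ?case by (simp add: simp_chains_closed simplicial_boundary_linear)
  next
    case (diff a b)
    have "?h (simplicial_boundary r p (a - b)) + simplicial_boundary r (Suc p) (?h (a - b)) - (a - b) =
      (?h (simplicial_boundary r p a) + simplicial_boundary r (Suc p) (?h a) - a) -
      (?h (simplicial_boundary r p b) + simplicial_boundary r (Suc p) (?h b) - b)"
      by (simp add: frag_extend_diff simplicial_boundary_linear)
    then show ?case
      using simp_chains_closed(2)[OF diff] by (simp only:)
  next
    case (one \<tau>)
    then have \<tau>: "\<tau> \<subseteq> \<sigma>" "\<tau> \<noteq> {}" "card \<tau> = Suc p" "finite \<tau>"
      using fin finite_subset by (auto simp: faces_def)
    have pos0: "position r \<rho> v = 0" if "\<rho> \<subseteq> \<sigma>" for \<rho>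
    proof -
      have "{w \<in> \<rho>. w \<noteq> v \<and> (w, v) \<in> r} = {}"
        using min that antisym by (auto dest: antisymD)
      then show ?thesis unfolding position_def by (simp only: card.empty)
    qed
    show ?case
    proof (cases "v \<in> \<tau>")
      case True
      show ?thesis
      proof (cases p)
        case 0
        then have "\<tau> = {v}"
          using \<tau> True by (metis card_1_singletonE One_nat_def singletonD)
        then show ?thesis
          using 0 by (simp add: simplicial_boundary_def simp_chains_def)
      next
        case (Suc n)
        have "?h (simplicial_boundary r p (frag_of \<tau>)) =
          (\<Sum>u\<in>\<tau>. frag_cmul ((-1) ^ position r \<tau> u) (?h (frag_of (\<tau> - {u}))))"
          unfolding Suc simplicial_boundary_of by (simp add: frag_extend_sum[OF \<tau>(4)] frag_extend_cmul)
        also have "\<dots> = (\<Sum>u\<in>{v}. frag_cmul ((-1) ^ position r \<tau> u) (?h (frag_of (\<tau> - {u}))))"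
          using True \<tau>(4) by (intro sum.mono_neutral_right) auto
        also have "\<dots> = frag_of \<tau>"
          using pos0[OF \<tau>(1)] True by (simp add: insert_absorb)
        finally show ?thesis
          using True by (simp add: simplicial_boundary_linear simp_chains_closed)
      qed
    next
      case False
      let ?\<rho> = "insert v \<tau>"
      have \<rho>: "?\<rho> \<subseteq> \<sigma>" "finite ?\<rho>" using \<tau> v by auto
      have pos: "position r ?\<rho> u = Suc (position r \<tau> u)" if "u \<in> \<tau>" for u
      proof -
        have "{w \<in> ?\<rho>. w \<noteq> u \<and> (w, u) \<in> r} = insert v {w \<in> \<tau>. w \<noteq> u \<and> (w, u) \<in> r}"
          using that False min \<tau>(1) by auto
        then show ?thesis
          unfolding position_def using False \<tau>(4) by simp
      qed
      have "simplicial_boundary r (Suc p) (?h (frag_of \<tau>)) =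
          frag_of \<tau> + (\<Sum>u\<in>\<tau>. frag_cmul ((-1) ^ position r ?\<rho> u) (frag_of (?\<rho> - {u})))"
        using False \<tau>(4) pos0[OF \<rho>(1)] by (simp add: simplicial_boundary_of)
      also have "(\<Sum>u\<in>\<tau>. frag_cmul ((-1) ^ position r ?\<rho> u) (frag_of (?\<rho> - {u}))) =
          (\<Sum>u\<in>\<tau>. - frag_cmul ((-1) ^ position r \<tau> u) (frag_of (insert v (\<tau> - {u}))))"
        using False by (intro sum.cong refl) (auto simp: pos insert_Diff_if)
      finally have 1: "simplicial_boundary r (Suc p) (?h (frag_of \<tau>)) =
          frag_of \<tau> - (\<Sum>u\<in>\<tau>. frag_cmul ((-1) ^ position r \<tau> u) (frag_of (insert v (\<tau> - {u}))))"
        by (simp only: sum_negf add_uminus_conv_diff)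
      show ?thesis
      proof (cases p)
        case 0
        then obtain u where "\<tau> = {u}"
          using \<tau>(3) by (metis card_1_singletonE One_nat_def)
        moreover have "frag_of {v} \<in> simp_chains {{v}} 0"
          by (simp add: simp_chains_def)
        ultimately show ?thesis
          using 1 0 by (simp add: simplicial_boundary_0 simp_chains_closed(5))
      next
        case (Suc n)
        have "?h (simplicial_boundary r p (frag_of \<tau>)) =
          (\<Sum>u\<in>\<tau>. frag_cmul ((-1) ^ position r \<tau> u) (frag_of (insert v (\<tau> - {u}))))"
          unfolding Suc simplicial_boundary_of using False
          by (simp add: frag_extend_sum[OF \<tau>(4)] frag_extend_cmul)
        then show ?thesis
          using 1 by (simp add: simp_chains_closed)
      qed
    qed
  qed
  \<comment> \<open>By hypothesis only the simplex \<open>{v}\<close> can occur in the boundary of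
    \<open>c\<close>, and the cone operator kills it.\<close>
  have "?h (simplicial_boundary r p c) = 0"
    using bc by (intro frag_extend_eq_0) (auto simp: simp_chains_def)
  then have "c - simplicial_boundary r (Suc p) (?h c) \<in> simp_chains {{v}} p"
    using simp_chains_closed(4)[OF hom] by simp
  then show ?thesis
    using hin by blast
qed

lemma down_closed_vertex: "down_closed {{v}}"
  by (auto simp: down_closed_def)

lemma acyclic_faces_vertex:
  assumes \<sigma>: "\<sigma> \<in> K" and v: "v \<in> \<sigma>" and min: "\<And>w. w \<in> \<sigma> \<Longrightarrow> (v, w) \<in> r"
  shows "acyclic_pair cone_boundary (cone_chains (faces \<sigma>)) (cone_chains {{v}})"
  using simplicial_acyclic_faces_vertex[OF assms] trivial_homology_faces_vertex[OF \<sigma> v] v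
  by (intro acyclic_cone_from_both down_closed_faces faces_subset[OF \<sigma>] down_closed_vertex) (auto simp: faces_def)

lemma singular_chain_point:
  assumes v: "{v} \<in> K" and w: "singular_chain p (space_of {{v}}) w"
  obtains n where "w = frag_cmul n (frag_of (restrict (\<lambda>t. vertex_point v) (standard_simplex p)))"
proof -
  let ?s = "restrict (\<lambda>t. vertex_point v) (standard_simplex p)"
  have "Poly_Mapping.keys w \<subseteq> {?s}"
  proof
    fix f assume "f \<in> Poly_Mapping.keys w"
    then have f: "singular_simplex p (space_of {{v}}) f"
      using w by (auto simp: singular_chain_def)
    then have "f t = vertex_point v" if "t \<in> standard_simplex p" for t
      using that superlevel_vertex[OF v] by (auto simp: singular_simplex_def continuous_map_def Pi_iff)
    moreover have "f \<in> extensional (standard_simplex p)"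
      using f by (simp add: singular_simplex_def)
    ultimately show "f \<in> {?s}"
      by (auto simp: fun_eq_iff extensional_def)
  qed
  then have "w = frag_extend (\<lambda>_. frag_of ?s) w"
    by (subst (1) frag_expansion) (auto intro: frag_extend_eq)
  also have "\<dots> = frag_cmul (Poly_Mapping.lookup w ?s) (frag_of ?s)"
    using \<open>Poly_Mapping.keys w \<subseteq> {?s}\<close> by (cases "w = 0") (auto simp: frag_extend_def subset_singleton_iff)
  finally show thesis
    using that by blast
qed

text \<open>In cone degree \<open>0\<close> every singular chain at the point is the realization of
  a multiple of the vertex. In degree \<open>1\<close> the two faces of the constant simplex cancel,
  so the cycle condition gives \<open>realize r c = 0\<close> and \<open>c\<close> vanishes by
  injectivity; in higher degrees \<open>c\<close> vanishes because there are no simplices. What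
  remains is a singular cycle of positive dimension, which bounds by the dimension axiom.\<close>

lemma acyclic_vertex:
  assumes v: "{v} \<in> K"
  shows "acyclic_pair cone_boundary (cone_chains {{v}}) (cone_chains {})"
  unfolding acyclic_pair_def cone_chains_empty
proof (intro allI ballI impI)
  fix q x assume x: "x \<in> cone_chains {{v}} q" "cone_boundary q x = 0"
  obtain c w where cw: "x = (c, w)" by (cases x)
  have vK: "v \<in> vertices K" using v by (auto simp: vertices_def)
  let ?s = "\<lambda>p. restrict (\<lambda>t. vertex_point v) (standard_simplex p)"
  have s0: "simplex_param r {v} = ?s 0"
  proof -
    have "position r {v} v = 0"
      unfolding position_def by (simp add: card_eq_0_iff)
    then show ?thesis
      by (auto simp: simplex_param_def vertex_point_def standard_simplex_0 restrict_def fun_eq_iff)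
  qed
  have bd: "\<exists>u. singular_chain (Suc p) (space_of {{v}}) u \<and> chain_boundary (Suc p) u = w"
    if "singular_chain p (space_of {{v}}) w" "chain_boundary p w = 0" "p \<noteq> 0" for p w
  proof -
    have "topspace (space_of {{v}}) = {vertex_point v}"
      using superlevel_vertex[OF v] superlevel_subset[of 0 "{{v}}"] by auto
    then have "trivial_group (homology_group (int p) (space_of {{v}}))"
      using \<open>p \<noteq> 0\<close> by (intro homology_dimension_axiom) auto
    then have "singular_relboundary p (space_of {{v}}) {} w"
      using that by (intro trivial_homology_relboundary) (auto simp: singular_cycle)
    then show ?thesis
      by (simp add: singular_boundary)
  qed
  show "\<exists>y\<in>cone_chains {{v}} (Suc q). x - cone_boundary (Suc q) y = 0"
  proof (cases q)
    case 0
    then obtain n where "w = frag_cmul n (frag_of (?s 0))"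
      using singular_chain_point[OF v, of 0 w] x cw by (auto simp: cone_chains_0)
    then show ?thesis
      using x cw 0 s0
      by (intro bexI[of _ "(frag_cmul n (frag_of {v}), 0)"])
        (auto simp: cone_chains_0 cone_chains_Suc cone_boundary_Suc simplicial_boundary_0 realize_linear
          zero_prod_def simp_chains_def)
  next
    case (Suc p)
    have w: "singular_chain (Suc p) (space_of {{v}}) w" and c: "c \<in> simp_chains {{v}} p"
      and b: "realize r c + chain_boundary (Suc p) w = 0"
      using x cw Suc by (auto simp: cone_chains_Suc cone_boundary_Suc zero_prod_def)
    have "c = 0"
    proof (cases p)
      case 0
      have "Poly_Mapping.keys c \<subseteq> {{v}}"
        using c by (auto simp: simp_chains_def)
      then have ceq: "c = frag_cmul (Poly_Mapping.lookup c {v}) (frag_of {v})"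
        by (subst (1) frag_expansion, cases "c = 0") (auto simp: frag_extend_def subset_singleton_iff)
      obtain n where n: "w = frag_cmul n (frag_of (?s 1))"
        using singular_chain_point[OF v w] 0 by auto
      have "singular_face 1 k (?s 1) = ?s 0" if "k \<le> 1" for k
        using simplical_face_in_standard_simplex[of 1 k] that
        by (auto simp: singular_face_def fun_eq_iff restrict_def)
      then have "chain_boundary 1 (frag_of (?s 1)) = 0"
        by (simp add: chain_boundary_of)
      then have "chain_boundary (Suc p) w = 0"
        using n 0 by (simp add: chain_boundary_cmul)
      then have "realize r c = 0"
        using b by simp
      then show ?thesis
        using c v by (intro realize_eq_0[of c p]) (auto simp: simp_chains_def)
    next
      case (Suc n)
      then have "Poly_Mapping.keys c = {}"
        using c by (fastforce simp: simp_chains_def)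
      then show ?thesis by simp
    qed
    moreover from this obtain u where "singular_chain (Suc (Suc p)) (space_of {{v}}) u"
      "chain_boundary (Suc (Suc p)) u = w"
      using bd[of "Suc p" w] w b by (auto simp: realize_linear)
    ultimately show ?thesis
      using cw Suc
      by (intro bexI[of _ "(0, u)"])
        (auto simp: cone_chains_Suc cone_boundary_Suc simplicial_boundary_linear realize_linear zero_prod_def simp_chains_closed)
  qed
qed

text \<open>The least vertex, found as the one of position \<open>0\<close>, serves as an
  intermediate subcomplex: coning reduces the simplex to it, and the single vertex is acyclic in the
  cone sense.\<close>

lemma acyclic_faces:
  assumes \<sigma>: "\<sigma> \<in> K"
  shows "acyclic_pair cone_boundary (cone_chains (faces \<sigma>)) (cone_chains {})"
proof -
  have fin: "finite \<sigma>" "\<sigma> \<noteq> {}" "\<sigma> \<subseteq> vertices K"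
    using \<sigma> simplexD simplex_vertices by auto
  have bij: "bij_betw (position r \<sigma>) \<sigma> {..<card \<sigma>}"
    by (rule bij_betw_position[OF order fin(3,1)])
  have "0 \<in> {..<card \<sigma>}"
    using fin by (simp add: card_gt_0_iff)
  then have "0 \<in> position r \<sigma> ` \<sigma>"
    using bij_betw_imp_surj_on[OF bij] by simp
  then obtain v where v: "v \<in> \<sigma>" "position r \<sigma> v = 0"
    by force
  have min: "(v, w) \<in> r" if "w \<in> \<sigma>" for w
  proof (cases "w = v")
    case True
    have "refl_on (vertices K) r"
      using order by (simp add: linear_order_on_def partial_order_on_def preorder_on_def)
    then show ?thesis
      using True v(1) fin(3) by (simp add: refl_onD subsetD)
  next
    case False
    have "position r \<sigma> w \<noteq> 0"
      using inj_onD[OF bij_betw_imp_inj_on[OF bij], of w v] v False that by auto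
    then show ?thesis
      using position_less_iff[OF order fin(3,1) v(1) that] v(2) by auto
  qed
  have vK: "{v} \<in> K"
    by (rule down_closedD[OF down_closed_complex \<sigma>]) (use v in auto)
  show ?thesis
  proof (rule acyclic_pair_trans)
    show "acyclic_pair cone_boundary (cone_chains (faces \<sigma>)) (cone_chains {{v}})"
      by (rule acyclic_faces_vertex[OF \<sigma> v(1) min])
    show "acyclic_pair cone_boundary (cone_chains {{v}}) (cone_chains {})"
      by (rule acyclic_vertex[OF vK])
    show "dg_subgroup cone_boundary (cone_chains (faces \<sigma>))"
      by (rule dg_subgroup_cone[OF down_closed_faces faces_subset[OF \<sigma>]])
    show "dg_subgroup cone_boundary (cone_chains {{v}})"
      by (rule dg_subgroup_cone[OF down_closed_vertex]) (use vK in auto)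
    show "dg_subgroup cone_boundary (cone_chains {})"
      by (rule dg_subgroup_cone) (auto simp: down_closed_def)
    show "cone_chains {{v}} q \<subseteq> cone_chains (faces \<sigma>) q" for q
      by (rule cone_chains_mono) (use v in \<open>auto simp: faces_def\<close>)
    show "cone_chains {} q \<subseteq> cone_chains {{v}} q" for q
      by (rule cone_chains_mono) auto
  qed
qed

end

section \<open>Excision for the cone and induction over subcomplexes\<close>

lemma singular_relcycle_nested:
  "B \<subseteq> A \<Longrightarrow> singular_relcycle p (subtopology Y A) B c \<longleftrightarrow>
     singular_chain p (subtopology Y A) c \<and> singular_chain (p - 1) (subtopology Y B) (chain_boundary p c)"
  by (simp add: singular_relcycle subtopology_subtopology Int_absorb1)

lemma singular_relboundary_nested:
  "B \<subseteq> A \<Longrightarrow> singular_relboundary p (subtopology Y A) B c \<longleftrightarrow>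
     (\<exists>d e. singular_chain (Suc p) (subtopology Y A) d \<and> singular_chain p (subtopology Y B) e \<and>
        chain_boundary (Suc p) d + e = c)"
  by (simp add: singular_relboundary subtopology_subtopology Int_absorb1)

text \<open>Surjectivity and injectivity on homology unpacked into chains. The cone argument works
  with chains throughout, so this is the form in which it uses excision.\<close>

lemma inclusion_iso_chains:
  assumes iso: "hom_induced (int p) (subtopology Y A) B (subtopology Y A') B' id
      \<in> iso (relative_homology_group (int p) (subtopology Y A) B) (relative_homology_group (int p) (subtopology Y A') B')"
    and AB: "A \<subseteq> A'" "B \<subseteq> B'"
  shows "singular_relcycle p (subtopology Y A') B' z \<Longrightarrow>
      \<exists>z0. singular_relcycle p (subtopology Y A) B z0 \<and> singular_relboundary p (subtopology Y A') B' (z - z0)"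
    and "singular_relcycle p (subtopology Y A) B z \<Longrightarrow> singular_relboundary p (subtopology Y A') B' z \<Longrightarrow>
      singular_relboundary p (subtopology Y A) B z"
proof -
  let ?G = "relative_homology_group (int p) (subtopology Y A) B"
  let ?H = "relative_homology_group (int p) (subtopology Y A') B'"
  let ?i = "hom_induced (int p) (subtopology Y A) B (subtopology Y A') B' id"
  have cont: "continuous_map (subtopology Y A) (subtopology Y A') id"
    using AB(1) by (simp add: continuous_map_in_subtopology continuous_map_from_subtopology Pi_def) auto
  have i: "?i (homologous_rel_set p (subtopology Y A) B c) = homologous_rel_set p (subtopology Y A') B' c"
    if "singular_relcycle p (subtopology Y A) B c" for c
  proof -
    have "chain_map p id c = c"
      using that chain_map_ident[of p "subtopology Y A" c] unfolding singular_relcycle_def by blast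
    then show ?thesis
      using hom_induced_chain_map[OF cont _ that, of B'] AB(2) by (simp add: Pi_def subset_iff)
  qed
  have bij: "bij_betw ?i (carrier ?G) (carrier ?H)"
    using iso by (simp add: iso_def)
  show "\<exists>z0. singular_relcycle p (subtopology Y A) B z0 \<and> singular_relboundary p (subtopology Y A') B' (z - z0)"
    if z: "singular_relcycle p (subtopology Y A') B' z"
  proof -
    have "homologous_rel_set p (subtopology Y A') B' z \<in> ?i ` carrier ?G"
      using bij_betw_imp_surj_on[OF bij] z by (auto simp: carrier_relative_homology_group)
    then obtain z0 where z0: "singular_relcycle p (subtopology Y A) B z0"
      "homologous_rel_set p (subtopology Y A') B' z = homologous_rel_set p (subtopology Y A') B' z0"
      using i by (auto simp: carrier_relative_homology_group)
    then have "homologous_rel p (subtopology Y A') B' z z0"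
      by (simp only: homologous_rel_set_eq)
    then show ?thesis
      using z0(1) by (auto simp: homologous_rel_def)
  qed
  show "singular_relboundary p (subtopology Y A) B z"
    if z: "singular_relcycle p (subtopology Y A) B z" "singular_relboundary p (subtopology Y A') B' z"
  proof -
    have "homologous_rel p (subtopology Y A') B' z 0"
      using z(2) by (simp add: homologous_rel_def)
    then have "?i (homologous_rel_set p (subtopology Y A) B z) = ?i (homologous_rel_set p (subtopology Y A) B 0)"
      using i[OF z(1)] i[OF singular_relcycle_0] homologous_rel_set_eq by metis
    moreover have "homologous_rel_set p (subtopology Y A) B z \<in> carrier ?G"
      "homologous_rel_set p (subtopology Y A) B 0 \<in> carrier ?G"
      using z(1) by (auto simp: carrier_relative_homology_group)
    ultimately have "homologous_rel_set p (subtopology Y A) B z = homologous_rel_set p (subtopology Y A) B 0"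
      using bij_betw_imp_inj_on[OF bij] by (metis inj_onD)
    then have "homologous_rel p (subtopology Y A) B z 0"
      by (simp only: homologous_rel_set_eq)
    then show ?thesis
      by (simp add: homologous_rel_def)
  qed
qed

lemma down_closed_Un_Int:
  assumes "down_closed A" "down_closed B"
  shows "down_closed (A \<union> B)" and "down_closed (A \<inter> B)"
proof -
  have "\<tau> \<in> A \<union> B" if "\<sigma> \<in> A \<union> B" "\<tau> \<noteq> {}" "\<tau> \<subseteq> \<sigma>" for \<sigma> \<tau>
    using down_closedD[OF assms(1), of \<sigma> \<tau>] down_closedD[OF assms(2), of \<sigma> \<tau>] that by blast
  moreover have "\<tau> \<in> A \<inter> B" if "\<sigma> \<in> A \<inter> B" "\<tau> \<noteq> {}" "\<tau> \<subseteq> \<sigma>" for \<sigma> \<tau>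
    using down_closedD[OF assms(1), of \<sigma> \<tau>] down_closedD[OF assms(2), of \<sigma> \<tau>] that by blast
  ultimately show "down_closed (A \<union> B)" "down_closed (A \<inter> B)"
    unfolding down_closed_def by blast+
qed

context ordered_polyhedron
begin

text \<open>A simplicial chain of \<open>L\<close> splits as \<open>c0 + c1\<close> along
  \<open>A\<close> and \<open>M\<close>. A singular chain need not split, and the excision
  isomorphism makes up for this: injectivity yields \<open>w0\<close> in \<open>A\<close> bounding
  \<open>realize r c0\<close> modulo the intersection, and surjectivity yields a relative cycle
  \<open>z\<close> in \<open>A\<close> homologous to \<open>w + w0\<close>. Then
  \<open>(c0, z - w0)\<close> is a cone cycle of \<open>A\<close> modulo \<open>A \<inter> M\<close>
  that differs from the given one by a boundary and a chain of \<open>M\<close>.\<close>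

lemma acyclic_excision:
  assumes A: "down_closed A" "A \<subseteq> K" and M: "down_closed M" "M \<subseteq> K" and L: "L = A \<union> M"
    and acyc: "acyclic_pair cone_boundary (cone_chains A) (cone_chains (A \<inter> M))"
  shows "acyclic_pair cone_boundary (cone_chains L) (cone_chains M)"
proof -
  have Ld: "down_closed L" "L \<subseteq> K"
    using A M down_closed_Un_Int(1) by (auto simp: L)
  have AMd: "down_closed (A \<inter> M)"
    by (rule down_closed_Un_Int(2)[OF A(1) M(1)])
  let ?A = "superlevel K 0 A" and ?M = "superlevel K 0 M" and ?L = "superlevel K 0 L" and ?N = "superlevel K 0 (A \<inter> M)"
  have N: "?A \<inter> ?M = ?N" and cov: "?L = ?A \<union> ?M"
    by (auto simp: superlevel_def L)
  have sub: "?A \<subseteq> ?L" "?N \<subseteq> ?M" "?N \<subseteq> ?A" "?M \<subseteq> ?L"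
    using N cov by auto
  obtain b where b: "b > 0" "admissible_level K b"
    using admissible_level_exists .
  have iso: "hom_induced (int p) (space_of A) ?N (space_of L) ?M id
    \<in> iso (relative_homology_group (int p) (space_of A) ?N) (relative_homology_group (int p) (space_of L) ?M)" for p
    unfolding N[symmetric]
    using A(1) b L by (intro excision_closed[OF _ b(1,2) Ld(1) M(1) _ cov] squeeze_homotopy_superlevel) auto
  note surj = inclusion_iso_chains(1)[OF iso sub(1,2)] and inj = inclusion_iso_chains(2)[OF iso sub(1,2)]
  note simps = singular_relcycle_nested[OF sub(3)] singular_relcycle_nested[OF sub(4)]
    singular_relboundary_nested[OF sub(3)] singular_relboundary_nested[OF sub(4)]
  have mono: "singular_chain p (space_of N') c \<Longrightarrow> singular_chain p (space_of N'') c" if "N' \<subseteq> N''" for p c N' N''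
    using singular_chain_mono[OF _ superlevel_mono[OF that]] .
  have AL: "A \<subseteq> L" and MA: "A \<inter> M \<subseteq> M" and MLs: "M \<subseteq> L"
    using L by auto
  show ?thesis
    unfolding acyclic_pair_def
  proof (intro allI ballI impI)
    fix q x assume x: "x \<in> cone_chains L q" "cone_boundary q x \<in> cone_chains M (q - 1)"
    obtain c w where cw: "x = (c, w)" by (cases x)
    show "\<exists>y\<in>cone_chains L (Suc q). x - cone_boundary (Suc q) y \<in> cone_chains M q"
    proof (cases q)
      case 0
      have "singular_relcycle 0 (space_of L) ?M w"
        using x cw 0 by (simp add: simps cone_chains_0 chain_boundary_def)
      then obtain z u m where z: "singular_chain 0 (space_of A) z" "singular_chain (Suc 0) (space_of L) u"
        "singular_chain 0 (space_of M) m" "chain_boundary (Suc 0) u + m = w - z"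
        using surj[of 0 w] by (auto simp: simps)
      have "(0, z) \<in> cone_chains A 0"
        using z by (simp add: cone_chains_0)
      then obtain y where y: "y \<in> cone_chains A (Suc 0)" "(0, z) - cone_boundary (Suc 0) y \<in> cone_chains (A \<inter> M) 0"
        using acyclic_pairD[OF acyc, of "(0, z)" 0] by (auto simp: cone_chains_0 zero_prod_def)
      have yL: "y \<in> cone_chains L (Suc 0)"
        using y(1) cone_chains_mono[OF AL] by auto
      have uL: "(0, u) \<in> cone_chains L (Suc 0)"
        using z by (simp add: cone_chains_Suc simp_chains_closed)
      have yu: "y + (0, u) \<in> cone_chains L (Suc 0)"
        "cone_boundary (Suc 0) (y + (0, u)) = cone_boundary (Suc 0) y + cone_boundary (Suc 0) (0, u)"
        using dg_subgroup_add[OF dg_subgroup_cone[OF Ld] yL uL] .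
      have "x - cone_boundary (Suc 0) (y + (0, u)) = ((0, z) - cone_boundary (Suc 0) y) + (0, m)"
        using z(4) x cw 0 unfolding yu(2)
        by (auto simp: cone_chains_0 cone_boundary_Suc realize_linear simplicial_boundary_linear algebra_simps)
      moreover have "\<dots> \<in> cone_chains M 0"
        using y(2) cone_chains_mono[OF MA] z(3)
        by (intro dg_subgroup_add(1)[OF dg_subgroup_cone[OF M]]) (auto simp: cone_chains_0)
      ultimately show ?thesis
        using 0 yu(1) by metis
    next
      case (Suc p)
      have c: "c \<in> simp_chains L p" and w: "singular_chain (Suc p) (space_of L) w"
        using x cw Suc by (auto simp: cone_chains_Suc)
      have bc: "simplicial_boundary r p c \<in> simp_chains M (p - 1)"
        and bw: "singular_chain p (space_of M) (realize r c + chain_boundary (Suc p) w)"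
        using x(2) cw Suc simp_chains_closed(4)[of "- simplicial_boundary r p c"] simp_chains_closed(1)
        by (cases p; auto simp: cone_chains_0 cone_chains_Suc cone_boundary_Suc simplicial_boundary_0)+
      have "Poly_Mapping.keys c \<subseteq> {\<sigma>\<in>A. card \<sigma> = Suc p} \<union> {\<sigma>\<in>M. card \<sigma> = Suc p}"
        using c L by (auto simp: simp_chains_def)
      then obtain c0 c1 where c01: "c0 \<in> simp_chains A p" "c1 \<in> simp_chains M p" "c0 + c1 = c"
        by (rule frag_split) (auto simp: simp_chains_def)
      have bd1: "simplicial_boundary r p c1 \<in> simp_chains M (p - 1)"
        and bd0: "simplicial_boundary r p c0 \<in> simp_chains A (p - 1)"
        using simplicial_boundary_in[OF M(1) c01(2)] simplicial_boundary_in[OF A(1) c01(1)] by auto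
      have "simplicial_boundary r p c0 = simplicial_boundary r p c - simplicial_boundary r p c1"
        using c01(3) by (auto simp: simplicial_boundary_linear)
      then have "simplicial_boundary r p c0 \<in> simp_chains M (p - 1)"
        using simp_chains_closed(2)[OF bc bd1] by simp
      then have bdN: "simplicial_boundary r p c0 \<in> simp_chains (A \<inter> M) (p - 1)"
        using bd0 by (auto simp: simp_chains_def)
      have c0K: "c0 \<in> simp_chains K p"
        using simp_chains_mono[OF A(2)] c01(1) by auto
      have R0: "singular_chain p (space_of A) (realize r c0)" and R1: "singular_chain p (space_of M) (realize r c1)"
        using singular_chain_realize A M c01 by auto
      have "singular_relcycle p (space_of A) ?N (realize r c0)"
        using R0 singular_chain_realize[OF AMd _ bdN] A(2)
        by (auto simp: simps chain_boundary_realize[OF order c0K])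
      \<comment> \<open>The cycle condition on \<open>(c, w)\<close> says that
        \<open>realize r c\<close> bounds \<open>- w\<close> up to a chain of \<open>M\<close>, and
        \<open>realize r c1\<close> is a chain of \<open>M\<close> as well.\<close>
      moreover have "singular_relboundary p (space_of L) ?M (realize r c0)"
        unfolding simps
        using singular_chain_minus w singular_chain_diff[OF bw R1] c01(3)
        by (intro exI[of _ "- w"] exI[of _ "realize r c + chain_boundary (Suc p) w - realize r c1"])
          (auto simp: chain_boundary_minus realize_linear)
      ultimately have "singular_relboundary p (space_of A) ?N (realize r c0)"
        by (rule inj)
      then obtain w0 e where w0: "singular_chain (Suc p) (space_of A) w0" "singular_chain p (space_of (A \<inter> M)) e"
        "chain_boundary (Suc p) w0 + e = realize r c0"
        unfolding simps by blast
      have "singular_relcycle (Suc p) (space_of L) ?M (w + w0)"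
      proof -
        have "chain_boundary (Suc p) w0 = realize r c - realize r c1 - e"
          using w0(3) c01(3) by (auto simp: realize_linear algebra_simps)
        then have "chain_boundary (Suc p) (w + w0) = realize r c + chain_boundary (Suc p) w - realize r c1 - e"
          by (simp add: chain_boundary_add)
        moreover have "singular_chain p (space_of M) (\<dots>)"
          by (intro singular_chain_diff bw R1 mono[OF MA] w0(2))
        ultimately show ?thesis
          using singular_chain_add[OF w mono[OF AL w0(1)]] by (simp add: simps)
      qed
      then obtain z u m where z: "singular_relcycle (Suc p) (space_of A) ?N z"
        "singular_chain (Suc (Suc p)) (space_of L) u"
        "singular_chain (Suc p) (space_of M) m" "chain_boundary (Suc (Suc p)) u + m = w + w0 - z"
        using surj[of "Suc p" "w + w0"] by (auto simp: simps(4))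
      have zc: "singular_chain (Suc p) (space_of A) z" "singular_chain p (space_of (A \<inter> M)) (chain_boundary (Suc p) z)"
        using z(1) by (auto simp: simps)
      let ?x0 = "(c0, z - w0)"
      have x0: "?x0 \<in> cone_chains A (Suc p)"
        using c01 zc w0 by (auto simp: cone_chains_Suc intro: singular_chain_diff)
      have "realize r c0 + chain_boundary (Suc p) (z - w0) = e + chain_boundary (Suc p) z"
        using w0(3) by (auto simp: chain_boundary_diff algebra_simps)
      then have "cone_boundary (Suc p) ?x0 \<in> cone_chains (A \<inter> M) p"
        using simp_chains_closed(4)[OF bdN] singular_chain_add[OF w0(2) zc(2)]
        by (cases p) (auto simp: cone_boundary_Suc cone_chains_0 cone_chains_Suc simplicial_boundary_0)
      then obtain y where y: "y \<in> cone_chains A (Suc (Suc p))" "?x0 - cone_boundary (Suc (Suc p)) y \<in> cone_chains (A \<inter> M) (Suc p)"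
        using acyclic_pairD[OF acyc x0] by auto
      have yL: "y \<in> cone_chains L (Suc (Suc p))"
        using y(1) cone_chains_mono[OF AL] by auto
      have uL: "(0, u) \<in> cone_chains L (Suc (Suc p))"
        using z by (simp add: cone_chains_Suc simp_chains_closed)
      have yu: "y + (0, u) \<in> cone_chains L (Suc (Suc p))"
        "cone_boundary (Suc (Suc p)) (y + (0, u)) = cone_boundary (Suc (Suc p)) y + cone_boundary (Suc (Suc p)) (0, u)"
        using dg_subgroup_add[OF dg_subgroup_cone[OF Ld] yL uL] .
      have "x - cone_boundary (Suc (Suc p)) (y + (0, u)) = (?x0 - cone_boundary (Suc (Suc p)) y) + (c1, m)"
        using z(4) c01(3) cw unfolding yu(2)
        by (cases "cone_boundary (Suc (Suc p)) y")
          (auto simp: cone_boundary_Suc realize_linear simplicial_boundary_linear algebra_simps)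
      moreover have "\<dots> \<in> cone_chains M (Suc p)"
        using y(2) cone_chains_mono[OF MA] z(3) c01(2)
        by (intro dg_subgroup_add(1)[OF dg_subgroup_cone[OF M]]) (auto simp: cone_chains_Suc)
      ultimately show ?thesis
        using Suc yu(1) by metis
    qed
  qed
qed

lemma down_closed_empty: "down_closed {}"
  by (simp add: down_closed_def)

lemma acyclic_absolute:
  assumes "down_closed L" "L \<subseteq> K"
  shows "acyclic_pair cone_boundary (cone_chains L) (cone_chains {})"
proof -
  have "finite L"
    using assms finite_complex finite_subset by blast
  then show ?thesis
    using assms
  proof (induction "card L" arbitrary: L rule: less_induct)
    case less
    show ?case
    proof (cases "L = {}")
      case True
      then show ?thesis
        unfolding acyclic_pair_def
      proof (intro allI ballI impI)
        fix q x assume "x \<in> cone_chains L q"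
        moreover have "cone_boundary (Suc q) 0 = 0"
          by (simp add: cone_boundary_def realize_linear simplicial_boundary_linear zero_prod_def)
        moreover have "0 \<in> cone_chains {} (Suc q)"
          by (simp add: cone_chains_empty)
        ultimately show "\<exists>y\<in>cone_chains L (Suc q). x - cone_boundary (Suc q) y \<in> cone_chains {} q"
          using True by (intro bexI[of _ 0]) simp_all
      qed
    next
      case False
      \<comment> \<open>Maximality ensures that removing the single simplex leaves a
        subcomplex.\<close>
      obtain \<sigma> where \<sigma>: "\<sigma> \<in> L" and max: "\<And>\<tau>. \<tau> \<in> L \<Longrightarrow> \<sigma> \<subseteq> \<tau> \<Longrightarrow> \<tau> = \<sigma>"
        using finite_has_maximal[OF less.prems(1) False] by metis
      let ?M = "L - {\<sigma>}" and ?B = "faces \<sigma> - {\<sigma>}"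
      have M: "down_closed ?M" "?M \<subseteq> K"
        using less.prems max by (auto simp: down_closed_def)
      have fL: "faces \<sigma> \<subseteq> L"
        using \<sigma> less.prems(2) by (auto simp: faces_def down_closed_def)
      have \<sigma>K: "\<sigma> \<in> K" using \<sigma> less.prems by auto
      have \<sigma>f: "\<sigma> \<in> faces \<sigma>"
        using simplexD(1)[OF \<sigma>K] by (simp add: faces_def)
      have B: "down_closed ?B" "?B \<subseteq> K" "?B \<subseteq> ?M"
      proof -
        show "down_closed ?B"
          unfolding down_closed_def faces_def by blast
        show "?B \<subseteq> K"
          using faces_subset[OF \<sigma>K] by blast
        show "?B \<subseteq> ?M"
          using fL by blast
      qed
      have card: "card ?M < card L"
        by (rule card_Diff1_less[OF less.prems(1) \<sigma>])
      then have "card ?B < card L"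
        using card_mono[OF _ B(3)] less.prems(1) by fastforce
      then have aB: "acyclic_pair cone_boundary (cone_chains ?B) (cone_chains {})"
        using less.hyps B less.prems(1) finite_subset[OF B(3)] by blast
      have aM: "acyclic_pair cone_boundary (cone_chains ?M) (cone_chains {})"
        using less.hyps[OF card] M less.prems(1) by blast
      note dg = dg_subgroup_cone[OF down_closed_faces faces_subset[OF \<sigma>K]] dg_subgroup_cone[OF B(1,2)]
        dg_subgroup_cone[OF down_closed_empty empty_subsetI] dg_subgroup_cone[OF less.prems(2,3)] dg_subgroup_cone[OF M]
      \<comment> \<open>The pair of a simplex and its boundary: the simplex is settled by coning,
        and the boundary by induction because it has fewer simplices than \<open>L\<close>. Excision
        transfers the result to \<open>L\<close> and \<open>?M\<close>.\<close>
      have "acyclic_pair cone_boundary (cone_chains (faces \<sigma>)) (cone_chains ?B)"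
        by (rule acyclic_pair_quotient[OF dg(1,2,3) _ _ acyclic_faces[OF \<sigma>K] aB]; rule cone_chains_mono) auto
      moreover have "faces \<sigma> \<inter> ?M = ?B" "L = faces \<sigma> \<union> ?M"
        using fL \<sigma>f by auto
      ultimately have "acyclic_pair cone_boundary (cone_chains L) (cone_chains ?M)"
        using acyclic_excision[OF down_closed_faces faces_subset[OF \<sigma>K] M] by metis
      then show ?thesis
        by (intro acyclic_pair_trans[OF dg(4,5,3) _ _ _ aM] cone_chains_mono) auto
    qed
  qed
qed

lemma acyclic_cone:
  assumes L: "down_closed L" "L \<subseteq> K" and M: "down_closed M" "M \<subseteq> L"
  shows "acyclic_pair cone_boundary (cone_chains L) (cone_chains M)"
proof -
  have MK: "M \<subseteq> K" using L M by auto
  show ?thesis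
    by (rule acyclic_pair_quotient[OF dg_subgroup_cone[OF L] dg_subgroup_cone[OF M(1) MK]
          dg_subgroup_cone[OF down_closed_empty empty_subsetI] cone_chains_mono[OF M(2)] cone_chains_mono[OF empty_subsetI]
          acyclic_absolute[OF L] acyclic_absolute[OF M(1) MK]])
qed

text \<open>The first isomorphism theorem for the map that sends a simplicial cycle to the class of
  its realization. Acyclicity applied to \<open>(0, z)\<close> shows that the class of
  \<open>z\<close> is attained; applied to \<open>(c, - w)\<close>, where \<open>w\<close> fills
  \<open>realize r c\<close>, it shows that \<open>c\<close> bounds simplicially.\<close>

theorem simplicial_iso_singular:
  assumes L: "down_closed L" "L \<subseteq> K" and M: "down_closed M" "M \<subseteq> L"
  shows "simplicial_homology_group r p L M \<cong> relative_homology_group (int p) (space_of L) (superlevel K 0 M)"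
proof -
  let ?C = "simplicial_chain_group p L" and ?Z = "simplicial_relcycles r p L M" and ?Bd = "simplicial_relboundaries r p L M"
  let ?Y = "space_of L" and ?S = "superlevel K 0 M"
  let ?H = "relative_homology_group (int p) ?Y ?S"
  let ?G = "subgroup_generated ?C ?Z"
  have MK: "M \<subseteq> K" using L M by auto
  note acyc = acyclic_cone[OF assms]
  have nest: "?S \<subseteq> superlevel K 0 L"
    by (rule superlevel_mono[OF M(2)])
  note simps = singular_relcycle_nested[OF nest] singular_relboundary_nested[OF nest]
  have Zeq: "?Z = {c \<in> simp_chains L p. simplicial_boundary r p c \<in> simp_chains M (p - 1)}"
    by (simp add: simplicial_relcycles_def carrier_simplicial_chain_group)
  have Bdeq: "?Bd = {c \<in> simp_chains L p. \<exists>d\<in>simp_chains L (Suc p). simplicial_boundary r (Suc p) d - c \<in> simp_chains M p}"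
    by (simp add: simplicial_relboundaries_def carrier_simplicial_chain_group)
  have grp: "group ?C"
    by (simp add: simplicial_chain_group_def)
  have mult: "(\<otimes>\<^bsub>?C\<^esub>) = (+)"
    by (simp add: fun_eq_iff simplicial_chain_group_def)
  have sg: "subgroup ?Z ?C"
  proof (rule group.subgroupI[OF grp])
    show "?Z \<subseteq> carrier ?C"
      by (auto simp: Zeq carrier_simplicial_chain_group)
    show "?Z \<noteq> {}"
    proof -
      have "0 \<in> ?Z"
        by (simp add: Zeq simplicial_boundary_linear simp_chains_closed)
      then show ?thesis by blast
    qed
    show "inv\<^bsub>?C\<^esub> a \<in> ?Z" if "a \<in> ?Z" for a
    proof -
      have "inv\<^bsub>?C\<^esub> a = - a"
        using that by (auto simp: simplicial_chain_group_def Zeq simp_chains_def)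
      then show ?thesis
        using that by (auto simp: Zeq simplicial_boundary_linear simp_chains_closed)
    qed
    show "a \<otimes>\<^bsub>?C\<^esub> b \<in> ?Z" if "a \<in> ?Z" "b \<in> ?Z" for a b
      using that by (auto simp: mult Zeq simplicial_boundary_linear simp_chains_closed)
  qed
  have carr: "carrier ?G = ?Z"
    by (rule subgroup.carrier_subgroup_generated_subgroup[OF sg])
  have grpG: "group ?G"
    by (rule group.group_subgroup_generated[OF grp])
  have rc: "singular_relcycle p ?Y ?S (realize r c)" if "c \<in> ?Z" for c
  proof -
    have c: "c \<in> simp_chains L p" "simplicial_boundary r p c \<in> simp_chains M (p - 1)" "c \<in> simp_chains K p"
      using that simp_chains_mono[OF L(2)] by (auto simp: Zeq)
    show ?thesis
      using singular_chain_realize[OF L c(1)] singular_chain_realize[OF M(1) MK c(2)]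
      by (simp add: simps chain_boundary_realize[OF order c(3)])
  qed
  let ?h = "\<lambda>c. homologous_rel_set p ?Y ?S (realize r c)"
  have "realize r \<in> hom ?G (relcycle_group p ?Y ?S)"
    using rc by (intro homI) (auto simp: carr mult realize_linear)
  moreover have "homologous_rel_set p ?Y ?S \<in> hom (relcycle_group p ?Y ?S) ?H"
    using normal.r_coset_hom_Mod[OF normal_subgroup_singular_relboundary_relcycle, of p ?Y ?S]
    by (simp add: right_coset_singular_relboundary nontrivial_relative_homology_group)
  ultimately have "homologous_rel_set p ?Y ?S \<circ> realize r \<in> hom ?G ?H"
    by (rule hom_compose)
  then have hom: "?h \<in> hom ?G ?H"
    by (simp add: o_def)
  have surj: "?h ` carrier ?G = carrier ?H"
  proof
    show "?h ` carrier ?G \<subseteq> carrier ?H"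
      using hom by (auto simp: hom_def)
    show "carrier ?H \<subseteq> ?h ` carrier ?G"
    proof
      fix Q assume "Q \<in> carrier ?H"
      then obtain z where z: "singular_relcycle p ?Y ?S z" "Q = homologous_rel_set p ?Y ?S z"
        by (auto simp: carrier_relative_homology_group)
      have "(0, z) \<in> cone_chains L p" "cone_boundary p (0, z) \<in> cone_chains M (p - 1)"
      proof -
        show "(0, z) \<in> cone_chains L p"
          using z(1) by (cases p) (auto simp: simps cone_chains_0 cone_chains_Suc simp_chains_closed)
        show "cone_boundary p (0, z) \<in> cone_chains M (p - 1)"
        proof (cases p)
          case 0
          then show ?thesis by (simp add: zero_prod_def cone_chains_0)
        next
          case (Suc n)
          then show ?thesis
            using z(1) by (cases n) (auto simp: simps cone_boundary_Suc cone_chains_0 cone_chains_Suc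
                simp_chains_closed realize_linear simplicial_boundary_linear)
        qed
      qed
      then obtain y where y: "y \<in> cone_chains L (Suc p)" "(0, z) - cone_boundary (Suc p) y \<in> cone_chains M p"
        by (rule acyclic_pairD[OF acyc])
      obtain c u where cu: "y = (c, u)" by (cases y)
      have cu': "c \<in> simp_chains L p" "singular_chain (Suc p) ?Y u"
        using y(1) by (auto simp: cu cone_chains_Suc)
      have "simplicial_boundary r p c \<in> simp_chains M (p - 1)"
        using y(2) simp_chains_closed(1)
        by (cases p) (auto simp: cu cone_boundary_Suc cone_chains_0 cone_chains_Suc simplicial_boundary_0)
      then have cZ: "c \<in> ?Z"
        using cu' by (simp add: Zeq)
      have e: "singular_chain p (space_of M) (z - (realize r c + chain_boundary (Suc p) u))"
        using y(2) by (cases p) (auto simp: cu cone_boundary_Suc cone_chains_0 cone_chains_Suc)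
      have "singular_relboundary p ?Y ?S (z - realize r c)"
        unfolding simps using cu'(2) e
        by (intro exI[of _ u] exI[of _ "z - (realize r c + chain_boundary (Suc p) u)"]) auto
      then have "homologous_rel p ?Y ?S z (realize r c)"
        by (simp add: homologous_rel_def)
      then have "Q = ?h c"
        by (simp only: z(2) homologous_rel_set_eq)
      then show "Q \<in> ?h ` carrier ?G"
        using cZ carr by auto
    qed
  qed
  have ker: "kernel ?G ?H ?h = ?Bd"
  proof
    show "kernel ?G ?H ?h \<subseteq> ?Bd"
    proof
      fix c assume "c \<in> kernel ?G ?H ?h"
      then have c: "c \<in> ?Z" "singular_relboundary p ?Y ?S (realize r c)"
        by (auto simp: kernel_def carr homologous_rel_set_eq_relboundary)
      then obtain w m where w: "singular_chain (Suc p) ?Y w" "singular_chain p (space_of M) m"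
        "chain_boundary (Suc p) w + m = realize r c"
        by (auto simp: simps)
      have cL: "c \<in> simp_chains L p" and cM: "simplicial_boundary r p c \<in> simp_chains M (p - 1)"
        using c(1) by (auto simp: Zeq)
      have "realize r c + chain_boundary (Suc p) (- w) = m"
        unfolding w(3)[symmetric] by (simp add: chain_boundary_minus)
      then have "(c, - w) \<in> cone_chains L (Suc p)" "cone_boundary (Suc p) (c, - w) \<in> cone_chains M (Suc p - 1)"
        using cL cM w simp_chains_closed(4)[OF cM]
        by (cases p; auto simp: cone_chains_Suc cone_chains_0 cone_boundary_Suc singular_chain_minus simplicial_boundary_0)+
      then obtain y where y: "y \<in> cone_chains L (Suc (Suc p))" "(c, - w) - cone_boundary (Suc (Suc p)) y \<in> cone_chains M (Suc p)"
        by (rule acyclic_pairD[OF acyc])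
      obtain d u where du: "y = (d, u)" by (cases y)
      have d: "d \<in> simp_chains L (Suc p)" "c + simplicial_boundary r (Suc p) d \<in> simp_chains M p"
        using y by (auto simp: du cone_chains_Suc cone_boundary_Suc)
      have "- (c + simplicial_boundary r (Suc p) d) = simplicial_boundary r (Suc p) (- d) - c"
        by (simp add: simplicial_boundary_linear)
      then have "simplicial_boundary r (Suc p) (- d) - c \<in> simp_chains M p"
        using simp_chains_closed(4)[OF d(2)] by (simp only:)
      then show "c \<in> ?Bd"
        using cL simp_chains_closed(4)[OF d(1)] by (auto simp: Bdeq)
    qed
    show "?Bd \<subseteq> kernel ?G ?H ?h"
    proof
      fix c assume "c \<in> ?Bd"
      then obtain d where d: "c \<in> simp_chains L p" "d \<in> simp_chains L (Suc p)" "simplicial_boundary r (Suc p) d - c \<in> simp_chains M p"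
        by (auto simp: Bdeq)
      let ?m = "simplicial_boundary r (Suc p) d - c"
      have dK: "d \<in> simp_chains K (Suc p)"
        using simp_chains_mono[OF L(2)] d(2) by auto
      \<comment> \<open>Relative boundaries are defined among all chains of \<open>L\<close>, so
        that they are relative cycles has to be derived from the vanishing of the squared
        boundary.\<close>
      have "simplicial_boundary r p c = - simplicial_boundary r p ?m"
        using simplicial_boundary_boundary[OF dK] by (simp add: simplicial_boundary_linear)
      then have "c \<in> ?Z"
        using d(1) simplicial_boundary_in[OF M(1) d(3)] by (simp add: Zeq simp_chains_closed)
      moreover have "singular_relboundary p ?Y ?S (realize r c)"
        unfolding simps
        using singular_chain_realize[OF L d(2)] singular_chain_realize[OF M(1) MK d(3)]
        by - (rule exI[of _ "realize r d"], rule exI[of _ "- realize r ?m"],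
          auto simp: chain_boundary_realize[OF order dK] singular_chain_minus, simp add: realize_linear)
      ultimately show "c \<in> kernel ?G ?H ?h"
        by (auto simp: kernel_def carr homologous_rel_set_eq_relboundary)
    qed
  qed
  have "group_hom ?G ?H ?h"
    using grpG hom by (simp add: group_hom_def group_hom_axioms_def)
  then have "?G Mod (kernel ?G ?H ?h) \<cong> ?H"
    using surj by (rule group_hom.FactGroup_iso)
  then show ?thesis
    by (simp add: ker simplicial_homology_group_def)
qed

end

section \<open>Isolated invariant sets and semiflows\<close>

lemma card_facet: "is_facet \<tau> \<sigma> \<Longrightarrow> card \<sigma> = Suc (card \<tau>)"
  by (auto simp: is_facet_def simplex_dim_def)

lemma facet_subset: "is_facet \<tau> \<sigma> \<Longrightarrow> \<tau> \<noteq> {} \<and> \<tau> \<subseteq> \<sigma>"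
  by (auto simp: is_facet_def is_face_def)

lemma face_in_simplicial_closure: "\<sigma> \<in> S \<Longrightarrow> \<tau> \<noteq> {} \<Longrightarrow> \<tau> \<subseteq> \<sigma> \<Longrightarrow> \<tau> \<in> simplicial_closure S"
  by (auto simp: simplicial_closure_def is_face_def)

lemma down_closed_closure: "down_closed (simplicial_closure S)"
  unfolding down_closed_def simplicial_closure_def is_face_def by blast

lemma mouth_subset_closure: "mouth S \<subseteq> simplicial_closure S"
  by (auto simp: mouth_def)

section \<open>Arrows and isolated invariant sets of a combinatorial vector field\<close>

context
  fixes K V
  assumes V: "combinatorial_vector_field K V"
begin

lemma vector_field_block_unique: "A \<in> V \<Longrightarrow> B \<in> V \<Longrightarrow> x \<in> A \<Longrightarrow> x \<in> B \<Longrightarrow> A = B"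
  using V unfolding combinatorial_vector_field_def partition_on_def disjoint_def by blast

lemma arrow_in_complex: "is_arrow V \<tau> \<sigma> \<Longrightarrow> \<tau> \<in> K \<and> \<sigma> \<in> K"
  using V unfolding combinatorial_vector_field_def partition_on_def is_arrow_def by blast

text \<open>Blocks that meet are equal, and cardinality tells the tail of a doubleton from its
  head.\<close>

lemma arrow_unique:
  assumes "is_arrow V \<tau> \<sigma>" "is_arrow V \<tau>' \<sigma>'" "{\<tau>, \<sigma>} \<inter> {\<tau>', \<sigma>'} \<noteq> {}"
  shows "\<tau> = \<tau>' \<and> \<sigma> = \<sigma>'"
proof -
  have "{\<tau>, \<sigma>} = {\<tau>', \<sigma>'}"
    using assms vector_field_block_unique[of "{\<tau>, \<sigma>}" "{\<tau>', \<sigma>'}"] unfolding is_arrow_def by blast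
  moreover have "card \<sigma> = Suc (card \<tau>)" "card \<sigma>' = Suc (card \<tau>')"
    using card_facet assms(1,2) unfolding is_arrow_def by blast+
  ultimately show ?thesis
    unfolding doubleton_eq_iff by (elim disjE) auto
qed

lemma arrow_not_critical:
  assumes "is_arrow V \<tau> \<sigma>"
  shows "\<tau> \<notin> critical V" "\<sigma> \<notin> critical V"
proof -
  have "{\<tau>, \<sigma>} \<in> V" "\<tau> \<noteq> \<sigma>"
    using assms card_facet[of \<tau> \<sigma>] unfolding is_arrow_def by auto
  then show "\<tau> \<notin> critical V" "\<sigma> \<notin> critical V"
    using vector_field_block_unique[of "{\<tau>, \<sigma>}"] unfolding critical_def by blast+
qed

lemma head_of_arrow: "is_arrow V \<tau> \<sigma> \<Longrightarrow> head_of V \<tau> = \<sigma>"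
  unfolding head_of_def by (rule the_equality) (use arrow_unique in blast)+

lemma tail_of_arrow: "is_arrow V \<tau> \<sigma> \<Longrightarrow> tail_of V \<sigma> = \<tau>"
  unfolding tail_of_def by (rule the_equality) (use arrow_unique in blast)+

lemma arrow_head_not_tail:
  assumes "is_arrow V \<tau> \<sigma>"
  shows "\<sigma> \<notin> arrow_tails V"
proof
  assume "\<sigma> \<in> arrow_tails V"
  then obtain \<eta> where "is_arrow V \<sigma> \<eta>"
    by (auto simp: arrow_tails_def)
  then have "\<tau> = \<sigma>"
    using arrow_unique[OF assms, of \<sigma> \<eta>] by simp
  then show False
    using card_facet[of \<tau> \<sigma>] assms by (simp add: is_arrow_def)
qed

lemma Pi_map_tail: "is_arrow V \<tau> \<sigma> \<Longrightarrow> Pi_map V \<tau> = {\<sigma>}"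
  using arrow_not_critical head_of_arrow by (auto simp: Pi_map_def arrow_tails_def)

text \<open>No simplex is both a tail and a head, so \<open>lower_simplex\<close> or
  \<open>upper_simplex\<close> returns the simplex itself.\<close>

lemma flow_tile_superset: "X closure_of eps_cell K \<epsilon> \<sigma> \<subseteq> flow_tile K V \<epsilon> \<sigma>" if "X = polytope_space K"
proof (cases "\<sigma> \<in> arrow_heads V")
  case True
  then have "\<sigma> \<notin> arrow_tails V"
    using arrow_head_not_tail by (auto simp: arrow_heads_def)
  then show ?thesis
    using that by (auto simp: flow_tile_def upper_simplex_def)
next
  case False
  then show ?thesis
    using that by (auto simp: flow_tile_def lower_simplex_def)
qed

context
  fixes S
  assumes S: "comb_isolated_invariant K V S"
begin

lemma isolated_invariant_subset: "S \<subseteq> K"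
  using S by (simp add: comb_isolated_invariant_def comb_invariant_def)

text \<open>
  If only the head \<open>\<sigma>\<close> of an arrow were in \<open>S\<close>, a predecessor \<open>\<kappa>\<close> of \<open>\<sigma>\<close> in \<open>S\<close> could also move to the
  tail \<open>\<tau>\<close>, and \<open>\<kappa>, \<tau>, \<sigma>\<close> would be a solution that leaves \<open>S\<close> through its mouth and returns.
\<close>

lemma arrow_tail_in_iff_head_in:
  assumes arrow: "is_arrow V \<tau> \<sigma>"
  shows "\<tau> \<in> S \<longleftrightarrow> \<sigma> \<in> S"
proof
  assume "\<tau> \<in> S"
  then obtain \<rho> where \<rho>: "comb_solution K V UNIV \<rho>" "\<rho> 0 = \<tau>" "range \<rho> \<subseteq> S"
    using S by (auto simp: comb_isolated_invariant_def comb_invariant_def)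
  then have "\<rho> (0 + 1) \<in> Pi_map V \<tau>"
    unfolding comb_solution_def by blast
  then show "\<sigma> \<in> S"
    using \<rho>(3) Pi_map_tail[OF arrow] by auto
next
  assume \<sigma>: "\<sigma> \<in> S"
  show "\<tau> \<in> S"
  proof (rule ccontr)
    assume \<tau>: "\<tau> \<notin> S"
    obtain \<rho> where \<rho>: "comb_solution K V UNIV \<rho>" "\<rho> 0 = \<sigma>" "range \<rho> \<subseteq> S"
      using S \<sigma> by (auto simp: comb_isolated_invariant_def comb_invariant_def)
    define \<kappa> where "\<kappa> = \<rho> (-1)"
    have \<kappa>: "\<kappa> \<in> S" using \<rho>(3) by (auto simp: \<kappa>_def)
    have step: "\<sigma> \<in> Pi_map V \<kappa>"
      using \<rho>(1,2) unfolding comb_solution_def \<kappa>_def by (metis UNIV_I add.left_inverse)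
    have face: "\<tau> \<noteq> {}" "\<tau> \<subseteq> \<sigma>" "\<tau> \<noteq> \<sigma>"
      using arrow facet_subset[of \<tau> \<sigma>] card_facet[of \<tau> \<sigma>] by (auto simp: is_arrow_def)
    \<comment> \<open>If \<open>\<kappa>\<close> is critical or a head, its image contains with
      \<open>\<sigma>\<close> also the proper face \<open>\<tau>\<close>, unless
      \<open>\<tau>\<close> is the excluded tail of \<open>\<kappa>\<close>; but then
      \<open>\<kappa> = \<sigma>\<close>, which is not in its own boundary. If
      \<open>\<kappa>\<close> is a tail, its head is \<open>\<sigma>\<close>, so
      \<open>\<kappa> = \<tau>\<close> contradicts \<open>\<tau> \<notin> S\<close>.\<close>
    have "\<tau> \<in> Pi_map V \<kappa>"
    proof (cases "\<kappa> \<in> critical V")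
      case True
      then show ?thesis
        using step face by (auto simp: Pi_map_def simplicial_closure_def is_face_def)
    next
      case nc: False
      show ?thesis
      proof (cases "\<kappa> \<in> arrow_tails V")
        case True
        then obtain \<eta> where \<eta>: "is_arrow V \<kappa> \<eta>"
          by (auto simp: arrow_tails_def)
        then have "\<eta> = \<sigma>"
          using step Pi_map_tail by auto
        then have "\<kappa> = \<tau>"
          using \<eta> arrow arrow_unique by blast
        then show ?thesis
          using \<kappa> \<tau> by simp
      next
        case nt: False
        show ?thesis
        proof (cases "\<kappa> \<in> arrow_heads V")
          case True
          have Pk: "Pi_map V \<kappa> = simplex_boundary \<kappa> - {tail_of V \<kappa>}"
            using nc nt True by (simp add: Pi_map_def)
          have "\<tau> \<noteq> tail_of V \<kappa>"
          proof
            assume eq: "\<tau> = tail_of V \<kappa>"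
            obtain \<eta> where \<eta>: "is_arrow V \<eta> \<kappa>"
              using True by (auto simp: arrow_heads_def)
            then have "\<kappa> = \<sigma>"
              using eq tail_of_arrow[OF \<eta>] arrow arrow_unique by blast
            then show False
              using step Pk by (auto simp: simplex_boundary_def)
          qed
          then show ?thesis
            using step face unfolding Pk by (auto simp: simplex_boundary_def is_face_def)
        qed (use step nc nt in \<open>simp add: Pi_map_def\<close>)
      qed
    qed
    moreover have "\<sigma> \<in> Pi_map V \<tau>"
      using Pi_map_tail[OF arrow] by simp
    moreover have "\<tau> \<in> mouth S"
      using face_in_simplicial_closure[OF \<sigma> face(1,2)] \<tau> by (simp add: mouth_def)
    moreover have "\<kappa> \<in> K" "\<tau> \<in> K" "\<sigma> \<in> K"
      using \<kappa> isolated_invariant_subset arrow_in_complex[OF arrow] by auto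
    ultimately have "comb_solution K V {-1, 0, 1} (\<lambda>k. if k < 0 then \<kappa> else if k = 0 then \<tau> else \<sigma>)"
      by (auto simp: comb_solution_def int_interval_def)
    then show False
      using S \<kappa> \<sigma> \<open>\<tau> \<in> mouth S\<close> unfolding comb_isolated_invariant_def
      by (auto dest!: spec[of _ "\<lambda>k. if k < 0 then \<kappa> else if k = 0 then \<tau> else \<sigma>"])
  qed
qed

lemma lower_upper_simplex_in:
  assumes "\<sigma> \<in> S"
  shows "lower_simplex V \<sigma> \<in> S" "upper_simplex V \<sigma> \<in> S"
  using assms arrow_tail_in_iff_head_in tail_of_arrow head_of_arrow
  by (auto simp: lower_simplex_def upper_simplex_def arrow_heads_def arrow_tails_def)

lemma down_closed_mouth: "down_closed (mouth S)"
proof -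
  have "simplicial_closure (mouth S) = mouth S"
    using S by (simp add: comb_isolated_invariant_def combinatorially_closed_def)
  then show ?thesis
    by (auto simp: down_closed_def simplicial_closure_def is_face_def)
qed

text \<open>A missing intermediate simplex would lie in the mouth, and since the mouth is closed
  under faces, \<open>\<tau>\<close> would lie there too.\<close>

lemma invariant_convex:
  assumes "\<tau> \<in> S" "\<kappa> \<in> S" "\<tau> \<subseteq> \<sigma>" "\<sigma> \<subseteq> \<kappa>" "\<tau> \<noteq> {}"
  shows "\<sigma> \<in> S"
proof (rule ccontr)
  assume "\<sigma> \<notin> S"
  then have "\<sigma> \<in> mouth S"
    using assms face_in_simplicial_closure[of \<kappa> S \<sigma>] by (auto simp: mouth_def)
  then have "\<tau> \<in> mouth S"
    using down_closedD[OF down_closed_mouth _ assms(5,3)] by simp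
  then show False
    using assms(1) by (simp add: mouth_def)
qed

end

end

lemma openin_interval_pos:
  assumes "openin (top_of_set {a..b}) W" "0 \<in> W" "0 < (b::real)"
  obtains t where "t \<in> W" "0 < t"
proof -
  obtain O' where O': "open O'" "W = {a..b} \<inter> O'"
    using assms(1) by (auto simp: openin_open)
  then obtain e where e: "e > 0" "ball 0 e \<subseteq> O'"
    using assms(2) open_contains_ball by blast
  have "min (e / 2) b \<in> W"
    using e assms O' by (auto simp: subset_iff)
  then show thesis
    using that e assms(3) by simp
qed

lemma openin_interval_neg:
  assumes "openin (top_of_set {a..b}) W" "0 \<in> W" "a < (0::real)"
  obtains t where "t \<in> W" "t < 0"
proof -
  obtain O' where O': "open O'" "W = {a..b} \<inter> O'"
    using assms(1) by (auto simp: openin_open)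
  then obtain e where e: "e > 0" "ball 0 e \<subseteq> O'"
    using assms(2) open_contains_ball by blast
  have "max (- e / 2) a \<in> W"
    using e assms O' by (auto simp: subset_iff)
  then show thesis
    using that[of "max (- e / 2) a"] e assms(3) by simp
qed

section \<open>Compactness of the polytope and closedness of invariant parts\<close>

context polyhedron
begin

text \<open>Points are functions on the whole vertex type, which may be infinite, so compactness of
  the surrounding cube is an instance of Tychonoff's theorem. The support condition is closed in the
  form that every non-simplex has a coordinate at most \<open>0\<close>.\<close>

lemma compact_polytope: "compact P"
proof -
  let ?N = "{\<tau>. \<tau> \<subseteq> vertices K \<and> \<tau> \<noteq> {} \<and> \<tau> \<notin> K}"
  let ?box = "{x::'v\<Rightarrow>real. \<forall>v. 0 \<le> x v \<and> x v \<le> 1}"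
  have fin: "finite \<tau>" if "\<tau> \<in> ?N" for \<tau>
    using that finite_vertices finite_subset by blast
  have "compactin (powertop_real UNIV) (PiE UNIV (\<lambda>v::'v. {0..1::real}))"
    by (simp add: compactin_PiE)
  then have box: "compact (PiE UNIV (\<lambda>v::'v. {0..1::real}))"
    by (simp add: euclidean_product_topology)
  let ?C = "(\<Inter>v\<in>- vertices K. {x::'v\<Rightarrow>real. x v = 0}) \<inter> {x. (\<Sum>v\<in>vertices K. x v) = 1} \<inter>
    (\<Inter>\<tau>\<in>?N. \<Union>v\<in>\<tau>. {x::'v\<Rightarrow>real. x v \<le> 0})"
  have "closed ?C"
  proof (intro closed_Int closed_INT ballI closed_UN)
    show "closed {x::'v\<Rightarrow>real. x v = 0}" for v
      by (rule closed_Collect_eq[OF continuous_on_coordinate continuous_on_const])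
    show "closed {x::'v\<Rightarrow>real. x v \<le> 0}" for v
      by (rule closed_Collect_le[OF continuous_on_coordinate continuous_on_const])
    show "closed {x::'v\<Rightarrow>real. (\<Sum>v\<in>vertices K. x v) = 1}"
      by (intro closed_Collect_eq continuous_on_sum continuous_on_coordinate continuous_on_const)
  qed (use fin in auto)
  moreover have "P = PiE UNIV (\<lambda>v::'v. {0..1::real}) \<inter> ?C"
  proof
    show "P \<subseteq> PiE UNIV (\<lambda>v::'v. {0..1::real}) \<inter> ?C"
    proof
      fix x assume x: "x \<in> P"
      have le1: "x v \<le> 1" for v
      proof (cases "v \<in> vertices K")
        case True
        then have "x v \<le> (\<Sum>v\<in>vertices K. x v)"
          using pointD(2)[OF x] finite_vertices by (intro member_le_sum) auto
        then show ?thesis using pointD(3)[OF x] by simp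
      qed (use pointD(1)[OF x] in simp)
      have "x \<in> superlevel K 0 K"
        using x pointD(4)[OF x] by (simp add: superlevel_def)
      then have "\<forall>\<tau>\<in>?N. \<exists>v\<in>\<tau>. x v \<le> 0"
        unfolding superlevel_eq_no_face_above[OF admissible_level_0 down_closed_complex] by blast
      then show "x \<in> PiE UNIV (\<lambda>v::'v. {0..1::real}) \<inter> ?C"
        using le1 pointD(1-3)[OF x] by auto
    qed
    show "PiE UNIV (\<lambda>v::'v. {0..1::real}) \<inter> ?C \<subseteq> P"
    proof
      fix x assume x: "x \<in> PiE UNIV (\<lambda>v::'v. {0..1::real}) \<inter> ?C"
      then have nn: "0 \<le> x v" and off: "v \<notin> vertices K \<Longrightarrow> x v = 0" and sum: "(\<Sum>v\<in>vertices K. x v) = 1" for v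
        by (auto simp: PiE_def Pi_def)
      let ?s = "{v\<in>vertices K. x v > 0}"
      have "?s \<noteq> {}"
        using sum_one_imp_pos[OF sum] by blast
      moreover have "\<not> (\<exists>v\<in>?s. x v \<le> 0)" "?s \<subseteq> vertices K"
        by auto
      ultimately have "?s \<in> K"
        using x by blast
      then show "x \<in> P"
        using nn off sum by (simp add: topspace_polytope_space)
    qed
  qed
  ultimately show ?thesis
    using box by (simp add: compact_Int_closed)
qed

lemma compact_space_polytope: "compact_space X"
  using compact_polytope by (simp add: polytope_space_def compact_space_subtopology)

lemma Hausdorff_polytope: "Hausdorff_space X"
  using Hausdorff_space_product_topology[of "\<lambda>_::'v. euclideanreal" UNIV]
  by (auto simp: polytope_space_def euclidean_product_topology intro: Hausdorff_space_subtopology)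

lemma continuous_semiflow:
  assumes "semiflow X \<phi>" "0 \<le> s"
  shows "continuous_map X X (\<phi> s)"
proof -
  have c: "continuous_map (prod_topology (top_of_set {0..}) X) X (\<lambda>(t, x). \<phi> t x)"
    using assms by (simp add: semiflow_def)
  have "continuous_map X (prod_topology (top_of_set {0..}) X) (\<lambda>x. (s, x))"
    using assms(2) by (intro continuous_map_pairedI) (auto simp: continuous_map_const)
  from continuous_map_compose[OF this c] show ?thesis
    by (simp add: o_def)
qed

text \<open>
  A full solution is determined by its values at the times \<open>0, -1, -2, \<dots>\<close>. These sequences form a
  closed subset of a countable power of the compact space \<open>X\<close>, which projects onto the invariant part.
\<close>

lemma closedin_Inv:
  assumes sf: "semiflow X \<phi>" and B: "closedin X B"
  shows "closedin X (Inv X \<phi> B)"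
proof -
  have BP: "B \<subseteq> P" using B closedin_subset by blast
  have \<phi>0: "\<phi> 0 x = x" if "x \<in> P" for x
    using sf that by (simp add: semiflow_def)
  have \<phi>add: "\<phi> s (\<phi> t x) = \<phi> (s + t) x" if "x \<in> P" "0 \<le> s" "0 \<le> t" for s t x
    using sf that by (simp add: semiflow_def)
  define F where "F = {y\<in>B. \<forall>s\<ge>0. \<phi> s y \<in> B}"
  have "F = (\<Inter>s\<in>{0..}. {y \<in> topspace X. \<phi> s y \<in> B}) \<inter> B"
    using BP by (auto simp: F_def)
  then have F: "closedin X F"
    using B continuous_semiflow[OF sf]
    by (auto intro!: closedin_Int closedin_Inter closedin_continuous_map_preimage)
  have FP: "F \<subseteq> P" using BP by (auto simp: F_def)
  let ?PT = "product_topology (\<lambda>_::nat. X) UNIV"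
  \<comment> \<open>\<open>y n\<close> stands for the value at time \<open>- n\<close>. Membership
    in \<open>F\<close> keeps the whole forward orbit of each \<open>y n\<close> in
    \<open>B\<close>, which covers the times in between.\<close>
  define Z where "Z = {y \<in> topspace ?PT. \<forall>n. y n \<in> F \<and> \<phi> 1 (y (Suc n)) = y n}"
  have proj: "continuous_map ?PT X (\<lambda>y. y n)" for n
    by (rule continuous_map_product_projection) simp
  have Zeq: "Z = (\<Inter>n. {y \<in> topspace ?PT. y n \<in> F}) \<inter> (\<Inter>n. {y \<in> topspace ?PT. \<phi> 1 (y (Suc n)) = y n})"
    by (auto simp: Z_def)
  have "closedin ?PT Z"
    unfolding Zeq
  proof (intro closedin_Int closedin_INT)
    show "closedin ?PT {y \<in> topspace ?PT. y n \<in> F}" for n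
      by (rule closedin_continuous_map_preimage[OF proj F])
    show "closedin ?PT {y \<in> topspace ?PT. \<phi> 1 (y (Suc n)) = y n}" for n
      using continuous_map_compose[OF proj continuous_semiflow[OF sf zero_le_one], of "Suc n"]
      by (intro closedin_continuous_maps_eq[OF Hausdorff_polytope _ proj]) (simp add: o_def)
  qed auto
  moreover have "compact_space ?PT"
    using compact_space_polytope by (simp add: compact_space_product_topology)
  ultimately have "compactin ?PT Z"
    by (rule closedin_compact_space[rotated])
  then have "compactin X ((\<lambda>y. y 0) ` Z)"
    by (rule image_compactin[OF _ proj])
  then have closed: "closedin X ((\<lambda>y. y 0) ` Z)"
    using Hausdorff_polytope by (simp add: compactin_imp_closedin)
  have "Inv X \<phi> B = (\<lambda>y. y 0) ` Z"
  proof
    show "Inv X \<phi> B \<subseteq> (\<lambda>y. y 0) ` Z"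
    proof
      fix x assume "x \<in> Inv X \<phi> B"
      then obtain \<gamma> where \<gamma>: "flow_solution X \<phi> UNIV \<gamma>" "\<gamma> 0 = x" "range \<gamma> \<subseteq> B"
        by (auto simp: Inv_def)
      have step: "\<phi> s (\<gamma> t) = \<gamma> (s + t)" if "0 \<le> s" for s t
        using \<gamma>(1) that by (simp add: flow_solution_def)
      define y where "y = (\<lambda>n::nat. \<gamma> (- real n))"
      have "y n \<in> F" for n
        using \<gamma>(3) step by (auto simp: F_def y_def)
      moreover have "\<phi> 1 (y (Suc n)) = y n" for n
        using step[of 1 "- real (Suc n)"] by (simp add: y_def)
      ultimately have "y \<in> Z"
        using FP by (auto simp: Z_def)
      moreover have "y 0 = x"
        using \<gamma>(2) by (simp add: y_def)
      ultimately show "x \<in> (\<lambda>y. y 0) ` Z" by blast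
    qed
    show "(\<lambda>y. y 0) ` Z \<subseteq> Inv X \<phi> B"
    proof clarify
      fix y assume "y \<in> Z"
      then have yF: "y n \<in> F" and yS: "\<phi> 1 (y (Suc n)) = y n" for n
        by (auto simp: Z_def)
      have yP: "y n \<in> P" for n using yF FP by blast
      have rewind: "\<phi> (real k) (y (n + k)) = y n" for n k
      proof (induction k)
        case 0
        then show ?case using \<phi>0[OF yP] by simp
      next
        case (Suc k)
        have "\<phi> (real (Suc k)) (y (n + Suc k)) = \<phi> (real k) (\<phi> 1 (y (Suc (n + k))))"
          using \<phi>add[OF yP, of "real k" 1] by (simp add: add.commute)
        then show ?case using yS Suc by simp
      qed
      have indep: "\<phi> (t + real (n + k)) (y (n + k)) = \<phi> (t + real n) (y n)" if "0 \<le> t + real n" for t n k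
        using \<phi>add[OF yP that, of "real k" "n + k"] rewind[of k n] by (simp add: add.assoc)
      \<comment> \<open>\<open>nat \<lceil>- t\<rceil>\<close> is the least \<open>n\<close> with
        \<open>0 \<le> t + n\<close>. By \<open>indep\<close> every such \<open>n\<close> gives the
        same value, so a common \<open>n\<close> may be used for two times.\<close>
      define \<gamma> where "\<gamma> = (\<lambda>t. \<phi> (t + real (nat \<lceil>- t\<rceil>)) (y (nat \<lceil>- t\<rceil>)))"
      have \<gamma>: "\<gamma> t = \<phi> (t + real n) (y n)" if "0 \<le> t + real n" for t n
      proof -
        let ?m = "nat \<lceil>- t\<rceil>"
        have m: "0 \<le> t + real ?m" by linarith
        have "\<phi> (t + real (?m + n)) (y (?m + n)) = \<gamma> t"
          using indep[OF m, of n] by (simp add: \<gamma>_def)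
        moreover have "\<phi> (t + real (n + ?m)) (y (n + ?m)) = \<phi> (t + real n) (y n)"
          using indep[OF that] .
        ultimately show ?thesis by (simp add: add.commute)
      qed
      have ex: "\<exists>n::nat. 0 \<le> t + real n" for t :: real
        by (rule exI[of _ "nat \<lceil>- t\<rceil>"]) linarith
      have in_B: "\<gamma> t \<in> B" for t
        using ex[of t] \<gamma> yF by (auto simp: F_def)
      have "\<phi> s (\<gamma> t) = \<gamma> (s + t)" if "0 \<le> s" for s t
      proof -
        obtain n where n: "0 \<le> t + real n" using ex by blast
        then have "0 \<le> s + t + real n" using that by simp
        then show ?thesis
          using \<gamma>[OF n] \<gamma>[of "s + t" n] \<phi>add[OF yP that n] by (simp add: add.assoc)
      qed
      then have "flow_solution X \<phi> UNIV \<gamma>"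
        using in_B BP by (auto simp: flow_solution_def)
      moreover have "\<gamma> 0 = y 0"
        using \<gamma>[of 0 0] \<phi>0[OF yP] by simp
      moreover have "y 0 \<in> B"
        using yF[of 0] by (simp add: F_def)
      ultimately show "y 0 \<in> Inv X \<phi> B"
        using in_B by (auto simp: Inv_def)
    qed
  qed
  then show ?thesis
    using closed by simp
qed

end

section \<open>The isolating block\<close>

lemma closure_of_polytope_space:
  "A \<subseteq> topspace (polytope_space K) \<Longrightarrow>
     polytope_space K closure_of A = topspace (polytope_space K) \<inter> closure A"
  by (simp add: polytope_space_def closure_of_subtopology Int_absorb1)

context polyhedron
begin

lemma admissible_levelI:
  assumes "0 < \<epsilon>" and "\<epsilon> < 1 / (1 + real_of_int (complex_dim K))"
  shows "admissible_level K \<epsilon>"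
  unfolding admissible_level_def
proof (intro conjI ballI)
  fix \<sigma> assume \<sigma>: "\<sigma> \<in> K"
  have "simplex_dim \<sigma> \<le> complex_dim K"
    unfolding complex_dim_def using \<sigma> finite_complex by (intro Max_ge) auto
  then have "real (card \<sigma>) \<le> 1 + real_of_int (complex_dim K)"
    unfolding simplex_dim_def by linarith
  moreover have "0 < card \<sigma>"
    using simplexD[OF \<sigma>] by (simp add: card_gt_0_iff)
  ultimately have "\<epsilon> * real (card \<sigma>) \<le> \<epsilon> * (1 + real_of_int (complex_dim K))" "0 < 1 + real_of_int (complex_dim K)"
    using assms(1) by auto
  moreover from this have "\<epsilon> * (1 + real_of_int (complex_dim K)) < 1"
    using assms(2) by (simp add: pos_less_divide_eq)
  ultimately show "\<epsilon> * real (card \<sigma>) < 1"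
    by simp
qed (use assms in simp)

text \<open>\<open>g\<close> is a positive lower bound for the slack
  \<open>1 - \<epsilon> * card \<sigma>\<close> of all simplices and \<open>n\<close> an upper bound
  for their cardinalities. Raising the level by \<open>g / (2 * n)\<close> costs each simplex at
  most half of \<open>g\<close>. The inserted \<open>1\<close> keeps the minimum defined for an
  empty complex.\<close>

lemma admissible_level_larger:
  assumes "admissible_level K \<epsilon>"
  obtains b where "\<epsilon> < b" "admissible_level K b"
proof -
  define n where "n = 1 + real (\<Sum>\<sigma>\<in>K. card \<sigma>)"
  have n: "0 < n"
    unfolding n_def by (rule add_pos_nonneg[OF zero_less_one of_nat_0_le_iff])
  have card: "real (card \<sigma>) \<le> n" if "\<sigma> \<in> K" for \<sigma>
    using member_le_sum[OF that, of card] finite_complex unfolding n_def by (smt (verit) of_nat_mono zero_le)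
  define g where "g = Min (insert 1 ((\<lambda>\<sigma>. 1 - \<epsilon> * real (card \<sigma>)) ` K))"
  have g: "0 < g"
    unfolding g_def using assms finite_complex by (subst Min_gr_iff) (auto simp: admissible_level_def)
  have le: "g \<le> 1 - \<epsilon> * real (card \<sigma>)" if "\<sigma> \<in> K" for \<sigma>
    unfolding g_def using that finite_complex by (intro Min_le) auto
  have "\<epsilon> < \<epsilon> + g / (2 * n)"
    using g n by simp
  moreover have "admissible_level K (\<epsilon> + g / (2 * n))"
    unfolding admissible_level_def
  proof (intro conjI ballI)
    show "0 \<le> \<epsilon> + g / (2 * n)"
      using assms g n by (simp add: admissible_level_def)
    fix \<sigma> assume \<sigma>: "\<sigma> \<in> K"
    have "g / (2 * n) * real (card \<sigma>) \<le> g / (2 * n) * n"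
      using card[OF \<sigma>] g n by (intro mult_left_mono) auto
    also have "\<dots> = g / 2"
      using n by simp
    also have "\<dots> < 1 - \<epsilon> * real (card \<sigma>)"
      using le[OF \<sigma>] g by linarith
    finally show "(\<epsilon> + g / (2 * n)) * real (card \<sigma>) < 1"
      by (simp add: distrib_right)
  qed
  ultimately show thesis
    using that by blast
qed

section \<open>The cells whose closures contain a given point\<close>

context
  fixes \<epsilon> :: real
  assumes pos: "0 < \<epsilon>" and lev: "admissible_level K \<epsilon>"
begin

abbreviation "lo x \<equiv> sigma_min K \<epsilon> x"
abbreviation "hi x \<equiv> sigma_max K \<epsilon> x"

lemma sigma_min_le_max: "lo x \<subseteq> hi x"
  by (auto simp: sigma_min_def sigma_max_def)

text \<open>Since \<open>\<epsilon>\<close> is positive, \<open>hi x\<close> lies in the support of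
  \<open>x\<close>. Quantifying over sets between \<open>lo x\<close> and \<open>hi x\<close>
  therefore means quantifying over simplices.\<close>

lemma sigma_between:
  assumes x: "x \<in> P" and \<sigma>: "lo x \<subseteq> \<sigma>" "\<sigma> \<subseteq> hi x"
  shows "\<sigma> \<in> K" "\<sigma> \<noteq> {}"
proof -
  have "lo x \<noteq> {}"
    using exceeds_level[OF x lev] unfolding sigma_min_def by blast
  then show "\<sigma> \<noteq> {}"
    using \<sigma> by blast
  moreover have "\<sigma> \<subseteq> {v\<in>vertices K. x v > 0}"
    using \<sigma>(2) pos by (auto simp: sigma_max_def)
  ultimately show "\<sigma> \<in> K"
    by (rule down_closedD[OF down_closed_complex pointD(4)[OF x]])
qed

lemma superlevel_sigma_min: "superlevel K \<epsilon> L = {x\<in>P. lo x \<in> L}"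
  by (simp add: superlevel_def sigma_min_def)

lemma eps_cell_iff:
  assumes "\<sigma> \<subseteq> vertices K"
  shows "x \<in> eps_cell K \<epsilon> \<sigma> \<longleftrightarrow> x \<in> P \<and> lo x = \<sigma> \<and> hi x = \<sigma>"
proof -
  have "(\<forall>v\<in>\<sigma>. \<epsilon> < x v) \<and> (\<forall>v\<in>vertices K - \<sigma>. x v < \<epsilon>) \<longleftrightarrow> lo x = \<sigma> \<and> hi x = \<sigma>" (is "?l \<longleftrightarrow> ?r")
  proof
    assume l: ?l
    have "(v \<in> lo x \<longleftrightarrow> v \<in> \<sigma>) \<and> (v \<in> hi x \<longleftrightarrow> v \<in> \<sigma>)" for v
    proof (cases "v \<in> \<sigma>")
      case True
      then have "\<epsilon> < x v" "v \<in> vertices K"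
        using l assms by blast+
      then show ?thesis
        using True by (simp add: sigma_min_def sigma_max_def)
    next
      case False
      then have "x v < \<epsilon>" if "v \<in> vertices K"
        using l that by blast
      then show ?thesis
        using False by (auto simp: sigma_min_def sigma_max_def)
    qed
    then show ?r
      by blast
  next
    assume r: ?r
    show ?l
    proof (intro conjI ballI)
      fix v assume "v \<in> \<sigma>"
      then have "v \<in> lo x" using r by simp
      then show "\<epsilon> < x v" by (simp add: sigma_min_def)
    next
      fix v assume v: "v \<in> vertices K - \<sigma>"
      then have "v \<notin> hi x" using r by simp
      then show "x v < \<epsilon>" using v by (simp add: sigma_max_def)
    qed
  qed
  then show ?thesis by (simp add: eps_cell_def)
qed

definition barycenter :: "'v set \<Rightarrow> 'v \<Rightarrow> real" where
  "barycenter \<sigma> = (\<lambda>v. if v \<in> \<sigma> then 1 / real (card \<sigma>) else 0)"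

lemma barycenter_in:
  assumes \<sigma>: "\<sigma> \<in> K"
  shows "barycenter \<sigma> \<in> P"
proof -
  have sub: "\<sigma> \<subseteq> vertices K" and card: "0 < real (card \<sigma>)"
    using simplexD[OF \<sigma>] simplex_vertices[OF \<sigma>] by (auto simp: card_gt_0_iff)
  have "{v\<in>vertices K. barycenter \<sigma> v > 0} = \<sigma>"
    using sub card by (auto simp: barycenter_def)
  moreover have "(\<Sum>v\<in>vertices K. barycenter \<sigma> v) = (\<Sum>v\<in>\<sigma>. 1 / real (card \<sigma>))"
    using sub finite_vertices by (intro sum.mono_neutral_cong_right) (auto simp: barycenter_def)
  ultimately show ?thesis
    using sub \<sigma> card by (auto simp: topspace_polytope_space barycenter_def)
qed

lemma barycenter_gt:
  assumes \<sigma>: "\<sigma> \<in> K" and v: "v \<in> \<sigma>"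
  shows "\<epsilon> < barycenter \<sigma> v"
proof -
  have "0 < real (card \<sigma>)"
    using simplexD[OF \<sigma>] by (simp add: card_gt_0_iff)
  then show ?thesis
    using lev \<sigma> v by (auto simp: admissible_level_def barycenter_def pos_less_divide_eq)
qed

text \<open>For the second inclusion, move from \<open>x\<close> straight towards the barycenter of
  \<open>\<sigma>\<close>. The segment stays in the closed simplex carrying \<open>x\<close>, which
  contains \<open>\<sigma>\<close>, and it lies in the open cell at every positive time.\<close>

lemma closure_eps_cell:
  assumes \<sigma>: "\<sigma> \<in> K"
  shows "X closure_of eps_cell K \<epsilon> \<sigma> = {x\<in>P. lo x \<subseteq> \<sigma> \<and> \<sigma> \<subseteq> hi x}"
proof
  have sub: "\<sigma> \<subseteq> vertices K"
    by (rule simplex_vertices[OF \<sigma>])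
  let ?C = "(\<Inter>v\<in>\<sigma>. {x::'v\<Rightarrow>real. \<epsilon> \<le> x v}) \<inter> (\<Inter>v\<in>vertices K - \<sigma>. {x. x v \<le> \<epsilon>})"
  have "closed ?C"
  proof (intro closed_Int closed_INT ballI)
    show "closed {x::'v\<Rightarrow>real. \<epsilon> \<le> x v}" for v
      by (rule closed_Collect_le[OF continuous_on_const continuous_on_coordinate])
    show "closed {x::'v\<Rightarrow>real. x v \<le> \<epsilon>}" for v
      by (rule closed_Collect_le[OF continuous_on_coordinate continuous_on_const])
  qed
  then have "closedin X (P \<inter> ?C)"
    by (rule closedin_polytope_space)
  moreover have eq: "P \<inter> ?C = {x\<in>P. lo x \<subseteq> \<sigma> \<and> \<sigma> \<subseteq> hi x}"
  proof -
    have "x \<in> ?C \<longleftrightarrow> lo x \<subseteq> \<sigma> \<and> \<sigma> \<subseteq> hi x" for x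
      using sub by (auto simp: sigma_min_def sigma_max_def not_less[symmetric])
    then show ?thesis by blast
  qed
  moreover have "eps_cell K \<epsilon> \<sigma> \<subseteq> {x\<in>P. lo x \<subseteq> \<sigma> \<and> \<sigma> \<subseteq> hi x}"
    using eps_cell_iff[OF sub] by auto
  ultimately show "X closure_of eps_cell K \<epsilon> \<sigma> \<subseteq> {x\<in>P. lo x \<subseteq> \<sigma> \<and> \<sigma> \<subseteq> hi x}"
    by (intro closure_of_minimal) auto
  show "{x\<in>P. lo x \<subseteq> \<sigma> \<and> \<sigma> \<subseteq> hi x} \<subseteq> X closure_of eps_cell K \<epsilon> \<sigma>"
  proof clarify
    fix x assume x: "x \<in> P" "lo x \<subseteq> \<sigma>" "\<sigma> \<subseteq> hi x"
    let ?s = "{v\<in>vertices K. x v > 0}"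
    define c where "c = barycenter \<sigma>"
    have cP: "c \<in> P" and ec: "\<And>v. v \<in> \<sigma> \<Longrightarrow> \<epsilon> < c v" and c0: "\<And>v. v \<notin> \<sigma> \<Longrightarrow> c v = 0"
      using barycenter_in[OF \<sigma>] barycenter_gt[OF \<sigma>] by (auto simp: c_def barycenter_def)
    have \<sigma>s: "\<sigma> \<subseteq> ?s"
      using x(3) pos by (auto simp: sigma_max_def)
    have sK: "?s \<in> K"
      by (rule pointD(4)[OF x(1)])
    have xs: "x \<in> superlevel K 0 (faces ?s)"
      unfolding superlevel_faces[OF sK] using x(1) pointD(1,2)[OF x(1)] by (auto simp: order_less_le)
    have cs: "c \<in> superlevel K 0 (faces ?s)"
      unfolding superlevel_faces[OF sK] using cP \<sigma>s c0 by blast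
    define f where "f = (\<lambda>t v. (1 - t) * x v + t * c v)"
    have fP: "f t \<in> P" if "0 \<le> t" "t \<le> 1" for t
      using convex_faces[OF sK xs cs that] superlevel_subset by (auto simp: f_def)
    have fcell: "f t \<in> eps_cell K \<epsilon> \<sigma>" if t: "t \<in> {0<..1}" for t
    proof -
      have "f t v > \<epsilon>" if "v \<in> \<sigma>" for v
      proof -
        have "(1 - t) * x v + t * c v \<ge> (1 - t) * \<epsilon> + t * c v"
          using t that x(3) by (intro add_right_mono mult_left_mono) (auto simp: sigma_max_def)
        moreover have "t * c v > t * \<epsilon>"
          using mult_strict_left_mono[OF ec[OF that], of t] t by simp
        ultimately show ?thesis
          by (simp add: f_def algebra_simps)
      qed
      moreover have "f t v < \<epsilon>" if "v \<in> vertices K - \<sigma>" for v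
      proof -
        have "x v \<le> \<epsilon>" "0 \<le> x v"
          using that x(1,2) pointD(2)[OF x(1)] by (auto simp: sigma_min_def not_less[symmetric])
        then have "(1 - t) * x v \<le> (1 - t) * \<epsilon>"
          using t by (intro mult_left_mono) auto
        also have "\<dots> < \<epsilon>"
          using t pos by (simp add: algebra_simps)
        finally show ?thesis
          using that by (simp add: f_def c0)
      qed
      ultimately show ?thesis
        using fP t by (simp add: eps_cell_def)
    qed
    have "continuous_on (closure {0<..1}) f"
      unfolding f_def by (intro continuous_on_coordinatewise_then_product continuous_intros)
    moreover have "f ` {0<..1} \<subseteq> closure (eps_cell K \<epsilon> \<sigma>)"
      using fcell closure_subset by blast
    ultimately have "f ` closure {0<..1} \<subseteq> closure (eps_cell K \<epsilon> \<sigma>)"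
      by (intro image_closure_subset) auto
    moreover have "f 0 = x"
      by (simp add: f_def)
    ultimately have "x \<in> closure (eps_cell K \<epsilon> \<sigma>)"
      by (force simp: image_subset_iff)
    moreover have "eps_cell K \<epsilon> \<sigma> \<subseteq> P"
      by (auto simp: eps_cell_def)
    ultimately show "x \<in> X closure_of eps_cell K \<epsilon> \<sigma>"
      using x(1) by (simp add: closure_of_polytope_space)
  qed
qed

lemma eps_cell_nonempty:
  assumes \<sigma>: "\<sigma> \<in> K"
  shows "eps_cell K \<epsilon> \<sigma> \<noteq> {}"
proof -
  have "barycenter \<sigma> \<in> eps_cell K \<epsilon> \<sigma>"
    using barycenter_in[OF \<sigma>] barycenter_gt[OF \<sigma>] pos by (simp add: eps_cell_def) (simp add: barycenter_def)
  then show ?thesis by blast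
qed

text \<open>Strict inequalities persist nearby, so only coordinates equal to
  \<open>\<epsilon>\<close> can change sides.\<close>

lemma openin_sigma_nbhd:
  assumes x: "x \<in> P"
  obtains U where "openin X U" "x \<in> U" "\<And>y. y \<in> U \<Longrightarrow> y \<in> P \<and> lo x \<subseteq> lo y \<and> hi y \<subseteq> hi x"
proof
  let ?O = "(\<Inter>v\<in>lo x. {y::'v\<Rightarrow>real. \<epsilon> < y v}) \<inter> (\<Inter>v\<in>vertices K - hi x. {y. y v < \<epsilon>})"
  have fin: "finite (lo x)" "finite (vertices K - hi x)"
    using finite_vertices by (auto simp: sigma_min_def)
  have "open ?O"
  proof (intro open_Int open_INT ballI fin)
    show "open {y::'v\<Rightarrow>real. \<epsilon> < y v}" for v
      by (rule open_Collect_less[OF continuous_on_const continuous_on_coordinate])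
    show "open {y::'v\<Rightarrow>real. y v < \<epsilon>}" for v
      by (rule open_Collect_less[OF continuous_on_coordinate continuous_on_const])
  qed
  then show "openin X (P \<inter> ?O)"
    by (rule openin_polytope_space)
  show "x \<in> P \<inter> ?O"
    using x by (auto simp: sigma_min_def sigma_max_def)
  show "y \<in> P \<and> lo x \<subseteq> lo y \<and> hi y \<subseteq> hi x" if "y \<in> P \<inter> ?O" for y
    using that unfolding sigma_min_def sigma_max_def by force
qed

section \<open>The block: frontier, exit set, invariant part and homology\<close>

context
  fixes V :: "'v set set set" and S :: "'v set set" and \<phi> :: "real \<Rightarrow> ('v \<Rightarrow> real) \<Rightarrow> 'v \<Rightarrow> real"
  assumes V: "combinatorial_vector_field K V" and S: "comb_isolated_invariant K V S"
    and sf: "semiflow X \<phi>" and adm: "admissible K V \<epsilon> \<phi>"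
begin

abbreviation "B \<equiv> \<Union>\<sigma>\<in>S. X closure_of eps_cell K \<epsilon> \<sigma>"

lemma block_iff: "x \<in> B \<longleftrightarrow> x \<in> P \<and> (\<exists>\<sigma>\<in>S. lo x \<subseteq> \<sigma> \<and> \<sigma> \<subseteq> hi x)"
proof -
  have "x \<in> X closure_of eps_cell K \<epsilon> \<sigma> \<longleftrightarrow> x \<in> P \<and> lo x \<subseteq> \<sigma> \<and> \<sigma> \<subseteq> hi x" if "\<sigma> \<in> S" for \<sigma>
    using closure_eps_cell[of \<sigma>] isolated_invariant_subset[OF V S] that by auto
  then show ?thesis by auto
qed

lemma closedin_block: "closedin X B"
  using finite_subset[OF isolated_invariant_subset[OF V S] finite_complex] by (intro closedin_Union) auto

text \<open>The open cells of all simplices between \<open>lo x\<close> and \<open>hi x\<close>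
  accumulate at \<open>x\<close>, so one that is missing from \<open>S\<close> gives points outside
  \<open>B\<close> arbitrarily near. If none is missing, then \<open>lo y\<close> is in
  \<open>S\<close> for all \<open>y\<close> near \<open>x\<close>.\<close>

lemma interior_block_iff: "x \<in> X interior_of B \<longleftrightarrow> x \<in> P \<and> (\<forall>\<sigma>. lo x \<subseteq> \<sigma> \<and> \<sigma> \<subseteq> hi x \<longrightarrow> \<sigma> \<in> S)"
proof
  assume x: "x \<in> X interior_of B"
  have xP: "x \<in> P"
    by (rule subsetD[OF interior_of_subset_topspace x])
  have "\<sigma> \<in> S" if \<sigma>: "lo x \<subseteq> \<sigma>" "\<sigma> \<subseteq> hi x" for \<sigma>
  proof (rule ccontr)
    assume "\<sigma> \<notin> S"
    have \<sigma>K: "\<sigma> \<in> K"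
      using sigma_between[OF xP \<sigma>] by simp
    have "x \<in> X closure_of eps_cell K \<epsilon> \<sigma>"
      using closure_eps_cell[OF \<sigma>K] xP \<sigma> by simp
    then have "\<forall>T. x \<in> T \<and> openin X T \<longrightarrow> (\<exists>y. y \<in> eps_cell K \<epsilon> \<sigma> \<and> y \<in> T)"
      unfolding in_closure_of by (rule conjunct2)
    then obtain y where y: "y \<in> eps_cell K \<epsilon> \<sigma>" "y \<in> X interior_of B"
      using x openin_interior_of[of X B] by meson
    have "y \<in> B"
      by (rule subsetD[OF interior_of_subset y(2)])
    moreover have "lo y = \<sigma>" "hi y = \<sigma>"
      using y(1) eps_cell_iff[OF simplex_vertices[OF \<sigma>K]] by auto
    ultimately have "\<sigma> \<in> S"
      unfolding block_iff by auto
    then show False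
      using \<open>\<sigma> \<notin> S\<close> by simp
  qed
  then show "x \<in> P \<and> (\<forall>\<sigma>. lo x \<subseteq> \<sigma> \<and> \<sigma> \<subseteq> hi x \<longrightarrow> \<sigma> \<in> S)"
    using xP by blast
next
  assume x: "x \<in> P \<and> (\<forall>\<sigma>. lo x \<subseteq> \<sigma> \<and> \<sigma> \<subseteq> hi x \<longrightarrow> \<sigma> \<in> S)"
  then obtain U where U: "openin X U" "x \<in> U" "\<And>y. y \<in> U \<Longrightarrow> y \<in> P \<and> lo x \<subseteq> lo y \<and> hi y \<subseteq> hi x"
    using openin_sigma_nbhd by blast
  have "U \<subseteq> B"
  proof
    fix y assume y: "y \<in> U"
    then have "lo y \<in> S"
      using U(3)[OF y] x sigma_min_le_max[of y] by blast
    then show "y \<in> B"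
      unfolding block_iff using U(3)[OF y] sigma_min_le_max[of y] by blast
  qed
  then show "x \<in> X interior_of B"
    using U(1,2) by (auto simp: interior_of_def)
qed

lemma cell_in_interior:
  assumes "\<sigma> \<in> S" "y \<in> eps_cell K \<epsilon> \<sigma>"
  shows "y \<in> X interior_of B"
proof -
  have "\<sigma> \<subseteq> vertices K"
    using assms(1) isolated_invariant_subset[OF V S] simplex_vertices by blast
  then show ?thesis
    unfolding interior_block_iff using eps_cell_iff assms by auto
qed

lemma cell_outside:
  assumes "\<sigma> \<in> K" "\<sigma> \<notin> S" "y \<in> eps_cell K \<epsilon> \<sigma>"
  shows "y \<notin> B"
  unfolding block_iff using eps_cell_iff[OF simplex_vertices[OF assms(1)]] assms by auto

lemma flow_tile_in_block: "\<sigma> \<in> S \<Longrightarrow> flow_tile K V \<epsilon> \<sigma> \<subseteq> B"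
  unfolding flow_tile_def using lower_upper_simplex_in[OF V S] by blast

text \<open>
  By arrow compatibility the block is a union of flow tiles, so a frontier point lies in a tile inside
  the block and in another one outside it.
\<close>

lemma frontier_solution:
  assumes x: "x \<in> X frontier_of B" and t: "t1 \<le> 0" "0 < t2"
    and \<gamma>: "flow_solution X \<phi> {t1..t2} \<gamma>" "\<gamma> 0 = x"
  obtains U where "openin (top_of_set {t1..t2}) U" "0 \<in> U"
    "\<And>t. t \<in> U \<Longrightarrow> t < 0 \<Longrightarrow> \<gamma> t \<in> eps_cell K \<epsilon> (hi x)"
    "\<And>t. t \<in> U \<Longrightarrow> t > 0 \<Longrightarrow> \<gamma> t \<in> eps_cell K \<epsilon> (lo x)"
proof -
  have xB: "x \<in> B" and xi: "x \<notin> X interior_of B"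
    using x closedin_block by (auto simp: frontier_of_def closure_of_closedin)
  obtain \<sigma> where \<sigma>: "\<sigma> \<in> S" "lo x \<subseteq> \<sigma>" "\<sigma> \<subseteq> hi x" and xP: "x \<in> P"
    using xB block_iff by blast
  obtain \<tau> where \<tau>: "\<tau> \<notin> S" "lo x \<subseteq> \<tau>" "\<tau> \<subseteq> hi x"
    using xi xP interior_block_iff by blast
  have K: "\<sigma> \<in> K" "\<tau> \<in> K"
    using sigma_between(1)[OF xP] \<sigma> \<tau> by auto
  have tile: "x \<in> flow_tile K V \<epsilon> \<rho>" if "\<rho> \<in> K" "lo x \<subseteq> \<rho>" "\<rho> \<subseteq> hi x" for \<rho>
    using flow_tile_superset[OF V refl, of \<epsilon> \<rho>] closure_eps_cell[OF that(1)] xP that by auto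
  \<comment> \<open>A point of the open cell of \<open>\<tau>\<close> is outside \<open>B\<close>,
    hence outside the tile of \<open>\<sigma>\<close>.\<close>
  have "flow_tile K V \<epsilon> \<sigma> \<noteq> flow_tile K V \<epsilon> \<tau>"
  proof -
    obtain y where y: "y \<in> eps_cell K \<epsilon> \<tau>"
      using eps_cell_nonempty[OF K(2)] by blast
    moreover have "eps_cell K \<epsilon> \<tau> \<subseteq> P"
      by (auto simp: eps_cell_def)
    ultimately have "y \<in> flow_tile K V \<epsilon> \<tau>"
      using flow_tile_superset[OF V refl, of \<epsilon> \<tau>] closure_of_subset[of "eps_cell K \<epsilon> \<tau>" X] by blast
    moreover have "y \<notin> flow_tile K V \<epsilon> \<sigma>"
      using cell_outside[OF K(2) \<tau>(1) y] flow_tile_in_block[OF \<sigma>(1)] by blast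
    ultimately show ?thesis by blast
  qed
  then have "\<exists>C\<in>flow_tiles K V \<epsilon>. \<exists>D\<in>flow_tiles K V \<epsilon>. C \<noteq> D \<and> x \<in> C \<and> x \<in> D"
    unfolding flow_tiles_def using K tile \<sigma> \<tau> by blast
  then have "\<exists>U. openin (top_of_set {t1..t2}) U \<and> 0 \<in> U \<and>
             (\<forall>t\<in>U. t < 0 \<longrightarrow> \<gamma> t \<in> eps_cell K \<epsilon> (hi x)) \<and>
             (\<forall>t\<in>U. t > 0 \<longrightarrow> \<gamma> t \<in> eps_cell K \<epsilon> (lo x))"
    using adm[unfolded admissible_def, rule_format, OF xP, of t1 t2 \<gamma>] t \<gamma> by blast
  then show thesis
    using that by blast
qed

lemma nbhd_in_openin: "openin Y U \<Longrightarrow> x \<in> U \<Longrightarrow> nbhd_in Y x U"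
  by (simp add: nbhd_in_def interior_of_openin openin_subset)

lemma frontier_point:
  assumes "x \<in> X frontier_of B"
  shows "x \<in> P" "x \<in> B" "lo x \<in> K" "hi x \<in> K" "lo x \<notin> S \<or> hi x \<notin> S"
proof -
  show xB: "x \<in> B"
    using assms closedin_block by (auto simp: frontier_of_def closure_of_closedin)
  then show xP: "x \<in> P"
    using block_iff by blast
  show "lo x \<in> K" "hi x \<in> K"
    using sigma_between(1)[OF xP] sigma_min_le_max[of x] by auto
  have "x \<notin> X interior_of B"
    using assms by (simp add: frontier_of_def)
  then obtain \<tau> where \<tau>: "\<tau> \<notin> S" "lo x \<subseteq> \<tau>" "\<tau> \<subseteq> hi x"
    using xP interior_block_iff by blast
  have "lo x \<noteq> {}"
    using sigma_between(2)[OF xP order_refl sigma_min_le_max] .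
  then show "lo x \<notin> S \<or> hi x \<notin> S"
    using invariant_convex[OF V S _ _ \<tau>(2,3)] \<tau>(1) by blast
qed

lemma strict_egressI:
  assumes x: "x \<in> X frontier_of B" and "lo x \<notin> S" "hi x \<in> S"
  shows "x \<in> strict_egress X \<phi> B"
  unfolding strict_egress_def
proof (intro CollectI conjI allI impI x)
  fix t1 t2 \<gamma> assume *: "t1 \<le> 0 \<and> 0 < t2 \<and> flow_solution X \<phi> {t1..t2} \<gamma> \<and> \<gamma> 0 = x"
  obtain U where U: "openin (top_of_set {t1..t2}) U" "0 \<in> U"
    "\<And>t. t \<in> U \<Longrightarrow> t < 0 \<Longrightarrow> \<gamma> t \<in> eps_cell K \<epsilon> (hi x)"
    "\<And>t. t \<in> U \<Longrightarrow> t > 0 \<Longrightarrow> \<gamma> t \<in> eps_cell K \<epsilon> (lo x)"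
    by (rule frontier_solution[OF x, of t1 t2 \<gamma>]) (use * in auto)
  show "\<exists>J. nbhd_in (top_of_set {t1..t2}) 0 J \<and>
          (\<forall>t\<in>J. t > 0 \<longrightarrow> \<gamma> t \<notin> B) \<and> (\<forall>t\<in>J. t < 0 \<longrightarrow> \<gamma> t \<in> X interior_of B)"
  proof (intro exI[of _ U] conjI ballI impI)
    show "nbhd_in (top_of_set {t1..t2}) 0 U"
      by (rule nbhd_in_openin[OF U(1,2)])
    show "\<gamma> t \<notin> B" if "t \<in> U" "t > 0" for t
      by (rule cell_outside[OF frontier_point(3)[OF x] assms(2) U(4)[OF that]])
    show "\<gamma> t \<in> X interior_of B" if "t \<in> U" "t < 0" for t
      by (rule cell_in_interior[OF assms(3) U(3)[OF that]])
  qed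
qed

lemma strict_ingressI:
  assumes x: "x \<in> X frontier_of B" and "lo x \<in> S" "hi x \<notin> S"
  shows "x \<in> strict_ingress X \<phi> B"
  unfolding strict_ingress_def
proof (intro CollectI conjI allI impI x)
  fix t1 t2 \<gamma> assume *: "t1 \<le> 0 \<and> 0 < t2 \<and> flow_solution X \<phi> {t1..t2} \<gamma> \<and> \<gamma> 0 = x"
  obtain U where U: "openin (top_of_set {t1..t2}) U" "0 \<in> U"
    "\<And>t. t \<in> U \<Longrightarrow> t < 0 \<Longrightarrow> \<gamma> t \<in> eps_cell K \<epsilon> (hi x)"
    "\<And>t. t \<in> U \<Longrightarrow> t > 0 \<Longrightarrow> \<gamma> t \<in> eps_cell K \<epsilon> (lo x)"
    by (rule frontier_solution[OF x, of t1 t2 \<gamma>]) (use * in auto)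
  show "\<exists>J. nbhd_in (top_of_set {t1..t2}) 0 J \<and>
          (\<forall>t\<in>J. t > 0 \<longrightarrow> \<gamma> t \<in> X interior_of B) \<and> (\<forall>t\<in>J. t < 0 \<longrightarrow> \<gamma> t \<notin> B)"
  proof (intro exI[of _ U] conjI ballI impI)
    show "nbhd_in (top_of_set {t1..t2}) 0 U"
      by (rule nbhd_in_openin[OF U(1,2)])
    show "\<gamma> t \<in> X interior_of B" if "t \<in> U" "t > 0" for t
      by (rule cell_in_interior[OF assms(2) U(4)[OF that]])
    show "\<gamma> t \<notin> B" if "t \<in> U" "t < 0" for t
      by (rule cell_outside[OF frontier_point(4)[OF x] assms(3) U(3)[OF that]])
  qed
qed

lemma bounce_offI:
  assumes x: "x \<in> X frontier_of B" and "lo x \<notin> S" "hi x \<notin> S"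
  shows "x \<in> bounce_off X \<phi> B"
  unfolding bounce_off_def
proof (intro CollectI conjI allI impI x)
  fix t1 t2 \<gamma> assume *: "t1 \<le> 0 \<and> 0 < t2 \<and> flow_solution X \<phi> {t1..t2} \<gamma> \<and> \<gamma> 0 = x"
  obtain U where U: "openin (top_of_set {t1..t2}) U" "0 \<in> U"
    "\<And>t. t \<in> U \<Longrightarrow> t < 0 \<Longrightarrow> \<gamma> t \<in> eps_cell K \<epsilon> (hi x)"
    "\<And>t. t \<in> U \<Longrightarrow> t > 0 \<Longrightarrow> \<gamma> t \<in> eps_cell K \<epsilon> (lo x)"
    by (rule frontier_solution[OF x, of t1 t2 \<gamma>]) (use * in auto)
  show "\<exists>J. nbhd_in (top_of_set {t1..t2}) 0 J \<and> (\<forall>t\<in>J - {0}. \<gamma> t \<notin> B)"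
  proof (intro exI[of _ U] conjI ballI)
    show "nbhd_in (top_of_set {t1..t2}) 0 U"
      by (rule nbhd_in_openin[OF U(1,2)])
    show "\<gamma> t \<notin> B" if "t \<in> U - {0}" for t
    proof (cases "t < 0")
      case True
      then show ?thesis
        using cell_outside[OF frontier_point(4)[OF x] assms(3) U(3)] that by blast
    next
      case False
      then show ?thesis
        using cell_outside[OF frontier_point(3)[OF x] assms(2) U(4)] that by force
    qed
  qed
qed

text \<open>The conditions on exit points quantify over solutions. That every point has at least
  this one makes them informative, so that \<open>lo x \<notin> S\<close> can be derived from
  them.\<close>

lemma forward_solution:
  assumes x: "x \<in> P"
  shows "flow_solution X \<phi> {0..1} (\<lambda>t. \<phi> t x)"
  using continuous_semiflow[OF sf] x sf
  by (auto simp: flow_solution_def semiflow_def is_interval_1 continuous_map_def Pi_iff)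

lemma exit_set_iff: "x \<in> exit_set X \<phi> B \<longleftrightarrow> x \<in> B \<and> lo x \<notin> S"
proof
  assume e: "x \<in> exit_set X \<phi> B"
  then have x: "x \<in> X frontier_of B"
    by (auto simp: exit_set_def strict_egress_def bounce_off_def)
  have xP: "x \<in> P" and xB: "x \<in> B"
    using frontier_point[OF x] by auto
  have sol: "flow_solution X \<phi> {0..1} (\<lambda>t. \<phi> t x)" and init: "\<phi> 0 x = x"
    using forward_solution[OF xP] sf xP by (auto simp: semiflow_def)
  have e1: "\<exists>J. nbhd_in (top_of_set {0..1}) 0 J \<and> (\<forall>t\<in>J. t > 0 \<longrightarrow> \<phi> t x \<notin> B)"
  proof (cases "x \<in> strict_egress X \<phi> B")
    case True
    then have "\<exists>J. nbhd_in (top_of_set {0..1}) 0 J \<and> (\<forall>t\<in>J. t > 0 \<longrightarrow> \<phi> t x \<notin> B) \<and>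
        (\<forall>t\<in>J. t < 0 \<longrightarrow> \<phi> t x \<in> X interior_of B)"
      unfolding strict_egress_def using sol init
      by (elim CollectE conjE allE[of _ 0] allE[of _ 1] allE[of _ "\<lambda>t. \<phi> t x"]) auto
    then show ?thesis by blast
  next
    case False
    then have "x \<in> bounce_off X \<phi> B"
      using e by (simp add: exit_set_def)
    then have "\<exists>J. nbhd_in (top_of_set {0..1}) 0 J \<and> (\<forall>t\<in>J - {0}. \<phi> t x \<notin> B)"
      unfolding bounce_off_def using sol init
      by (elim CollectE conjE allE[of _ 0] allE[of _ 1] allE[of _ "\<lambda>t. \<phi> t x"]) auto
    then show ?thesis by blast
  qed
  then obtain J where J: "0 \<in> top_of_set {0..1} interior_of J" "\<And>t. t \<in> J \<Longrightarrow> t > 0 \<Longrightarrow> \<phi> t x \<notin> B"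
    by (auto simp: nbhd_in_def)
  obtain U where U: "openin (top_of_set {0..1}) U" "0 \<in> U"
    "\<And>t. t \<in> U \<Longrightarrow> t > 0 \<Longrightarrow> \<phi> t x \<in> eps_cell K \<epsilon> (lo x)"
    by (rule frontier_solution[OF x _ _ sol init]) auto
  \<comment> \<open>The neighborhood from the exit condition and the one from admissibility share a
    positive time; at that time the orbit is outside \<open>B\<close> and in the cell of
    \<open>lo x\<close>.\<close>
  have "openin (top_of_set {0..1}) (U \<inter> top_of_set {0..1} interior_of J)"
    using U(1) by (intro openin_Int) auto
  then obtain t where t: "t \<in> U" "t \<in> top_of_set {0..1} interior_of J" "0 < t"
    using openin_interval_pos[of 0 1 "U \<inter> top_of_set {0..1} interior_of J"] U(2) J(1) by auto
  have "t \<in> J"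
    by (rule subsetD[OF interior_of_subset t(2)])
  then have "\<phi> t x \<notin> B"
    using J(2) t(3) by blast
  moreover have "\<phi> t x \<in> eps_cell K \<epsilon> (lo x)"
    by (rule U(3)[OF t(1,3)])
  ultimately have "lo x \<notin> S"
    using subsetD[OF interior_of_subset cell_in_interior] by metis
  then show "x \<in> B \<and> lo x \<notin> S"
    using xB by blast
next
  assume x: "x \<in> B \<and> lo x \<notin> S"
  then have xB: "x \<in> B" by blast
  have "x \<notin> X interior_of B"
    using x sigma_min_le_max[of x] unfolding interior_block_iff by blast
  then have "x \<in> X frontier_of B"
    using xB closedin_block by (simp only: frontier_of_def closure_of_closedin) blast
  then show "x \<in> exit_set X \<phi> B"
    using strict_egressI bounce_offI x unfolding exit_set_def by blast
qed

lemma exit_set_eq: "exit_set X \<phi> B = B \<inter> superlevel K \<epsilon> (mouth S)"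
proof -
  have "lo x \<notin> S \<longleftrightarrow> x \<in> superlevel K \<epsilon> (mouth S)" if x: "x \<in> B" for x
  proof -
    obtain \<sigma> where \<sigma>: "\<sigma> \<in> S" "lo x \<subseteq> \<sigma>" and xP: "x \<in> P"
      using x block_iff by blast
    have "lo x \<in> simplicial_closure S"
      using face_in_simplicial_closure[OF \<sigma>(1) sigma_between(2)[OF xP order_refl sigma_min_le_max] \<sigma>(2)] .
    then show ?thesis
      using xP by (simp add: superlevel_sigma_min mouth_def)
  qed
  then show ?thesis
    using exit_set_iff by blast
qed

lemma block_cover: "superlevel K \<epsilon> (simplicial_closure S) = B \<union> superlevel K \<epsilon> (mouth S)"
proof
  show "superlevel K \<epsilon> (simplicial_closure S) \<subseteq> B \<union> superlevel K \<epsilon> (mouth S)"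
  proof
    fix x assume "x \<in> superlevel K \<epsilon> (simplicial_closure S)"
    then have x: "x \<in> P" "lo x \<in> simplicial_closure S"
      by (auto simp: superlevel_sigma_min)
    show "x \<in> B \<union> superlevel K \<epsilon> (mouth S)"
    proof (cases "lo x \<in> S")
      case True
      then have "x \<in> B"
        unfolding block_iff using x sigma_min_le_max[of x] by blast
      then show ?thesis by blast
    next
      case False
      then show ?thesis
        using x by (simp add: superlevel_sigma_min mouth_def)
    qed
  qed
  have "x \<in> superlevel K \<epsilon> (simplicial_closure S)" if x: "x \<in> B" for x
  proof -
    obtain \<sigma> where \<sigma>: "\<sigma> \<in> S" "lo x \<subseteq> \<sigma>" and xP: "x \<in> P"
      using x block_iff by blast
    have "lo x \<in> simplicial_closure S"
      using face_in_simplicial_closure[OF \<sigma>(1) sigma_between(2)[OF xP order_refl sigma_min_le_max] \<sigma>(2)] .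
    then show ?thesis
      using xP by (simp add: superlevel_sigma_min)
  qed
  then show "B \<union> superlevel K \<epsilon> (mouth S) \<subseteq> superlevel K \<epsilon> (simplicial_closure S)"
    using superlevel_mono[OF mouth_subset_closure[of S]] by blast
qed

lemma isolating_block_block: "isolating_block X \<phi> B"
  unfolding isolating_block_def
proof (intro conjI)
  show "closedin X B"
    by (rule closedin_block)
  show "X frontier_of B = strict_egress X \<phi> B \<union> strict_ingress X \<phi> B \<union> bounce_off X \<phi> B"
  proof
    show "X frontier_of B \<subseteq> strict_egress X \<phi> B \<union> strict_ingress X \<phi> B \<union> bounce_off X \<phi> B"
      using strict_egressI strict_ingressI bounce_offI frontier_point(5) by blast
  qed (auto simp: strict_egress_def strict_ingress_def bounce_off_def)
  show "closedin X (exit_set X \<phi> B)"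
    unfolding exit_set_eq by (intro closedin_Int closedin_block closedin_superlevel[OF lev down_closed_mouth[OF V S]])
qed

text \<open>A full solution in \<open>B\<close> through a frontier point would visit the cells of
  \<open>hi x\<close> and \<open>lo x\<close> inside \<open>B\<close>. Both simplices would then
  belong to \<open>S\<close>, which \<open>frontier_point\<close> excludes.\<close>

lemma Inv_block_interior: "Inv X \<phi> B \<subseteq> X interior_of B"
proof
  fix x assume "x \<in> Inv X \<phi> B"
  then obtain \<gamma> where \<gamma>: "flow_solution X \<phi> UNIV \<gamma>" "\<gamma> 0 = x" "range \<gamma> \<subseteq> B" and xB: "x \<in> B"
    unfolding Inv_def by blast
  show "x \<in> X interior_of B"
  proof (rule ccontr)
    assume "x \<notin> X interior_of B"
    then have x: "x \<in> X frontier_of B"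
      using xB closedin_block by (simp only: frontier_of_def closure_of_closedin) blast
    have sol: "flow_solution X \<phi> {-1..1} \<gamma>"
      using \<gamma>(1) by (auto simp: flow_solution_def is_interval_1)
    obtain U where U: "openin (top_of_set {-1..1}) U" "0 \<in> U"
      "\<And>t. t \<in> U \<Longrightarrow> t < 0 \<Longrightarrow> \<gamma> t \<in> eps_cell K \<epsilon> (hi x)"
      "\<And>t. t \<in> U \<Longrightarrow> t > 0 \<Longrightarrow> \<gamma> t \<in> eps_cell K \<epsilon> (lo x)"
      by (rule frontier_solution[OF x _ _ sol \<gamma>(2)]) auto
    obtain t where t: "t \<in> U" "0 < t"
      by (rule openin_interval_pos[OF U(1,2)]) auto
    obtain s where s: "s \<in> U" "s < 0"
      by (rule openin_interval_neg[OF U(1,2)]) auto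
    have "\<gamma> t \<in> B" "\<gamma> s \<in> B"
      using \<gamma>(3) by blast+
    then have "lo x \<in> S" "hi x \<in> S"
      using cell_outside[OF frontier_point(3)[OF x] _ U(4)[OF t]]
        cell_outside[OF frontier_point(4)[OF x] _ U(3)[OF s]] by blast+
    then show False
      using frontier_point(5)[OF x] by blast
  qed
qed

lemma Inv_Inv_block: "Inv X \<phi> (Inv X \<phi> B) = Inv X \<phi> B"
proof
  show "Inv X \<phi> (Inv X \<phi> B) \<subseteq> Inv X \<phi> B"
    by (auto simp: Inv_def)
  show "Inv X \<phi> B \<subseteq> Inv X \<phi> (Inv X \<phi> B)"
  proof
    fix x assume x: "x \<in> Inv X \<phi> B"
    then obtain \<gamma> where \<gamma>: "flow_solution X \<phi> UNIV \<gamma>" "\<gamma> 0 = x" "range \<gamma> \<subseteq> B"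
      unfolding Inv_def by blast
    have "\<gamma> a \<in> Inv X \<phi> B" for a
    proof -
      have "flow_solution X \<phi> UNIV (\<lambda>t. \<gamma> (t + a))"
        using \<gamma>(1) by (auto simp: flow_solution_def add.assoc)
      then show ?thesis
        unfolding Inv_def using \<gamma>(3) by (intro CollectI conjI exI[of _ "\<lambda>t. \<gamma> (t + a)"]) auto
    qed
    then show "x \<in> Inv X \<phi> (Inv X \<phi> B)"
      unfolding Inv_def[of X \<phi> "Inv X \<phi> B"] using x \<gamma> by blast
  qed
qed

lemma flow_isolated_invariant_block: "flow_isolated_invariant X \<phi> (Inv X \<phi> B)"
  unfolding flow_isolated_invariant_def
  using closedin_Inv[OF sf closedin_block] Inv_Inv_block closedin_block Inv_block_interior by blast

text \<open>Coordinates at most \<open>\<epsilon>\<close> are fixed and the others stay at least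
  \<open>\<epsilon>\<close>. So \<open>lo\<close> cannot grow, \<open>hi\<close> cannot shrink, and
  each closed cell is preserved.\<close>

lemma squeeze_homotopy_block:
  assumes b: "\<epsilon> \<le> b" "admissible_level K b" and x: "x \<in> B" and t: "0 \<le> t" "t \<le> 1"
  shows "squeeze_homotopy K \<epsilon> b t x \<in> B"
proof -
  let ?y = "squeeze_homotopy K \<epsilon> b t x"
  obtain \<sigma> where \<sigma>: "\<sigma> \<in> S" "lo x \<subseteq> \<sigma>" "\<sigma> \<subseteq> hi x" and xP: "x \<in> P"
    using x block_iff by blast
  have yP: "?y \<in> P"
    using squeeze_homotopy_in[OF less_imp_le[OF pos] b xP t] .
  have "lo ?y \<subseteq> \<sigma>"
  proof
    fix v assume v: "v \<in> lo ?y"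
    then have "v \<in> lo x"
      using squeeze_homotopy_fixed[OF less_imp_le[OF pos] b, of x v t] by (force simp: sigma_min_def)
    then show "v \<in> \<sigma>" using \<sigma>(2) by blast
  qed
  moreover have "\<sigma> \<subseteq> hi ?y"
    using \<sigma>(3) squeeze_homotopy_ge[OF less_imp_le[OF pos] b xP _ t] by (auto simp: sigma_max_def)
  ultimately show ?thesis
    unfolding block_iff using \<sigma>(1) yP by blast
qed

lemma homology_block:
  assumes r: "linear_order_on (vertices K) r"
  shows "simplicial_homology_group r p (simplicial_closure S) (mouth S)
    \<cong> relative_homology_group (int p) (subtopology X B) (exit_set X \<phi> B)"
proof -
  interpret ordered_polyhedron K r
    by standard (rule r)
  let ?L = "simplicial_closure S" and ?M = "mouth S"
  have L: "down_closed ?L" and M: "down_closed ?M" and MsubL: "?M \<subseteq> ?L"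
    by (rule down_closed_closure, rule down_closed_mouth[OF V S], rule mouth_subset_closure)
  have LK: "?L \<subseteq> K"
    using isolated_invariant_subset[OF V S] down_closedD[OF down_closed_complex]
    unfolding simplicial_closure_def is_face_def by blast
  obtain b where b: "\<epsilon> < b" "admissible_level K b"
    using admissible_level_larger[OF lev] .
  have e0: "0 \<le> \<epsilon>" using pos by simp
  have "simplicial_homology_group r p ?L ?M \<cong> relative_homology_group (int p) (space_of ?L) (superlevel K 0 ?M)"
    by (rule simplicial_iso_singular[OF L LK M MsubL])
  \<comment> \<open>Here the squeezing runs between the levels \<open>0\<close> and
    \<open>\<epsilon>\<close>; the excision that follows uses the levels \<open>\<epsilon>\<close>
    and \<open>b\<close>.\<close>
  also have "\<dots> \<cong> relative_homology_group (int p) (subtopology X (superlevel K \<epsilon> ?L)) (superlevel K \<epsilon> ?M)"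
  proof (rule is_isoI, rule inclusion_iso_squeeze[OF order_refl e0 lev])
    fix D x t assume D: "D \<in> {superlevel K 0 ?L, superlevel K \<epsilon> ?L, superlevel K 0 ?M, superlevel K \<epsilon> ?M}"
      and x: "x \<in> D" and t: "0 \<le> t" "t \<le> (1::real)"
    have inv: "squeeze_homotopy K 0 \<epsilon> t x \<in> superlevel K s N"
      if "down_closed N" "x \<in> superlevel K s N" "0 \<le> s" "s \<le> \<epsilon>" for s N
      by (rule squeeze_homotopy_superlevel[OF order_refl e0 lev that t])
    show "squeeze_homotopy K 0 \<epsilon> t x \<in> D"
      using D x inv[OF L, of 0] inv[OF L, of \<epsilon>] inv[OF M, of 0] inv[OF M, of \<epsilon>] e0 by auto
  qed (use squeeze_superlevel[OF order_refl e0 lev] L M superlevel_level_mono[OF lev _ e0] superlevel_mono[OF MsubL]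
      superlevel_subset in auto)
  also have "\<dots> \<cong> relative_homology_group (int p) (subtopology X B) (exit_set X \<phi> B)"
    unfolding exit_set_eq
    by (rule group.iso_sym[OF group_relative_homology_group], rule is_isoI,
        rule excision_closed[OF e0 b L M MsubL block_cover],
        rule squeeze_homotopy_block[OF less_imp_le[OF b(1)] b(2)])
  finally show ?thesis .
qed

end

end

end

theorem theorem2p1:
  fixes K :: "'v set set"
    and V :: "'v set set set"
    and S :: "'v set set"
    and \<epsilon> :: real
    and \<phi> :: "real \<Rightarrow> ('v \<Rightarrow> real) \<Rightarrow> ('v \<Rightarrow> real)"
  defines "X \<equiv> polytope_space K"
    and "B \<equiv> (\<Union>\<sigma>\<in>S. polytope_space K closure_of eps_cell K \<epsilon> \<sigma>)"
  assumes "abstract_simplicial_complex K"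
    and "combinatorial_vector_field K V"
    and "0 < \<epsilon>" and "\<epsilon> < 1 / (1 + real_of_int (complex_dim K))"
    and "comb_isolated_invariant K V S"
    and "semiflow X \<phi>" and "admissible K V \<epsilon> \<phi>"
  shows "isolating_block X \<phi> B \<and>
         flow_isolated_invariant X \<phi> (Inv X \<phi> B) \<and>
         (\<forall>r p. linear_order_on (vertices K) r \<longrightarrow>
            simplicial_homology_group r p (simplicial_closure S) (mouth S)
              \<cong> relative_homology_group (int p) (subtopology X B) (exit_set X \<phi> B))"
proof -
  interpret polyhedron K
    by standard fact
  have lev: "admissible_level K \<epsilon>"
    using admissible_levelI assms by blast
  note facts = \<open>0 < \<epsilon>\<close> lev \<open>combinatorial_vector_field K V\<close> \<open>comb_isolated_invariant K V S\<close>
    \<open>semiflow X \<phi>\<close>[unfolded X_def] \<open>admissible K V \<epsilon> \<phi>\<close>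
  show ?thesis
    unfolding X_def B_def
    using isolating_block_block[OF facts] flow_isolated_invariant_block[OF facts] homology_block[OF facts] by blast
qed

end
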